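(* Let $X=\{x_1,\ldots,x_n\}\subset\mathbb R^d$ be a pointset with aspect ratio $\Phi$, let $\epsilon,\delta>0$, and let $m$ divide $d$. Set $\Lambda=O(\log(d\log\Phi/(\epsilon\delta)))$ and $L=\log\Phi+\Lambda$. The $m$-block variant of QuadSketch runs in time $\tilde O(ndL)$ and produces a sketch of size $O(nd\Lambda+nm\log n)$ bits such that, for every $i\in[n]$, \[ \Pr\left[\forall j\in[n]:\ \|\tilde x_i-\tilde x_j\| = (1\pm\epsilon)\|x_i-x_j\| \right] \geq 1-m\delta. \]
   Context: Norms are Euclidean, logarithms are base 2, $[n]=\{1,\ldots,n\}$, $\tilde O$ suppresses polylogarithmic factors, $a=(1\pm\epsilon)b$ means $(1-\epsilon)b\le a\le(1+\epsilon)b$, and $\Phi=\max_{i<j}\|x_i-x_j\|/\min_{i<j}\|x_i-x_j\|$. QuadSketch (parameters $L$, $\Lambda$) on a pointset $y_1,\ldots,y_n\in\mathbb R^{d'}$: Step 1: let $\Delta=2^{\lceil\log\max_i\|y_1-y_i\|\rceil}$, let $H$ be the axis-parallel cube centered at $y_1$ of side $4\Delta$, shifted in each coordinate $k$ by independent uniform $\sigma_k\in[-\Delta,\Delta]$; $G_\ell$ is the grid of cell side $2^\ell$ aligned with $H$. Step 2: build the $2^{d'}$-ary tree with root $H$ in which each node (a cell of $G_\ell$) has as children the cells of $G_{\ell-1}$ inside it containing some input point, for $L$ levels; the edge to a child is labeled by the $d'$-bit string recording, per coordinate, whether the child is the lower (0) or upper (1) half. Each point lies in one leaf. Step 3: every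 maximal downward path $u_0,\ldots,u_k$ whose interior nodes have exactly one child, with $k>\Lambda+1$, is shortened by deleting $u_{\Lambda+1},\ldots,u_{k-1}$ and joining $u_k$ to $u_\Lambda$ by a "long edge" labeled $k-\Lambda$. The sketch stores this pruned tree with its labels and each point's leaf index. Decompression: the approximate point of a leaf is obtained, per coordinate, by concatenating the corresponding bits of short-edge labels from the root and zeros for the missing levels of long edges, read as a binary expansion (bit at level $\ell$ has weight $2^\ell$). The $m$-block variant: partition the $d$ coordinates into $m$ blocks $B_1,\ldots,B_m$ of size $d/m$, apply QuadSketch separately to the projected pointsets $(x_1)_{B_t},\ldots,(x_n)_{B_t}$ for each $t$, and let $\tilde x_i$ be the concatenation of the decompressed projections.
   Formalization: In Λ both logarithms are read as at least 1, and ε, δ above 1 count as 1 (for n=2, log Φ=0 and the formula is undefined); L uses ⌈log Φ⌉; the level of each block's root cell is given to decompression beside the stored bits and is not counted in the size. *)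

theory Defs
  imports "HOL-Probability.Probability" "HOL-Library.Log_Nat" "HOL-Library.Monad_Syntax"
begin

text \<open>
  Vectors are real lists and pointsets are lists of vectors (all coordinates, points and blocks are
  counted from 0, so the distinguished point of a block is the head of the list).
\<close>

definition vdist :: "real list \<Rightarrow> real list \<Rightarrow> real" where
  "vdist p q = L2_set (\<lambda>k. p ! k - q ! k) {..<length p}"

definition pair_dists :: "real list list \<Rightarrow> real set" where
  "pair_dists X = {vdist (X ! i) (X ! j) | i j. i < j \<and> j < length X}"

definition aspect_ratio :: "real list list \<Rightarrow> real" where
  "aspect_ratio X = Max (pair_dists X) / Min (pair_dists X)"


subsection \<open>Programs with running time\<close>

text \<open>
  A program is a value together with the number of steps spent on it. The unit-cost operations are
  those of a real RAM: arithmetic, comparison and base-2 logarithm with ceiling on reals,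
  arithmetic on machine words, array access, list constructors, drawing one random shift, and
  emitting one bit. A pure expression is preceded by a \<open>charge\<close> for these operations.
\<close>

datatype 'a tm = TM (val: 'a) (time: nat)

definition return :: "'a \<Rightarrow> 'a tm" where
  "return v = TM v 1"

definition bind_tm :: "'a tm \<Rightarrow> ('a \<Rightarrow> 'b tm) \<Rightarrow> 'b tm" where
  "bind_tm p f = TM (val (f (val p))) (time p + time (f (val p)))"

definition charge :: "nat \<Rightarrow> unit tm" where
  "charge c = TM () c"

adhoc_overloading Monad_Syntax.bind \<rightleftharpoons> bind_tm

lemma bind_tm_cong [fundef_cong]:
  assumes "p = q" and "\<And>v. v = val q \<Longrightarrow> f v = g v"
  shows "bind_tm p f = bind_tm q g"
  using assms by (simp add: bind_tm_def)

primrec mapM :: "('a \<Rightarrow> 'b tm) \<Rightarrow> 'a list \<Rightarrow> 'b list tm" where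
  "mapM f [] = return []"
| "mapM f (x # xs) = do { y \<leftarrow> f x; ys \<leftarrow> mapM f xs; return (y # ys) }"

lemma mapM_cong [fundef_cong]:
  assumes "xs = ys" and "\<And>x. x \<in> set ys \<Longrightarrow> f x = g x"
  shows "mapM f xs = mapM g ys"
proof -
  have "(\<And>x. x \<in> set ys \<Longrightarrow> f x = g x) \<Longrightarrow> mapM f ys = mapM g ys"
    by (induction ys) auto
  then show ?thesis using assms by simp
qed


subsection \<open>Step 1: the randomly shifted grid\<close>

definition radius :: "real list list \<Rightarrow> real" where
  "radius ys = Max ((\<lambda>y. vdist (hd ys) y) ` set ys)"

text \<open>
  If all points coincide (possible for a projected pointset), the logarithm of the radius is
  undefined and the side parameter is taken to be 1.
\<close>

definition log_Delta :: "real list list \<Rightarrow> int" where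
  "log_Delta ys = (if radius ys = 0 then 0 else \<lceil>log 2 (radius ys)\<rceil>)"

definition Delta :: "real list list \<Rightarrow> real" where
  "Delta ys = 2 powi log_Delta ys"

text \<open>The cell of side \<open>4 * Delta\<close> that is the root is a cell of the grid of this level.\<close>

definition root_level :: "real list list \<Rightarrow> int" where
  "root_level ys = log_Delta ys + 2"

text \<open>Coordinates of \<open>y\<close> relative to the lower corner of the shifted cube \<open>H\<close>.\<close>

definition rel_coords :: "real list list \<Rightarrow> (nat \<Rightarrow> real) \<Rightarrow> real list \<Rightarrow> real list" where
  "rel_coords ys \<sigma> y =
     map (\<lambda>k. y ! k - (hd ys ! k + \<sigma> k - 2 * Delta ys)) [0..<length (hd ys)]"


subsection \<open>Step 2: the quadtree\<close>

text \<open>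
  The cells containing a point \<open>z\<close> are recorded by the labels on its root-to-leaf path; \<open>s\<close> is the
  side of the current cell and \<open>z\<close> is relative to the lower corner of the current cell.
\<close>

primrec cell_labels :: "nat \<Rightarrow> real \<Rightarrow> real list \<Rightarrow> bool list list tm" where
  "cell_labels 0 s z = return []"
| "cell_labels (Suc l) s z = do {
     charge (2 * length z);
     let h = s / 2;
     labs \<leftarrow> cell_labels l h (map (\<lambda>a. if h \<le> a then a - h else a) z);
     return (map (\<lambda>a. h \<le> a) z # labs) }"

datatype edge = Short "bool list" | Long nat

datatype 'a qtree = Leaf 'a | Node "(edge \<times> 'a qtree) list"

definition branch :: "bool \<Rightarrow> (bool list \<times> 'b) list \<Rightarrow> (bool list \<times> 'b) list" where
  "branch b ps = map (apfst tl) (filter (\<lambda>(key, _). hd key = b) ps)"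

text \<open>
  Groups items by their keys, which are bit strings of length \<open>k\<close>, one bit at a time. Only
  nonempty groups are produced.
\<close>

fun group_by_key :: "nat \<Rightarrow> (bool list \<times> 'b) list \<Rightarrow> (bool list \<times> 'b list) list tm" where
  "group_by_key k [] = return []"
| "group_by_key 0 (p # ps) = do {
     charge (length (p # ps));
     return [([], map snd (p # ps))] }"
| "group_by_key (Suc k) (p # ps) = do {
     charge (4 * length (p # ps));
     lo \<leftarrow> group_by_key k (branch False (p # ps));
     hi \<leftarrow> group_by_key k (branch True (p # ps));
     charge (length lo + length hi);
     return (map (apfst (Cons False)) lo @ map (apfst (Cons True)) hi) }"

text \<open>
  Builds the tree of depth \<open>l\<close> on the given points; each point is a pair of its index and the
  labels on its remaining path. A leaf carries the indices of the points in it.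
\<close>

primrec build :: "nat \<Rightarrow> nat \<Rightarrow> (nat \<times> bool list list) list \<Rightarrow> nat list qtree tm" where
  "build d 0 ps = do { charge (length ps); return (Leaf (map fst ps)) }"
| "build d (Suc l) ps = do {
     charge (length ps);
     groups \<leftarrow> group_by_key d (map (\<lambda>(i, labs). (hd labs, (i, tl labs))) ps);
     cs \<leftarrow> mapM (\<lambda>(lab, qs). do { t \<leftarrow> build d l qs; return (Short lab, t) }) groups;
     return (Node cs) }"


subsection \<open>Step 3: pruning\<close>

text \<open>
  The edges \<open>e_1, ..., e_k\<close> of a path \<open>u_0, ..., u_k\<close> are given bottom-up as \<open>[e_k, ..., e_1]\<close>;
  \<open>attach\<close> returns the edge leaving \<open>u_0\<close> and the subtree below it, with \<open>t\<close> at \<open>u_k\<close>.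
\<close>

fun attach :: "edge list \<Rightarrow> 'a qtree \<Rightarrow> edge \<times> 'a qtree" where
  "attach [e] t = (e, t)"
| "attach (e # e' # es) t = attach (e' # es) (Node [(e, t)])"
| "attach [] t = undefined"

definition shorten :: "nat \<Rightarrow> edge list \<Rightarrow> edge list" where
  "shorten \<Lambda> es =
     (let k = length es in if k > \<Lambda> + 1 then Long (k - \<Lambda>) # drop (k - \<Lambda>) es else es)"

definition close_path :: "nat \<Rightarrow> edge list \<Rightarrow> 'a qtree \<Rightarrow> (edge \<times> 'a qtree) tm" where
  "close_path \<Lambda> es t = do {
     charge (3 * length es);
     return (attach (shorten \<Lambda> es) t) }"

text \<open>\<open>es\<close> lists bottom-up the edges from the start \<open>u_0\<close> of the current maximal path to the node.\<close>

fun prune_path :: "nat \<Rightarrow> edge list \<Rightarrow> 'a qtree \<Rightarrow> (edge \<times> 'a qtree) tm" where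
  "prune_path \<Lambda> es (Leaf b) = close_path \<Lambda> es (Leaf b)"
| "prune_path \<Lambda> es (Node [(e, t)]) = do { charge 1; prune_path \<Lambda> (e # es) t }"
| "prune_path \<Lambda> es (Node cs) = do {
     cs' \<leftarrow> mapM (\<lambda>(e, t). prune_path \<Lambda> [e] t) cs;
     close_path \<Lambda> es (Node cs') }"

fun prune :: "nat \<Rightarrow> 'a qtree \<Rightarrow> 'a qtree tm" where
  "prune \<Lambda> (Leaf b) = return (Leaf b)"
| "prune \<Lambda> (Node cs) = do {
     cs' \<leftarrow> mapM (\<lambda>(e, t). prune_path \<Lambda> [e] t) cs;
     return (Node cs') }"


subsection \<open>The sketch as a bit string\<close>

fun num_nodes :: "'a qtree \<Rightarrow> nat" where
  "num_nodes (Leaf b) = 1"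
| "num_nodes (Node cs) = 1 + sum_list (map (\<lambda>(e, t). num_nodes t) cs)"

fun leaves :: "'a qtree \<Rightarrow> 'a list" where
  "leaves (Leaf b) = [b]"
| "leaves (Node cs) = concat (map (\<lambda>(e, t). leaves t) cs)"

text \<open>Stores the position of each leaf in the array entries of the points in that leaf.\<close>

primrec number_leaves :: "nat list list \<Rightarrow> nat \<Rightarrow> (nat \<Rightarrow> nat) \<Rightarrow> (nat \<Rightarrow> nat) tm" where
  "number_leaves [] j a = return a"
| "number_leaves (b # bs) j a = do {
     charge (length b);
     number_leaves bs (Suc j) (\<lambda>i. if i \<in> set b then j else a i) }"

definition put_nat :: "nat \<Rightarrow> nat \<Rightarrow> bool list" where
  "put_nat w v = map (bit v) [0..<w]"

fun put_edge :: "nat \<Rightarrow> edge \<Rightarrow> bool list" where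
  "put_edge w (Short lab) = False # lab"
| "put_edge w (Long k) = True # put_nat w k"

text \<open>Depth-first traversal: \<open>True\<close> descends to the next child, \<open>False\<close> returns to the parent.\<close>

fun put_tree :: "nat \<Rightarrow> 'a qtree \<Rightarrow> bool list" where
  "put_tree w (Leaf b) = [False]"
| "put_tree w (Node cs) =
     concat (map (\<lambda>(e, t). True # put_edge w e @ put_tree w t) cs) @ [False]"

text \<open>\<open>floorlog 2 v\<close> bits suffice for the numbers \<open>0, ..., v\<close>.\<close>

abbreviation long_width :: "nat \<Rightarrow> nat" where
  "long_width L \<equiv> floorlog 2 L"

abbreviation index_width :: "nat \<Rightarrow> nat" where
  "index_width n \<equiv> floorlog 2 (n - 1)"

text \<open>
  The output is the bit string storing the pruned tree and the leaf indices, together with the level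
  of the root grid, the scale at which the bit string is to be read.
\<close>

definition quadsketch ::
    "nat \<Rightarrow> nat \<Rightarrow> real list list \<Rightarrow> (nat \<Rightarrow> real) \<Rightarrow> (int \<times> bool list) tm" where
  "quadsketch L \<Lambda> ys \<sigma> = do {
     let n = length ys;
     let d = length (hd ys);
     charge (4 * n * (d + 1));
     let s = 4 * Delta ys;
     charge (d + 4 * n * d);
     let zs = map (rel_coords ys \<sigma>) ys;
     labs \<leftarrow> mapM (cell_labels L s) zs;
     charge n;
     t \<leftarrow> build d L (zip [0..<n] labs);
     p \<leftarrow> prune \<Lambda> t;
     charge (num_nodes p);
     leaf_of \<leftarrow> number_leaves (leaves p) 0 (\<lambda>_. 0);
     charge (long_width L + index_width n + n);
     let bs = put_tree (long_width L) p
              @ concat (map (\<lambda>i. put_nat (index_width n) (leaf_of i)) [0..<n]);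
     charge (length bs);
     return (root_level ys, bs) }"


subsection \<open>The block variant\<close>

definition is_block_partition :: "nat \<Rightarrow> nat \<Rightarrow> nat list list \<Rightarrow> bool" where
  "is_block_partition d m Bs \<longleftrightarrow>
     length Bs = m \<and> (\<forall>B\<in>set Bs. length B = d div m) \<and>
     distinct (concat Bs) \<and> set (concat Bs) = {..<d}"

definition project :: "nat list \<Rightarrow> real list list \<Rightarrow> real list list" where
  "project B X = map (\<lambda>x. map ((!) x) B) X"

type_synonym sketch = "int list \<times> bool list"

text \<open>\<open>\<sigma> (t, k)\<close> is the shift in the \<open>k\<close>-th coordinate of block \<open>t\<close>.\<close>

definition block_quadsketch ::
    "nat \<Rightarrow> nat \<Rightarrow> nat list list \<Rightarrow> real list list \<Rightarrow> (nat \<times> nat \<Rightarrow> real) \<Rightarrow> sketch tm" where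
  "block_quadsketch L \<Lambda> Bs X \<sigma> = do {
     rs \<leftarrow> mapM (\<lambda>(t, B). do {
              charge (length X * (length B + 1));
              quadsketch L \<Lambda> (project B X) (\<lambda>k. \<sigma> (t, k)) }) (zip [0..<length Bs] Bs);
     charge (sum_list (map (\<lambda>(l, bs). 1 + length bs) rs));
     return (map fst rs, concat (map snd rs)) }"

definition shift_measure :: "nat list list \<Rightarrow> real list list \<Rightarrow> (nat \<times> nat \<Rightarrow> real) measure" where
  "shift_measure Bs X =
     PiM (SIGMA t:{..<length Bs}. {..<length (Bs ! t)})
       (\<lambda>(t, k). let D = Delta (project (Bs ! t) X) in uniform_measure lborel {- D .. D})"

text \<open>
  The size is that of the stored tree and leaf indices. The root levels only fix the units of the
  coordinates: rescaling the pointset by a power of two changes them and leaves the bits unchanged, so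
  no bound in terms of scale-invariant parameters could include them.
\<close>

definition sketch_bits :: "sketch \<Rightarrow> nat" where
  "sketch_bits S = length (snd S)"


subsection \<open>Decompression\<close>

definition get_nat :: "nat \<Rightarrow> bool list \<Rightarrow> nat" where
  "get_nat w bs = horner_sum of_bool 2 (take w bs)"

definition get_edge :: "nat \<Rightarrow> nat \<Rightarrow> bool list \<Rightarrow> edge \<times> bool list" where
  "get_edge d w bs =
     (if hd bs then (Long (get_nat w (tl bs)), drop w (tl bs))
      else (Short (take d (tl bs)), drop d (tl bs)))"

fun mk_tree :: "(edge \<times> unit qtree) list \<Rightarrow> unit qtree" where
  "mk_tree [] = Leaf ()"
| "mk_tree cs = Node cs"

text \<open>
  Inverse of \<open>put_tree\<close>: reads the children of a node and returns the unread rest. The first argument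
  bounds the recursion depth; the length of the bit string is always enough.
\<close>

fun get_children ::
    "nat \<Rightarrow> nat \<Rightarrow> nat \<Rightarrow> bool list \<Rightarrow> (edge \<times> unit qtree) list \<times> bool list" where
  "get_children (Suc f) d w (True # bs) =
     (let (e, bs1) = get_edge d w bs;
          (cs, bs2) = get_children f d w bs1;
          (rest, bs3) = get_children f d w bs2
      in ((e, mk_tree cs) # rest, bs3))"
| "get_children f d w bs = ([], tl bs)"

text \<open>For each block, the pruned tree and the list of leaf indices of the points.\<close>

fun get_blocks ::
    "nat \<Rightarrow> nat \<Rightarrow> nat list list \<Rightarrow> bool list \<Rightarrow> (unit qtree \<times> nat list) list" where
  "get_blocks L n [] bs = []"
| "get_blocks L n (B # Bs) bs =
     (let (cs, bs1) = get_children (length bs) (length B) (long_width L) bs;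
          w = index_width n
      in (mk_tree cs, map (\<lambda>i. get_nat w (drop (i * w) bs1)) [0..<n])
         # get_blocks L n Bs (drop (n * w) bs1))"

text \<open>
  The approximate points of the leaves, in depth-first order, relative to the corner of the root cell;
  \<open>l\<close> is the level of the current node and \<open>v\<close> the corner of its cell as far as known. The bit of a
  short edge has the weight of the level of the child. A long edge skips levels, whose bits are 0.
\<close>

fun leaf_points :: "int \<Rightarrow> real list \<Rightarrow> 'a qtree \<Rightarrow> real list list" where
  "leaf_points l v (Leaf b) = [v]"
| "leaf_points l v (Node cs) =
     concat (map (\<lambda>(e, t).
       case e of
         Short lab \<Rightarrow> leaf_points (l - 1) (map2 (\<lambda>a b. a + of_bool b * 2 powi (l - 1)) v lab) t
       | Long k \<Rightarrow> leaf_points (l - int k) v t) cs)"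

text \<open>
  The approximation of point \<open>i\<close>. Each block is translated by the corner of its root cell, which is
  the same for all points and does not affect distances between approximations.
\<close>

definition decompress :: "nat \<Rightarrow> nat \<Rightarrow> nat list list \<Rightarrow> sketch \<Rightarrow> nat \<Rightarrow> real list" where
  "decompress L n Bs S i =
     concat (map (\<lambda>(B, l, t, idx). leaf_points l (replicate (length B) 0) t ! (idx ! i))
       (zip Bs (zip (fst S) (get_blocks L n Bs (snd S)))))"


subsection \<open>Parameters\<close>

text \<open>
  The parameter \<open>Lambda\<close> is \<open>O(log(d log Phi / (eps delta)))\<close> with \<open>C\<close> the hidden constant. As usual
  inside \<open>O(log ...)\<close>, both logarithms are read as at least 1 (for instance \<open>log Phi = 0\<close> for two
  points), and accuracies and failure probabilities above 1 count as 1. The clipping is inactive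
  whenever \<open>Phi \<ge> 2\<close>, \<open>eps, delta \<le> 1\<close> and \<open>d log Phi \<ge> 2 eps delta\<close>.
\<close>

definition Lambda_param :: "real \<Rightarrow> nat \<Rightarrow> real \<Rightarrow> real \<Rightarrow> real \<Rightarrow> nat" where
  "Lambda_param C d \<Phi> \<epsilon> \<delta> =
     nat \<lceil>C * max 1 (log 2 (real d * max 1 (log 2 \<Phi>) / (min 1 \<epsilon> * min 1 \<delta>)))\<rceil>"

definition L_param :: "real \<Rightarrow> nat \<Rightarrow> nat" where
  "L_param \<Phi> \<Lambda> = nat \<lceil>log 2 \<Phi>\<rceil> + \<Lambda>"

end

theory Submission
  imports Defs
begin

text \<open>
  Fix a point. Relative to its randomly shifted grid, it stays at distance at least \<open>\<rho>\<close> times the cell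
  side from all grid lines of the \<open>L\<close> levels below the root, in all coordinates and all blocks at once, except
  with probability at most \<open>6 \<rho> d L\<close>. If another point leaves its cell first at the level of side \<open>h\<close>,
  the two are therefore at distance at least \<open>\<rho> h\<close>. The tree branches there, so a new path starts, and
  pruning keeps the next \<open>\<Lambda>\<close> levels: bits above that node cancel in the difference of the decompressed
  points, and the bits lost below it amount to at most \<open>2 h / 2 ^ \<Lambda>\<close>. What lies below the leaf level is
  at most the side of a leaf cell, hence at most \<open>8 / 2 ^ \<Lambda>\<close> times the minimum distance of the whole
  pointset, so that no bound on the aspect ratios of the projections is needed.

  For the size, the branching nodes cut the tree into at most \<open>2 n\<close> maximal paths, each of which keeps
  at most \<open>\<Lambda> + 1\<close> short edges and one long edge; \<open>L \<le> 2 ^ \<Lambda>\<close> makes the label of the latter \<open>O(\<Lambda>)\<close> bits.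
\<close>

subsection \<open>The quadtree\<close>

text \<open>Only the fixed point has to be padded. The other endpoint enters solely through the
  level at which it leaves the cell, so one event of the shifts serves all j at once, there is no
  union bound over the points, and \<Lambda> contains no log n.

  Errors are measured coordinate by coordinate against the distance D of the two points in all d
  dimensions, never against their distance inside a block, which may be zero or tiny. Adding up d
  coordinate errors costs one factor d; the margin \<rho> = min 1 \<delta> / (6 d L) costs a second
  factor d and a factor L. Accuracy thus requires 2 ^ \<Lambda> to exceed a constant times d^2 L /
  (\<epsilon> \<delta>), with \<epsilon> and \<delta> clipped at 1. This is circular, because L
  itself contains \<Lambda>. The circle is broken by giving half of the exponent to the factor
  \<Lambda> and the other half to a power of d log \<Phi> / (\<epsilon> \<delta>), which is where
  the constant 22 comes from.\<close>

lemma val_return [simp]: "val (return v) = v"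
  and time_return [simp]: "time (return v) = 1"
  and val_charge [simp]: "val (charge c) = ()"
  and time_charge [simp]: "time (charge c) = c"
  and val_bind [simp]: "val (bind_tm p f) = val (f (val p))"
  and time_bind [simp]: "time (bind_tm p f) = time p + time (f (val p))"
  by (simp_all add: return_def charge_def bind_tm_def)

lemma val_mapM [simp]: "val (mapM f xs) = map (\<lambda>x. val (f x)) xs"
  by (induction xs) auto

lemma time_mapM: "time (mapM f xs) = (\<Sum>x\<leftarrow>xs. time (f x)) + length xs + 1"
  by (induction xs) auto

lemma sum_list_linear:
  fixes f :: "'a \<Rightarrow> nat"
  shows "(\<Sum>x\<leftarrow>xs. a + b * f x) = a * length xs + b * (\<Sum>x\<leftarrow>xs. f x)"
  by (induction xs) (auto simp: algebra_simps)

section \<open>Grouping items by their keys\<close>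

lemma length_branch: "length (branch False ps) + length (branch True ps) = length ps"
  using sum_length_filter_compl[of "\<lambda>(key, _). hd key = False" ps]
  by (simp add: branch_def case_prod_unfold)

text \<open>The recursion strips one bit per level; keys of exactly this length keep
  \<open>hd\<close> and \<open>tl\<close> in \<open>branch\<close> away from the empty list.\<close>

definition keys_length :: "nat \<Rightarrow> (bool list \<times> 'b) list \<Rightarrow> bool" where
  "keys_length k ps \<longleftrightarrow> (\<forall>p\<in>set ps. length (fst p) = k)"

lemma set_branch:
  assumes "keys_length (Suc k) ps"
  shows "(key, x) \<in> set (branch b ps) \<longleftrightarrow> (b # key, x) \<in> set ps"
proof -
  have "key' = b # tl key'" if "(key', x) \<in> set ps" "hd key' = b" for key'
    using assms that by (cases key') (force simp: keys_length_def)+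
  then show ?thesis
    by (force simp: branch_def image_iff)
qed

lemma keys_length_branch:
  assumes "keys_length (Suc k) ps"
  shows "keys_length k (branch b ps)"
  unfolding keys_length_def
proof
  fix p
  assume "p \<in> set (branch b ps)"
  then have "(b # fst p, snd p) \<in> set ps"
    using set_branch[OF assms, of "fst p" "snd p" b] by simp
  then show "length (fst p) = k"
    using assms by (force simp: keys_length_def)
qed

text \<open>Each item goes to exactly one of the two branches, so the groups partition the items
  with multiplicity. The later counts of leaves, nodes and steps per level rest on this.\<close>

lemma group_by_key_lengths:
  assumes "keys_length k ps"
  shows "(\<Sum>g\<leftarrow>val (group_by_key k ps). length (snd g)) = length ps"
  using assms
proof (induction k ps rule: group_by_key.induct)
  case (3 k p ps)
  show ?case
    using 3(1)[OF refl keys_length_branch[OF 3(3)]] 3(2)[OF refl refl keys_length_branch[OF 3(3)]]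
      length_branch[of "p # ps"] by (simp add: o_def)
qed auto

lemma group_by_key_set:
  assumes "keys_length k ps" and "(key, qs) \<in> set (val (group_by_key k ps))"
  shows "length key = k \<and> qs \<noteq> [] \<and> set qs = {x. (key, x) \<in> set ps}"
  using assms
proof (induction k ps arbitrary: key rule: group_by_key.induct)
  case (2 p ps)
  have "fst y = []" if "y \<in> set (p # ps)" for y
    using 2(1) that by (auto simp: keys_length_def)
  then have "snd ` set (p # ps) = {x. ([], x) \<in> set (p # ps)}"
    by (force simp del: list.set)
  then show ?case using 2(2) by simp
next
  case (3 k p ps)
  have "set (val (group_by_key (Suc k) (p # ps))) =
      (\<Union>b. apfst (Cons b) ` set (val (group_by_key k (branch b (p # ps)))))"
    by (auto simp: UNIV_bool)
  then obtain b key' where key: "key = b # key'"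
    and mem: "(key', qs) \<in> set (val (group_by_key k (branch b (p # ps))))"
    using 3(4) by (auto simp del: group_by_key.simps)
  have "length key' = k \<and> qs \<noteq> [] \<and> set qs = {x. (key', x) \<in> set (branch b (p # ps))}"
  proof (cases b)
    case True
    then show ?thesis
      using 3(2)[OF refl refl keys_length_branch[OF 3(3)]] mem by simp
  next
    case False
    then show ?thesis
      using 3(1)[OF refl keys_length_branch[OF 3(3)]] mem by simp
  qed
  then show ?case
    using set_branch[OF 3(3), of key' _ b] key by simp
qed auto

lemma group_by_key_keys:
  assumes "keys_length k ps" and "(key, x) \<in> set ps"
  shows "\<exists>qs. (key, qs) \<in> set (val (group_by_key k ps)) \<and> x \<in> set qs"
  using assms
proof (induction k ps arbitrary: key rule: group_by_key.induct)
  case (2 p ps)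
  then show ?case by (force simp: keys_length_def)
next
  case (3 k p ps)
  obtain b key' where key: "key = b # key'"
    using 3(3,4) by (cases key) (force simp: keys_length_def)+
  have mem: "(key', x) \<in> set (branch b (p # ps))"
    using set_branch[OF 3(3), of key' x b] 3(4) key by auto
  have "\<exists>qs. (key', qs) \<in> set (val (group_by_key k (branch b (p # ps)))) \<and> x \<in> set qs"
  proof (cases b)
    case True
    then show ?thesis
      using 3(2)[OF refl refl keys_length_branch[OF 3(3)]] mem by simp
  next
    case False
    then show ?thesis
      using 3(1)[OF refl keys_length_branch[OF 3(3)]] mem by simp
  qed
  then obtain qs where "(key', qs) \<in> set (val (group_by_key k (branch b (p # ps))))" "x \<in> set qs"
    by blast
  then show ?case
    using key by (intro exI[of _ qs]) (cases b; simp add: image_iff rev_bexI)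
qed auto

text \<open>Prefixing is injective, and the prefixes \<open>False\<close> and \<open>True\<close>
  separate the two halves. This becomes the distinctness of sibling labels in the tree.\<close>

lemma group_by_key_distinct: "distinct (map fst (val (group_by_key k ps)))"
proof (induction k ps rule: group_by_key.induct)
  case (3 k p ps)
  have *: "map fst (map (apfst (Cons b)) gs) = map (Cons b) (map fst gs)" for b and gs :: "(bool list \<times> 'a list) list"
    by simp
  have "distinct (map (Cons b) keys) \<longleftrightarrow> distinct keys" for b :: bool and keys
    by (simp add: distinct_map)
  then show ?case
    using 3(1)[OF refl] 3(2)[OF refl refl] by (auto simp: * simp del: map_map)
qed auto

lemma group_by_key_nonempty:
  assumes "keys_length k ps" and "ps \<noteq> []"
  shows "val (group_by_key k ps) \<noteq> []"
proof -
  obtain key x where "(key, x) \<in> set ps"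
    using assms(2) by (cases ps) auto
  then show ?thesis
    using group_by_key_keys[OF assms(1)] by force
qed

text \<open>Groups are nonempty, so each of them uses up at least one item.\<close>

lemma length_group_by_key:
  assumes "keys_length k ps"
  shows "length (val (group_by_key k ps)) \<le> length ps"
proof -
  have "1 \<le> length (snd g)" if "g \<in> set (val (group_by_key k ps))" for g
    using group_by_key_set[OF assms, of "fst g" "snd g"] that by (simp add: Suc_le_eq)
  then have "(\<Sum>g\<leftarrow>val (group_by_key k ps). 1) \<le> (\<Sum>g\<leftarrow>val (group_by_key k ps). length (snd g))"
    by (intro sum_list_mono) auto
  then show ?thesis
    using group_by_key_lengths[OF assms] by (simp add: sum_list_triv)
qed

text \<open>One bit costs five steps per item: four for branching and one for collecting the groups.
  The remaining overhead of 2 per call on a nonempty list is charged to its items, which gives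
  7.\<close>

lemma time_group_by_key:
  assumes "keys_length k ps"
  shows "time (group_by_key k ps) \<le> 1 + 7 * length ps * (k + 1)"
  using assms
proof (induction k ps rule: group_by_key.induct)
  case (3 k p ps)
  let ?lo = "branch False (p # ps)" and ?hi = "branch True (p # ps)"
  note keys = keys_length_branch[OF 3(3)]
  have len: "length ?lo + length ?hi = length (p # ps)"
    by (rule length_branch)
  have "time (group_by_key (Suc k) (p # ps)) = 4 * length (p # ps)
      + time (group_by_key k ?lo) + time (group_by_key k ?hi)
      + length (val (group_by_key k ?lo)) + length (val (group_by_key k ?hi)) + 1"
    by simp
  also have "\<dots> \<le> 4 * length (p # ps) + (1 + 7 * length ?lo * (k + 1))
      + (1 + 7 * length ?hi * (k + 1)) + length ?lo + length ?hi + 1"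
    using 3(1)[OF refl keys] 3(2)[OF refl refl keys] length_group_by_key[OF keys]
    by (intro add_mono) auto
  also have "\<dots> = 5 * length (p # ps) + 3 + 7 * (k + 1) * length (p # ps)"
    unfolding len[symmetric] by (simp add: algebra_simps)
  also have "\<dots> \<le> 1 + 7 * length (p # ps) * (Suc k + 1)"
    by (simp add: algebra_simps)
  finally show ?case .
qed auto

section \<open>Shape, paths and size of the unpruned tree\<close>

primrec full :: "nat \<Rightarrow> nat \<Rightarrow> 'a qtree \<Rightarrow> bool" where
  "full d 0 t \<longleftrightarrow> (\<exists>b. t = Leaf b)"
| "full d (Suc l) t \<longleftrightarrow> (\<exists>cs. t = Node cs \<and> cs \<noteq> [] \<and> distinct (map fst cs) \<and>
     (\<forall>(e, u)\<in>set cs. (\<exists>lab. e = Short lab \<and> length lab = d) \<and> full d l u))"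

text \<open>A relation, since a leaf is known only by its content, which in an arbitrary tree need
  not determine the path.\<close>

inductive path_to :: "'a qtree \<Rightarrow> bool list list \<Rightarrow> 'a \<Rightarrow> bool" where
  path_to_Leaf: "path_to (Leaf b) [] b"
| path_to_Node: "(Short lab, t) \<in> set cs \<Longrightarrow> path_to t labs b \<Longrightarrow> path_to (Node cs) (lab # labs) b"

inductive_cases path_to_LeafE: "path_to (Leaf b) labs b'"
inductive_cases path_to_NodeE: "path_to (Node cs) labs b"

definition labelled :: "nat \<Rightarrow> nat \<Rightarrow> (nat \<times> bool list list) list \<Rightarrow> bool" where
  "labelled d l ps \<longleftrightarrow> (\<forall>(i, labs)\<in>set ps. length labs = l \<and> (\<forall>lab\<in>set labs. length lab = d))"

abbreviation (input) keyed :: "(nat \<times> bool list list) list \<Rightarrow> (bool list \<times> nat \<times> bool list list) list" where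
  "keyed ps \<equiv> map (\<lambda>(i, labs). (hd labs, (i, tl labs))) ps"

lemma keys_length_keyed:
  assumes "labelled d (Suc l) ps"
  shows "keys_length d (keyed ps)"
proof -
  have "length (hd labs) = d" if "(i, labs) \<in> set ps" for i labs
    using assms that by (cases labs) (auto simp: labelled_def)
  then show ?thesis by (auto simp: keys_length_def)
qed

lemma keyed_iff:
  assumes "labelled d (Suc l) ps"
  shows "(key, i, labs) \<in> set (keyed ps) \<longleftrightarrow> (i, key # labs) \<in> set ps"
proof -
  have "labs' \<noteq> []" if "(j, labs') \<in> set ps" for j labs'
    using assms that by (auto simp: labelled_def)
  then show ?thesis by (force simp: image_iff)
qed

lemma labelled_group:
  assumes "labelled d (Suc l) ps" and "(key, qs) \<in> set (val (group_by_key d (keyed ps)))"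
  shows "length key = d" "qs \<noteq> []" "labelled d l qs"
    "\<And>i labs. (i, labs) \<in> set qs \<longleftrightarrow> (i, key # labs) \<in> set ps"
proof -
  have *: "length key = d \<and> qs \<noteq> [] \<and> set qs = {x. (key, x) \<in> set (keyed ps)}"
    by (rule group_by_key_set[OF keys_length_keyed[OF assms(1)] assms(2)])
  then show "length key = d" "qs \<noteq> []" by auto
  show **: "\<And>i labs. (i, labs) \<in> set qs \<longleftrightarrow> (i, key # labs) \<in> set ps"
    using * keyed_iff[OF assms(1)] by blast
  show "labelled d l qs"
    using ** assms(1) unfolding labelled_def by fastforce
qed

lemma full_build:
  assumes "labelled d l ps" and "ps \<noteq> []"
  shows "full d l (val (build d l ps))"
  using assms
proof (induction l arbitrary: ps)
  case (Suc l)
  define gs where "gs = val (group_by_key d (keyed ps))"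
  have tree: "val (build d (Suc l) ps) = Node (map (\<lambda>g. (Short (fst g), val (build d l (snd g)))) gs)"
    by (simp add: gs_def case_prod_unfold)
  have "length (fst g) = d \<and> full d l (val (build d l (snd g)))" if "g \<in> set gs" for g
    using that labelled_group[OF Suc.prems(1), of "fst g" "snd g"] Suc.IH by (simp add: gs_def)
  moreover have "distinct (map fst gs)"
    unfolding gs_def by (rule group_by_key_distinct)
  then have "distinct (map (\<lambda>g. Short (fst g)) gs)"
    by (simp add: distinct_map inj_on_def)
  moreover have "gs \<noteq> []"
    unfolding gs_def
    using Suc.prems(2) by (intro group_by_key_nonempty keys_length_keyed[OF Suc.prems(1)]) auto
  ultimately show ?case
    unfolding tree by (auto simp: o_def)
qed auto

text \<open>A leaf containing \<open>i\<close> can be reached only along labels recorded for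
  \<open>i\<close>. When every index occurs once, this recovers the labels of a point from its
  leaf.\<close>

lemma path_to_build:
  assumes "labelled d l ps" and "path_to (val (build d l ps)) labs b" and "i \<in> set b"
  shows "(i, labs) \<in> set ps"
  using assms
proof (induction l arbitrary: ps labs)
  case 0
  then show ?case by (force simp: labelled_def elim: path_to_LeafE)
next
  case (Suc l)
  from Suc.prems(2) obtain lab qs labs' where
    *: "(lab, qs) \<in> set (val (group_by_key d (keyed ps)))" "labs = lab # labs'"
      "path_to (val (build d l qs)) labs' b"
    by (auto elim!: path_to_NodeE simp: case_prod_unfold)
  then show ?case
    using labelled_group[OF Suc.prems(1) *(1)] Suc.IH[OF _ *(3)] Suc.prems(3) by auto
qed

lemma leaf_of_build:
  assumes "labelled d l ps" and "(i, labs) \<in> set ps"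
  shows "\<exists>b\<in>set (leaves (val (build d l ps))). i \<in> set b"
  using assms
proof (induction l arbitrary: ps labs)
  case 0
  then show ?case by force
next
  case (Suc l)
  define gs where "gs = val (group_by_key d (keyed ps))"
  have tree: "val (build d (Suc l) ps) = Node (map (\<lambda>g. (Short (fst g), val (build d l (snd g)))) gs)"
    by (simp add: gs_def case_prod_unfold)
  obtain key labs' where labs: "labs = key # labs'"
    using Suc.prems by (cases labs) (auto simp: labelled_def)
  have "\<exists>qs. (key, qs) \<in> set gs \<and> (i, labs') \<in> set qs"
    using keyed_iff[OF Suc.prems(1)] Suc.prems(2) labs
    unfolding gs_def by (intro group_by_key_keys keys_length_keyed[OF Suc.prems(1)]) blast
  then obtain qs where qs: "(key, qs) \<in> set gs" "(i, labs') \<in> set qs"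
    by blast
  have "\<exists>b\<in>set (leaves (val (build d l qs))). i \<in> set b"
    using Suc.IH[OF labelled_group(3)[OF Suc.prems(1)] qs(2)] qs(1) by (simp add: gs_def)
  then show ?case
    using qs(1) unfolding tree by force
qed

text \<open>On each level below the root the nodes share out the points among themselves and none is
  empty, so a level has at most \<open>length ps\<close> nodes.\<close>

lemma build_counts:
  assumes "labelled d l ps" and "ps \<noteq> []"
  shows "length (leaves (val (build d l ps))) \<le> length ps"
    and "num_nodes (val (build d l ps)) \<le> 1 + l * length ps"
    and "(\<Sum>b\<leftarrow>leaves (val (build d l ps)). length b) = length ps"
proof -
  have "length (leaves (val (build d l ps))) \<le> length ps \<and>
    num_nodes (val (build d l ps)) \<le> 1 + l * length ps \<and>
    (\<Sum>b\<leftarrow>leaves (val (build d l ps)). length b) = length ps"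
    using assms
  proof (induction l arbitrary: ps)
    case 0
    then show ?case by (cases ps) auto
  next
    case (Suc l)
    define gs where "gs = val (group_by_key d (keyed ps))"
    note keys = keys_length_keyed[OF Suc.prems(1)]
    have sum: "(\<Sum>g\<leftarrow>gs. length (snd g)) = length ps"
      using group_by_key_lengths[OF keys] by (simp add: gs_def)
    have len: "length gs \<le> length ps"
      using length_group_by_key[OF keys] by (simp add: gs_def)
    have IH: "length (leaves (val (build d l (snd g)))) \<le> length (snd g) \<and>
        num_nodes (val (build d l (snd g))) \<le> 1 + l * length (snd g) \<and>
        (\<Sum>b\<leftarrow>leaves (val (build d l (snd g))). length b) = length (snd g)" if "g \<in> set gs" for g
      using labelled_group[OF Suc.prems(1), of "fst g" "snd g"] that Suc.IH by (auto simp: gs_def)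
    have tree: "val (build d (Suc l) ps) = Node (map (\<lambda>g. (Short (fst g), val (build d l (snd g)))) gs)"
      by (simp add: gs_def case_prod_unfold)
    have "length (leaves (val (build d (Suc l) ps)))
        = (\<Sum>g\<leftarrow>gs. length (leaves (val (build d l (snd g)))))"
      unfolding tree by (simp add: length_concat o_def)
    also have "\<dots> \<le> (\<Sum>g\<leftarrow>gs. length (snd g))"
      using IH by (intro sum_list_mono) auto
    finally have 1: "length (leaves (val (build d (Suc l) ps))) \<le> length ps"
      using sum by simp
    have "num_nodes (val (build d (Suc l) ps))
        = 1 + (\<Sum>g\<leftarrow>gs. num_nodes (val (build d l (snd g))))"
      unfolding tree by (simp add: o_def)
    also have "\<dots> \<le> 1 + (\<Sum>g\<leftarrow>gs. 1 + l * length (snd g))"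
      using IH by (intro add_mono sum_list_mono) auto
    also have "\<dots> = 1 + length gs + l * length ps"
      unfolding sum_list_linear sum by simp
    finally have 2: "num_nodes (val (build d (Suc l) ps)) \<le> 1 + Suc l * length ps"
      using len by simp
    have "(\<Sum>b\<leftarrow>leaves (val (build d (Suc l) ps)). length b)
        = (\<Sum>g\<leftarrow>gs. \<Sum>b\<leftarrow>leaves (val (build d l (snd g))). length b)"
      unfolding tree by (induction gs) auto
    also have "\<dots> = (\<Sum>g\<leftarrow>gs. length (snd g))"
      using IH by (intro arg_cong[of _ _ sum_list] map_cong) auto
    finally show ?case using 1 2 sum by simp
  qed
  then show "length (leaves (val (build d l ps))) \<le> length ps"
    and "num_nodes (val (build d l ps)) \<le> 1 + l * length ps"
    and "(\<Sum>b\<leftarrow>leaves (val (build d l ps)). length b) = length ps"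
    by auto
qed

lemma time_build:
  assumes "labelled d l ps" and "ps \<noteq> []"
  shows "time (build d l ps) \<le> 1 + 13 * (length ps * (d + 1) * (l + 1))"
  using assms
proof (induction l arbitrary: ps)
  case (Suc l)
  define gs where "gs = val (group_by_key d (keyed ps))"
  note keys = keys_length_keyed[OF Suc.prems(1)]
  have sum: "(\<Sum>g\<leftarrow>gs. length (snd g)) = length ps"
    using group_by_key_lengths[OF keys] by (simp add: gs_def)
  have len: "length gs \<le> length ps"
    using length_group_by_key[OF keys] by (simp add: gs_def)
  have IH: "time (build d l (snd g)) \<le> 1 + 13 * (length (snd g) * (d + 1) * (l + 1))"
    if "g \<in> set gs" for g
    using labelled_group[OF Suc.prems(1), of "fst g" "snd g"] that Suc.IH by (auto simp: gs_def)
  have "time (build d (Suc l) ps) =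
      length ps + time (group_by_key d (keyed ps)) + (\<Sum>g\<leftarrow>gs. time (build d l (snd g)) + 1)
      + length gs + 2"
    by (simp add: gs_def time_mapM case_prod_unfold)
  also have "\<dots> \<le> length ps + (1 + 7 * length ps * (d + 1))
      + (\<Sum>g\<leftarrow>gs. 2 + 13 * ((d + 1) * (l + 1)) * length (snd g)) + length gs + 2"
  proof -
    have "time (build d l (snd g)) + 1 \<le> 2 + 13 * ((d + 1) * (l + 1)) * length (snd g)"
      if "g \<in> set gs" for g
      using IH[OF that] by (simp add: algebra_simps)
    then have "(\<Sum>g\<leftarrow>gs. time (build d l (snd g)) + 1)
        \<le> (\<Sum>g\<leftarrow>gs. 2 + 13 * ((d + 1) * (l + 1)) * length (snd g))"
      by (rule sum_list_mono)
    then show ?thesis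
      using time_group_by_key[OF keys, unfolded length_map] by linarith
  qed
  also have "\<dots> = length ps + (1 + 7 * length ps * (d + 1))
      + (2 * length gs + 13 * ((d + 1) * (l + 1)) * length ps) + length gs + 2"
    unfolding sum_list_linear sum ..
  also have "\<dots> \<le> 3 + 4 * length ps + 7 * length ps * (d + 1) + 13 * ((d + 1) * (l + 1)) * length ps"
    using len by simp
  \<comment> \<open>The list is nonempty, so the surplus 2 can be charged to its points. The
    coefficient 13 is the 7 of the grouping plus the 6 collected here.\<close>
  also have "\<dots> \<le> 1 + 2 * length ps + 4 * length ps + 7 * length ps * (d + 1) + 13 * ((d + 1) * (l + 1)) * length ps"
    using Suc.prems(2) by (cases ps) auto
  also have "\<dots> \<le> 1 + 13 * (length ps * (d + 1) * (Suc l + 1))"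
    by (simp add: algebra_simps)
  finally show ?case .
qed auto

subsection \<open>Pruning\<close>

text \<open>
  The recursion of \<open>prune_path\<close>: \<open>labs\<close> lists bottom-up the labels on the current maximal path.
\<close>

lemma full_path_induct [consumes 1, case_names Leaf Single Branch]:
  assumes "full d l t"
    and leaf: "\<And>labs b. P labs 0 (Leaf b)"
    and single: "\<And>labs l lab t. length lab = d \<Longrightarrow> full d l t \<Longrightarrow> P (lab # labs) l t \<Longrightarrow>
      P labs (Suc l) (Node [(Short lab, t)])"
    and branch: "\<And>labs l cs. 2 \<le> length cs \<Longrightarrow> full d (Suc l) (Node cs) \<Longrightarrow>
      (\<And>lab t. (Short lab, t) \<in> set cs \<Longrightarrow> P [lab] l t) \<Longrightarrow> P labs (Suc l) (Node cs)"
  shows "P labs l t"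
  using assms(1)
proof (induction l arbitrary: labs t)
  case 0
  then show ?case using leaf by auto
next
  case (Suc l)
  then obtain cs where t: "t = Node cs" and "cs \<noteq> []" by auto
  have children: "(\<exists>lab. e = Short lab \<and> length lab = d) \<and> full d l u" if "(e, u) \<in> set cs" for e u
    using Suc.prems that by (auto simp: t)
  show ?case
  proof (cases "2 \<le> length cs")
    case True
    show ?thesis
      unfolding t by (rule branch[OF True Suc.prems[unfolded t]]) (use children Suc.IH in blast)
  next
    case False
    with \<open>cs \<noteq> []\<close> obtain e u where cs: "cs = [(e, u)]"
      by (cases cs; cases "tl cs") auto
    then obtain lab where "e = Short lab" "length lab = d" "full d l u"
      using children by auto
    then show ?thesis
      unfolding t cs using single Suc.IH by blast
  qed
qed

lemma full_child:
  assumes "full d (Suc l) (Node cs)" and "c \<in> set cs"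
  obtains lab where "fst c = Short lab" "length lab = d" "full d l (snd c)" "(Short lab, snd c) \<in> set cs"
  using assms by (cases c) auto

lemma sum_list_Suc: "(\<Sum>x\<leftarrow>xs. Suc (f x)) = length xs + (\<Sum>x\<leftarrow>xs. f x)"
  by (induction xs) auto

text \<open>The overlapping patterns of \<open>prune_path\<close> are split into no child and at
  least two children; this restores the one equation that holds in both cases.\<close>

lemma prune_path_branch:
  assumes "length cs \<noteq> 1"
  shows "prune_path \<Lambda> es (Node cs) = do {
     cs' \<leftarrow> mapM (\<lambda>(e, t). prune_path \<Lambda> [e] t) cs;
     close_path \<Lambda> es (Node cs') }"
  using assms by (cases cs; cases "tl cs") auto

lemma val_close_path [simp]: "val (close_path \<Lambda> es t) = attach (shorten \<Lambda> es) t"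
  and time_close_path [simp]: "time (close_path \<Lambda> es t) = 3 * length es + 1"
  by (simp_all add: close_path_def)

lemma shorten_nonempty: "es \<noteq> [] \<Longrightarrow> shorten \<Lambda> es \<noteq> []"
  by (simp add: shorten_def Let_def)

abbreviation prune_child :: "nat \<Rightarrow> edge \<times> 'a qtree \<Rightarrow> edge \<times> 'a qtree" where
  "prune_child \<Lambda> c \<equiv> val (prune_path \<Lambda> [fst c] (snd c))"

lemma val_prune_Node: "val (prune \<Lambda> (Node cs)) = Node (map (prune_child \<Lambda>) cs)"
  by (simp add: case_prod_unfold)

lemma val_prune_path_branch:
  "2 \<le> length cs \<Longrightarrow> val (prune_path \<Lambda> es (Node cs)) =
    attach (shorten \<Lambda> es) (Node (map (prune_child \<Lambda>) cs))"
  by (subst prune_path_branch) (auto simp: case_prod_unfold)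

section \<open>Leaves and running time of pruning\<close>

lemma leaves_attach: "es \<noteq> [] \<Longrightarrow> leaves (snd (attach es t)) = leaves t"
  by (induction es t rule: attach.induct) auto

text \<open>Only nodes with a single child disappear, so the leaves and their order survive. Leaf
  numbers assigned in the pruned tree may therefore be read in the full tree.\<close>

lemma leaves_prune_path:
  "full d l t \<Longrightarrow> labs \<noteq> [] \<Longrightarrow> leaves (snd (val (prune_path \<Lambda> (map Short labs) t))) = leaves t"
proof (induction labs l t rule: full_path_induct)
  case (Branch labs l cs)
  have "leaves (snd (prune_child \<Lambda> c)) = leaves (snd c)" if "c \<in> set cs" for c
    using full_child[OF Branch(2) that] Branch(3) by fastforce
  then show ?case
    using Branch.prems
    by (simp add: val_prune_path_branch[OF Branch(1)] leaves_attach shorten_nonempty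
        case_prod_unfold o_def cong: map_cong)
qed (simp_all add: leaves_attach shorten_nonempty)

lemma leaves_prune:
  assumes "full d l t"
  shows "leaves (val (prune \<Lambda> t)) = leaves t"
proof (cases l)
  case (Suc l')
  then obtain cs where t: "t = Node cs" using assms by auto
  have "leaves (snd (prune_child \<Lambda> c)) = leaves (snd c)" if "c \<in> set cs" for c
    using full_child[OF assms[unfolded t Suc] that] leaves_prune_path[of d l' "snd c" "[_]"] by fastforce
  then show ?thesis
    unfolding t val_prune_Node by (simp add: case_prod_unfold o_def cong: map_cong)
qed (use assms in auto)

text \<open>Amortised: \<open>3 * length es\<close> pays for closing the pending path. A child
  starts with one pending edge, so the reserve 4 covers the 3 for that edge and the step that
  \<open>mapM\<close> spends on the child.\<close>

lemma time_prune_path: "time (prune_path \<Lambda> es t) + 4 \<le> 3 * length es + 6 * num_nodes t"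
proof (induction \<Lambda> es t rule: prune_path.induct)
  case ("3_1" \<Lambda> es)
  then show ?case by simp
next
  case ("3_2" \<Lambda> es c c' cs)
  have *: "time (prune_path \<Lambda> [fst x] (snd x)) + 1 \<le> 6 * num_nodes (snd x)"
    if "x \<in> set (c # c' # cs)" for x
    using "3_2"[OF that, of "fst x" "snd x"] by simp
  have "(\<Sum>x\<leftarrow>c # c' # cs. time (prune_path \<Lambda> [fst x] (snd x)) + 1)
      \<le> (\<Sum>x\<leftarrow>c # c' # cs. 6 * num_nodes (snd x))"
    using * by (rule sum_list_mono)
  then show ?case
    by (simp add: time_mapM case_prod_unfold sum_list_const_mult sum_list_Suc)
qed auto

lemma time_prune: "time (prune \<Lambda> t) \<le> 6 * num_nodes t"
proof (cases t)
  case (Node cs)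
  have "time (prune_path \<Lambda> [fst x] (snd x)) + 1 \<le> 6 * num_nodes (snd x)" for x
    using time_prune_path[of \<Lambda> "[fst x]" "snd x"] by simp
  then have "(\<Sum>x\<leftarrow>cs. Suc (time (prune_path \<Lambda> [fst x] (snd x)))) \<le> (\<Sum>x\<leftarrow>cs. 6 * num_nodes (snd x))"
    by (intro sum_list_mono) simp
  then show ?thesis
    by (simp add: Node time_mapM case_prod_unfold sum_list_const_mult sum_list_Suc)
qed simp

section \<open>Number of bits of the pruned tree\<close>

definition edge_bits :: "nat \<Rightarrow> edge \<times> 'a qtree \<Rightarrow> nat" where
  "edge_bits w c = 1 + length (put_edge w (fst c)) + length (put_tree w (snd c))"

lemma length_put_tree_Node: "length (put_tree w (Node cs)) = (\<Sum>c\<leftarrow>cs. edge_bits w c) + 1"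
  by (induction cs) (auto simp: edge_bits_def)

text \<open>Each edge costs a descending and a returning bit. The returning bit of the bottom edge
  is the closing bit of \<open>put_tree w t\<close> and would be counted twice, hence the
  \<open>+ 1\<close> on the left.\<close>

lemma edge_bits_attach:
  "es \<noteq> [] \<Longrightarrow> edge_bits w (attach es t) + 1 =
    (\<Sum>e\<leftarrow>es. 2 + length (put_edge w e)) + length (put_tree w t)"
  by (induction es t rule: attach.induct) (auto simp: edge_bits_def)

text \<open>Budget of one maximal path after pruning: at most \<open>\<Lambda> + 1\<close> short
  edges with label, tag and two traversal bits, and one long edge with \<open>w\<close> bits in
  place of the label.\<close>

definition path_bits :: "nat \<Rightarrow> nat \<Rightarrow> nat \<Rightarrow> nat" where
  "path_bits d w \<Lambda> = (\<Lambda> + 1) * (d + 3) + (w + 3)"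

lemma sum_Short_bits:
  "\<forall>lab\<in>set labs. length lab = d \<Longrightarrow>
    (\<Sum>e\<leftarrow>map Short labs. 2 + length (put_edge w e)) = length labs * (d + 3)"
  by (induction labs) auto

lemma shorten_bits:
  assumes "\<forall>lab\<in>set labs. length lab = d"
  shows "(\<Sum>e\<leftarrow>shorten \<Lambda> (map Short labs). 2 + length (put_edge w e)) \<le> path_bits d w \<Lambda>"
proof (cases "length labs > \<Lambda> + 1")
  case True
  have "(\<Sum>e\<leftarrow>map Short (drop (length labs - \<Lambda>) labs). 2 + length (put_edge w e))
      = length (drop (length labs - \<Lambda>) labs) * (d + 3)"
    using assms by (intro sum_Short_bits) (meson in_set_dropD)
  then show ?thesis
    using True by (simp add: shorten_def Let_def path_bits_def put_nat_def drop_map)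
next
  case False
  then have "length labs * (d + 3) \<le> (\<Lambda> + 1) * (d + 3)"
    by (intro mult_right_mono) auto
  then show ?thesis
    using False sum_Short_bits[OF assms, of w] by (simp add: shorten_def path_bits_def)
qed

text \<open>The extra \<open>path_bits\<close> on the left encodes that a subtree with r leaves,
  together with the path leading to it, consists of at most 2 r - 1 maximal paths. At a branching
  node the children supply at least two such reserves: one pays for the path ending there, the other
  is passed on.\<close>

lemma edge_bits_prune_path:
  "full d l t \<Longrightarrow> labs \<noteq> [] \<Longrightarrow> \<forall>lab\<in>set labs. length lab = d \<Longrightarrow>
    edge_bits w (val (prune_path \<Lambda> (map Short labs) t)) + path_bits d w \<Lambda>
      \<le> 2 * path_bits d w \<Lambda> * length (leaves t)"
proof (induction labs l t rule: full_path_induct)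
  case (Leaf labs b)
  then show ?case
    using edge_bits_attach[OF shorten_nonempty, of "map Short labs" w \<Lambda> "Leaf b"]
      shorten_bits[of labs d w \<Lambda>] by simp
next
  case (Single labs l lab t)
  then show ?case by simp
next
  case (Branch labs l cs)
  let ?P = "path_bits d w \<Lambda>"
  have "edge_bits w (prune_child \<Lambda> c) + ?P \<le> 2 * ?P * length (leaves (snd c))" if c: "c \<in> set cs" for c
  proof -
    obtain lab where "fst c = Short lab" "length lab = d" "(Short lab, snd c) \<in> set cs"
      by (rule full_child[OF Branch(2) c])
    then show ?thesis
      using Branch(3)[of lab "snd c"] by simp
  qed
  then have "(\<Sum>c\<leftarrow>cs. edge_bits w (prune_child \<Lambda> c) + ?P) \<le> (\<Sum>c\<leftarrow>cs. 2 * ?P * length (leaves (snd c)))"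
    by (rule sum_list_mono)
  also have "\<dots> = 2 * ?P * length (leaves (Node cs))"
    by (simp add: length_concat sum_list_const_mult o_def case_prod_unfold)
  finally have "(\<Sum>c\<leftarrow>cs. edge_bits w (prune_child \<Lambda> c)) + length cs * ?P
      \<le> 2 * ?P * length (leaves (Node cs))"
    by (simp add: sum_list_addf sum_list_triv)
  moreover have "2 * ?P \<le> length cs * ?P"
    using Branch(1) by (rule mult_right_mono) simp
  moreover have "edge_bits w (val (prune_path \<Lambda> (map Short labs) (Node cs)))
      \<le> ?P + (\<Sum>c\<leftarrow>cs. edge_bits w (prune_child \<Lambda> c))"
    using edge_bits_attach[OF shorten_nonempty, of "map Short labs" w \<Lambda> "Node (map (prune_child \<Lambda>) cs)"]
      shorten_bits[of labs d w \<Lambda>] Branch.prems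
    by (simp add: val_prune_path_branch[OF Branch(1)] length_put_tree_Node o_def del: put_tree.simps)
  ultimately show ?case by linarith
qed

lemma length_put_tree_prune:
  assumes "full d l t"
  shows "length (put_tree w (val (prune \<Lambda> t))) \<le> 2 * path_bits d w \<Lambda> * length (leaves t) + 1"
proof (cases l)
  case (Suc l')
  then obtain cs where t: "t = Node cs" using assms by auto
  let ?P = "path_bits d w \<Lambda>"
  have "edge_bits w (prune_child \<Lambda> c) \<le> 2 * ?P * length (leaves (snd c))" if c: "c \<in> set cs" for c
  proof -
    obtain lab where "fst c = Short lab" "length lab = d" "full d l' (snd c)"
      by (rule full_child[OF assms(1)[unfolded t Suc] c])
    then show ?thesis
      using edge_bits_prune_path[of d l' "snd c" "[lab]" w \<Lambda>] by simp
  qed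
  then have "(\<Sum>c\<leftarrow>cs. edge_bits w (prune_child \<Lambda> c)) \<le> (\<Sum>c\<leftarrow>cs. 2 * ?P * length (leaves (snd c)))"
    by (rule sum_list_mono)
  also have "\<dots> = 2 * ?P * length (leaves (Node cs))"
    by (simp add: length_concat sum_list_const_mult o_def case_prod_unfold)
  finally show ?thesis
    unfolding t val_prune_Node length_put_tree_Node by (simp add: o_def)
qed (use assms in auto)

text \<open>Every node emits its own closing bit. Hence traversing the pruned tree can be paid for
  by the output.\<close>

lemma num_nodes_le_put_tree: "num_nodes t \<le> length (put_tree w t)"
proof (induction t rule: num_nodes.induct)
  case (2 cs)
  have "(\<Sum>c\<leftarrow>cs. num_nodes (snd c)) \<le> (\<Sum>c\<leftarrow>cs. edge_bits w c)"
  proof (rule sum_list_mono)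
    fix c assume "c \<in> set cs"
    then show "num_nodes (snd c) \<le> edge_bits w c"
      using 2[of c "fst c" "snd c"] by (simp add: edge_bits_def)
  qed
  then show ?case
    unfolding length_put_tree_Node by (simp add: case_prod_unfold)
qed simp

section \<open>Trees that can be parsed back\<close>

primrec fits_edge :: "nat \<Rightarrow> nat \<Rightarrow> edge \<Rightarrow> bool" where
  "fits_edge d w (Short lab) \<longleftrightarrow> length lab = d"
| "fits_edge d w (Long k) \<longleftrightarrow> k < 2 ^ w"

text \<open>What the parser relies on: labels of known width, long-edge labels that fit into
  \<open>w\<close> bits, and no inner node without children, which \<open>mk_tree\<close> would read
  back as a leaf.\<close>

inductive fits :: "nat \<Rightarrow> nat \<Rightarrow> 'a qtree \<Rightarrow> bool" for d w where
  fits_Leaf: "fits d w (Leaf b)"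
| fits_Node: "cs \<noteq> [] \<Longrightarrow> (\<And>e t. (e, t) \<in> set cs \<Longrightarrow> fits_edge d w e) \<Longrightarrow>
    (\<And>e t. (e, t) \<in> set cs \<Longrightarrow> fits d w t) \<Longrightarrow> fits d w (Node cs)"

lemma fits_attach:
  "es \<noteq> [] \<Longrightarrow> \<forall>e\<in>set es. fits_edge d w e \<Longrightarrow> fits d w t \<Longrightarrow>
    fits_edge d w (fst (attach es t)) \<and> fits d w (snd (attach es t))"
proof (induction es t rule: attach.induct)
  case (2 e e' es t)
  have "fits d w (Node [(e, t)])"
    using 2(3,4) by (intro fits_Node) auto
  then show ?case using 2 by auto
qed auto

lemma fits_shorten:
  assumes "\<forall>lab\<in>set labs. length lab = d" and "length labs < 2 ^ w"
  shows "\<forall>e\<in>set (shorten \<Lambda> (map Short labs)). fits_edge d w e"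
  using assms by (auto simp: shorten_def Let_def drop_map dest: in_set_dropD)

text \<open>The bound is on the pending path plus the remaining depth, because a long edge may come
  to span both.\<close>

lemma fits_prune_path:
  "full d l t \<Longrightarrow> labs \<noteq> [] \<Longrightarrow> \<forall>lab\<in>set labs. length lab = d \<Longrightarrow> length labs + l < 2 ^ w \<Longrightarrow>
    fits_edge d w (fst (val (prune_path \<Lambda> (map Short labs) t))) \<and>
    fits d w (snd (val (prune_path \<Lambda> (map Short labs) t)))"
proof (induction labs l t rule: full_path_induct)
  case (Leaf labs b)
  then show ?case
    by (simp add: fits_attach fits_shorten shorten_nonempty fits_Leaf)
next
  case (Single labs l lab t)
  then show ?case by simp
next
  case (Branch labs l cs)
  have "fits_edge d w (fst (prune_child \<Lambda> c)) \<and> fits d w (snd (prune_child \<Lambda> c))" if c: "c \<in> set cs" for c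
  proof -
    obtain lab where "fst c = Short lab" "length lab = d" "(Short lab, snd c) \<in> set cs"
      by (rule full_child[OF Branch(2) c])
    moreover have "length [lab] + l < 2 ^ w" using Branch.prems by (cases labs) auto
    ultimately show ?thesis
      using Branch(3)[of lab "snd c"] by simp
  qed
  then have "fits d w (Node (map (prune_child \<Lambda>) cs))"
    using Branch(1) by (intro fits_Node) (auto, (metis fst_conv snd_conv)+)
  then show ?case
    using Branch.prems
    by (simp add: val_prune_path_branch[OF Branch(1)] fits_attach fits_shorten shorten_nonempty)
qed

lemma fits_prune:
  assumes "full d l t" and "l < 2 ^ w"
  shows "fits d w (val (prune \<Lambda> t))"
proof (cases l)
  case 0
  then show ?thesis using assms by (auto intro: fits_Leaf)
next
  case (Suc l')
  then obtain cs where t: "t = Node cs" and "cs \<noteq> []" using assms by auto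
  have "fits_edge d w (fst (prune_child \<Lambda> c)) \<and> fits d w (snd (prune_child \<Lambda> c))" if c: "c \<in> set cs" for c
  proof -
    obtain lab where "fst c = Short lab" "length lab = d" "full d l' (snd c)"
      by (rule full_child[OF assms(1)[unfolded t Suc] c])
    then show ?thesis
      using fits_prune_path[of d l' "snd c" "[lab]" w \<Lambda>] assms Suc by simp
  qed
  then show ?thesis
    unfolding t val_prune_Node
    using \<open>cs \<noteq> []\<close> by (intro fits_Node) (auto, (metis fst_conv snd_conv)+)
qed

subsection \<open>Decoding\<close>

lemma length_put_nat [simp]: "length (put_nat w k) = w"
  by (simp add: put_nat_def)

lemma get_put_nat:
  assumes "k < 2 ^ w"
  shows "get_nat w (put_nat w k @ bs) = k"
proof -
  have "get_nat w (put_nat w k @ bs) = horner_sum of_bool 2 (map (bit k) [0..<w])"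
    by (simp add: get_nat_def put_nat_def)
  also have "\<dots> = take_bit w k"
    by (simp add: horner_sum_bit_eq_take_bit)
  finally show ?thesis
    using assms by (simp add: take_bit_nat_eq_self)
qed

lemma get_put_edge:
  assumes "fits_edge d w e"
  shows "get_edge d w (put_edge w e @ bs) = (e, bs)"
  using assms by (cases e) (auto simp: get_edge_def get_put_nat)

text \<open>The bit string holds no leaf contents, so the tree can be read back only up to
  these.\<close>

abbreviation shape :: "'a qtree \<Rightarrow> unit qtree" where
  "shape \<equiv> map_qtree (\<lambda>_. ())"

fun children :: "'a qtree \<Rightarrow> (edge \<times> 'a qtree) list" where
  "children (Leaf b) = []"
| "children (Node cs) = cs"

lemma mk_tree_children: "fits d w t \<Longrightarrow> mk_tree (children (shape t)) = shape t"
proof (induction rule: fits.cases)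
  case (fits_Node cs)
  then show ?case by (cases cs) auto
qed simp

lemma get_children_put_tree:
  assumes "fits d w t" and "length (put_tree w t) \<le> f"
  shows "get_children f d w (put_tree w t @ bs) = (children (shape t), bs)"
  using assms
proof (induction arbitrary: f bs rule: fits.induct)
  case (fits_Leaf b)
  then show ?case by simp
next
  case (fits_Node cs)
  \<comment> \<open>The parser walks along the siblings one at a time, so the claim is made for
    every list of children of the node; \<open>set cs' \<subseteq> set cs\<close> keeps the outer
    induction hypothesis available.\<close>
  have "get_children f d w (concat (map (\<lambda>(e, t). True # put_edge w e @ put_tree w t) cs') @ False # bs)
      = (map (map_prod id shape) cs', bs)"
    if "set cs' \<subseteq> set cs" "length (concat (map (\<lambda>(e, t). True # put_edge w e @ put_tree w t) cs')) < f"
    for cs' f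
    using that
  proof (induction cs' arbitrary: f)
    case (Cons c cs')
    obtain e t where c: "c = (e, t)" by (cases c)
    then have mem: "(e, t) \<in> set cs" using Cons.prems by auto
    obtain f' where f: "f = Suc f'" using Cons.prems by (cases f) auto
    show ?case
      using Cons.IH[of f'] Cons.prems mem
        fits_Node(2,3)[OF mem] fits_Node(4)[OF mem, of f']
      by (simp add: c f get_put_edge mk_tree_children)
  qed auto
  then show ?case
    using fits_Node.prems by simp
qed

lemma leaf_points_shape: "leaf_points l v (shape t) = leaf_points l v t"
proof (induction l v t rule: leaf_points.induct)
  case (2 l v cs)
  have "(case map_prod id shape c of (e, t) \<Rightarrow> case e of
         Short lab \<Rightarrow> leaf_points (l - 1) (map2 (\<lambda>a b. a + of_bool b * 2 powi (l - 1)) v lab) t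
       | Long k \<Rightarrow> leaf_points (l - int k) v t) =
      (case c of (e, t) \<Rightarrow> case e of
         Short lab \<Rightarrow> leaf_points (l - 1) (map2 (\<lambda>a b. a + of_bool b * 2 powi (l - 1)) v lab) t
       | Long k \<Rightarrow> leaf_points (l - int k) v t)" if "c \<in> set cs" for c
    using 2[OF that] by (cases c; cases "fst c") auto
  then show ?case
    by (auto intro!: arg_cong[of _ _ concat])
qed simp

section \<open>Leaf numbers and index fields\<close>

lemma number_leaves_spec:
  "i \<in> \<Union>(set ` set bs) \<Longrightarrow>
    \<exists>k<length bs. i \<in> set (bs ! k) \<and> val (number_leaves bs j a) i = j + k"
proof -
  \<comment> \<open>A leaf without \<open>i\<close> leaves its entry alone, so the last leaf
    containing \<open>i\<close> decides; hence the case distinction on the remaining leaves.\<close>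
  have other: "val (number_leaves bs j a) i = a i" if "i \<notin> \<Union>(set ` set bs)" for bs j a
    using that by (induction bs arbitrary: j a) auto
  show "i \<in> \<Union>(set ` set bs) \<Longrightarrow>
    \<exists>k<length bs. i \<in> set (bs ! k) \<and> val (number_leaves bs j a) i = j + k"
  proof (induction bs arbitrary: j a)
    case (Cons b bs)
    show ?case
    proof (cases "i \<in> \<Union>(set ` set bs)")
      case True
      from Cons.IH[OF this, of "Suc j" "\<lambda>i. if i \<in> set b then j else a i"] obtain k
        where "k < length bs" "i \<in> set (bs ! k)"
          "val (number_leaves bs (Suc j) (\<lambda>i. if i \<in> set b then j else a i)) i = Suc j + k"
        by blast
      then show ?thesis by (intro exI[of _ "Suc k"]) auto
    next
      case False
      then show ?thesis
        using Cons.prems by (intro exI[of _ 0]) (auto simp: other)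
    qed
  qed simp
qed

lemma time_number_leaves:
  "time (number_leaves bs j a) = (\<Sum>b\<leftarrow>bs. length b) + 1"
  by (induction bs arbitrary: j a) auto

definition put_indices :: "nat \<Rightarrow> (nat \<Rightarrow> nat) \<Rightarrow> bool list" where
  "put_indices n a = concat (map (\<lambda>i. put_nat (index_width n) (a i)) [0..<n])"

lemma length_concat_put_nat: "length (concat (map (\<lambda>i. put_nat w (a i)) xs)) = length xs * w"
  by (induction xs) auto

lemma drop_concat_put_nat:
  "i < n \<Longrightarrow> \<exists>bs. drop (i * w) (concat (map (\<lambda>i. put_nat w (a i)) [0..<n])) = put_nat w (a i) @ bs"
proof -
  assume "i < n"
  then have "[0..<n] = [0..<i] @ i # [Suc i..<n]"
    using upt_add_eq_append[of 0 i "n - i"] by (simp add: upt_conv_Cons)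
  then have "concat (map (\<lambda>i. put_nat w (a i)) [0..<n]) =
      concat (map (\<lambda>i. put_nat w (a i)) [0..<i]) @ put_nat w (a i) @
      concat (map (\<lambda>i. put_nat w (a i)) [Suc i..<n])"
    by simp
  moreover have "length (concat (map (\<lambda>i. put_nat w (a i)) [0..<i])) = i * w"
    by (simp add: length_concat_put_nat)
  ultimately show ?thesis by auto
qed

lemma get_indices:
  assumes "\<And>i. i < n \<Longrightarrow> a i < n"
  shows "map (\<lambda>i. get_nat (index_width n) (drop (i * index_width n) (put_indices n a @ bs))) [0..<n]
    = map a [0..<n]"
proof (rule map_cong[OF refl])
  fix i assume "i \<in> set [0..<n]"
  then have i: "i < n" by simp
  then have "i * index_width n \<le> n * index_width n" by simp
  moreover obtain bs' where "drop (i * index_width n) (concat (map (\<lambda>i. put_nat (index_width n) (a i)) [0..<n]))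
      = put_nat (index_width n) (a i) @ bs'"
    using drop_concat_put_nat[OF i] by blast
  ultimately have "drop (i * index_width n) (put_indices n a @ bs) = put_nat (index_width n) (a i) @ bs' @ bs"
    unfolding put_indices_def by (simp add: length_concat_put_nat)
  moreover have "a i < 2 ^ index_width n"
  proof -
    have "a i \<le> n - 1" using assms[OF i] by simp
    also have "n - 1 < 2 ^ index_width n"
      by (rule floorlog_leD) auto
    finally show ?thesis .
  qed
  ultimately show "get_nat (index_width n) (drop (i * index_width n) (put_indices n a @ bs)) = a i"
    by (simp add: get_put_nat)
qed

lemma length_put_indices: "length (put_indices n a) = n * index_width n"
  by (simp add: put_indices_def length_concat_put_nat)

definition encode :: "nat \<Rightarrow> nat \<Rightarrow> 'a qtree \<Rightarrow> (nat \<Rightarrow> nat) \<Rightarrow> bool list" where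
  "encode L n t a = put_tree (long_width L) t @ put_indices n a"

text \<open>The blocks delimit themselves: the traversal bits end the tree, and the index fields
  have the fixed total length \<open>n * index_width n\<close>, so the next block starts where the
  parser stops.\<close>

lemma get_blocks_encode:
  assumes "\<And>x. x \<in> set xs \<Longrightarrow> fits (length (B x)) (long_width L) (t x)"
    and "\<And>x i. x \<in> set xs \<Longrightarrow> i < n \<Longrightarrow> a x i < n"
  shows "get_blocks L n (map B xs) (concat (map (\<lambda>x. encode L n (t x) (a x)) xs)) =
    map (\<lambda>x. (shape (t x), map (a x) [0..<n])) xs"
  using assms
proof (induction xs)
  case (Cons x xs)
  let ?rest = "concat (map (\<lambda>x. encode L n (t x) (a x)) xs)"
  have "get_children (length (encode L n (t x) (a x) @ ?rest)) (length (B x)) (long_width L)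
      (encode L n (t x) (a x) @ ?rest) = (children (shape (t x)), put_indices n (a x) @ ?rest)"
    unfolding encode_def append_assoc by (rule get_children_put_tree) (use Cons.prems in auto)
  moreover have "mk_tree (children (shape (t x))) = shape (t x)"
    using Cons.prems(1)[of x] by (intro mk_tree_children) auto
  moreover have "get_blocks L n (map B xs) ?rest = map (\<lambda>x. (shape (t x), map (a x) [0..<n])) xs"
    using Cons by simp
  ultimately show ?case
    using get_indices[of n "a x" ?rest] Cons.prems(2)
    by (simp add: Let_def length_put_indices)
qed simp

subsection \<open>Decompressed points\<close>

text \<open>Coordinate \<open>k\<close> of the corner of the cell reached by these labels, relative
  to the corner of the starting cell of level \<open>l\<close>.\<close>

primrec labels_value :: "int \<Rightarrow> bool list list \<Rightarrow> nat \<Rightarrow> real" where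
  "labels_value l [] k = 0"
| "labels_value l (lab # ls) k = of_bool (lab ! k) * 2 powi (l - 1) + labels_value (l - 1) ls k"

lemma labels_value_append: "labels_value l (xs @ ys) k = labels_value l xs k + labels_value (l - int (length xs)) ys k"
  by (induction xs arbitrary: l) (auto simp: algebra_simps)

lemma labels_value_nonneg: "0 \<le> labels_value l ls k"
  by (induction ls arbitrary: l) auto

lemma powi_half: "2 powi l = 2 * (2 powi (l - 1) :: real)"
  using power_int_add_1'[of "2::real" "l - 1"] by simp

lemma labels_value_le: "labels_value l ls k \<le> 2 powi l"
proof (induction ls arbitrary: l)
  case (Cons lab ls)
  have "labels_value l (lab # ls) k \<le> 1 * 2 powi (l - 1) + labels_value (l - 1) ls k"
    unfolding labels_value.simps by (intro add_right_mono mult_right_mono) auto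
  then show ?case
    using Cons[of "l - 1"] powi_half[of l] by linarith
qed simp

lemma labels_value_take_le: "labels_value l (take j ls) k \<le> labels_value l ls k"
  using labels_value_append[of l "take j ls" "drop j ls" k] labels_value_nonneg[of _ "drop j ls" k] by simp

text \<open>The dropped labels form an expansion that starts below level \<open>l - j\<close>, worth
  at most one unit of that level.\<close>

lemma labels_value_take_ge: "labels_value l ls k \<le> labels_value l (take j ls) k + 2 powi (l - int j)"
proof (cases "j \<le> length ls")
  case True
  then show ?thesis
    using labels_value_append[of l "take j ls" "drop j ls" k] labels_value_le[of "l - int j" "drop j ls" k] by simp
qed simp

definition located :: "int \<Rightarrow> real list \<Rightarrow> 'a qtree \<Rightarrow> ('a \<times> real list) set" where
  "located l v t = set (zip (leaves t) (leaf_points l v t))"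

text \<open>One step of \<open>leaf_points\<close>, isolated so that descending a path is a
  \<open>foldr\<close>; on a bottom-up list this applies the top edge first.\<close>

fun edge_step :: "edge \<Rightarrow> int \<times> real list \<Rightarrow> int \<times> real list" where
  "edge_step (Short lab) (l, v) = (l - 1, map2 (\<lambda>a b. a + of_bool b * 2 powi (l - 1)) v lab)"
| "edge_step (Long k) (l, v) = (l - int k, v)"

lemma length_leaf_points: "length (leaf_points l v t) = length (leaves t)"
proof (induction l v t rule: leaf_points.induct)
  case (2 l v cs)
  have "length (case c of (e, t) \<Rightarrow> case e of
         Short lab \<Rightarrow> leaf_points (l - 1) (map2 (\<lambda>a b. a + of_bool b * 2 powi (l - 1)) v lab) t
       | Long k \<Rightarrow> leaf_points (l - int k) v t) = length (leaves (snd c))" if "c \<in> set cs" for c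
    using 2[OF that] by (cases c; cases "fst c") auto
  then show ?case
    by (auto simp: length_concat o_def case_prod_unfold intro!: arg_cong[of _ _ sum_list])
qed simp

lemma leaf_points_Node:
  "leaf_points l v (Node cs) = concat (map (\<lambda>(e, t). case_prod leaf_points (edge_step e (l, v)) t) cs)"
  by (auto intro!: arg_cong[of _ _ concat] split: edge.splits)

lemma set_zip_concat:
  "(\<And>c. c \<in> set cs \<Longrightarrow> length (f c) = length (g c)) \<Longrightarrow>
    set (zip (concat (map f cs)) (concat (map g cs))) = (\<Union>c\<in>set cs. set (zip (f c) (g c)))"
  by (induction cs) auto

lemma located_Node: "located l v (Node cs) = (\<Union>c\<in>set cs. located l v (Node [c]))"
proof -
  have *: "located l v (Node cs) = (\<Union>c\<in>set cs. set (zip (leaves (snd c))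
      (case_prod leaf_points (edge_step (fst c) (l, v)) (snd c))))" for cs :: "(edge \<times> 'a qtree) list"
    unfolding located_def leaf_points_Node leaves.simps case_prod_unfold
    by (rule set_zip_concat) (simp add: length_leaf_points)
  show ?thesis
    unfolding *[of cs] *[of "[_]"] by simp
qed

lemma located_attach:
  "es \<noteq> [] \<Longrightarrow> located l v (Node [attach es t]) =
    located (fst (foldr edge_step es (l, v))) (snd (foldr edge_step es (l, v))) t"
proof (induction es t rule: attach.induct)
  case (1 e t)
  then show ?case
    unfolding located_def leaf_points_Node by (simp add: case_prod_unfold)
next
  case (2 e e' es t)
  have "located l v (Node [(e, t)]) = located (fst (edge_step e (l, v))) (snd (edge_step e (l, v))) t" for l v
    unfolding located_def leaf_points_Node by (simp add: case_prod_unfold)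
  then show ?case using 2 by simp
qed simp

lemma foldr_edge_step_Short:
  assumes "\<forall>lab\<in>set labs. length lab = d" and "length v = d"
  shows "fst (foldr edge_step (map Short labs) (l, v)) = l - int (length labs)"
    and "length (snd (foldr edge_step (map Short labs) (l, v))) = d"
    and "\<And>k. k < d \<Longrightarrow> snd (foldr edge_step (map Short labs) (l, v)) ! k = v ! k + labels_value l (rev labs) k"
proof -
  have "fst (foldr edge_step (map Short labs) (l, v)) = l - int (length labs) \<and>
    length (snd (foldr edge_step (map Short labs) (l, v))) = d \<and>
    (\<forall>k<d. snd (foldr edge_step (map Short labs) (l, v)) ! k = v ! k + labels_value l (rev labs) k)"
    using assms(1)
  proof (induction labs)
    case Nil
    then show ?case using assms(2) by simp
  next
    case (Cons lab labs)
    obtain l' v' where fold: "foldr edge_step (map Short labs) (l, v) = (l', v')"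
      by (cases "foldr edge_step (map Short labs) (l, v)")
    then have l': "l' = l - int (length labs)" and "length v' = d"
      "\<forall>k<d. v' ! k = v ! k + labels_value l (rev labs) k"
      using Cons by auto
    then show ?case
      using Cons.prems by (simp add: fold labels_value_append)
  qed
  then show "fst (foldr edge_step (map Short labs) (l, v)) = l - int (length labs)"
    and "length (snd (foldr edge_step (map Short labs) (l, v))) = d"
    and "\<And>k. k < d \<Longrightarrow> snd (foldr edge_step (map Short labs) (l, v)) ! k = v ! k + labels_value l (rev labs) k"
    by auto
qed

text \<open>A long edge still subtracts the levels that it skips, so the level at the end of a
  shortened path is correct, and only the corner loses the labels after the first
  \<open>\<Lambda>\<close>.\<close>

lemma located_path:
  assumes "labs \<noteq> []" and "\<forall>lab\<in>set labs. length lab = d" and "length v = d"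
  obtains v' where "length v' = d"
    and "\<And>t :: 'a qtree. located l v (Node [attach (shorten \<Lambda> (map Short labs)) t]) =
      located (l - int (length labs)) v' t"
    and "\<And>k. k < d \<Longrightarrow> v' ! k = v ! k +
      labels_value l (if \<Lambda> + 1 < length labs then take \<Lambda> (rev labs) else rev labs) k"
proof (cases "\<Lambda> + 1 < length labs")
  case True
  let ?kept = "drop (length labs - \<Lambda>) labs"
  have kept: "\<forall>lab\<in>set ?kept. length lab = d"
    using assms(2) by (meson in_set_dropD)
  have shorten: "shorten \<Lambda> (map Short labs) = Long (length labs - \<Lambda>) # map Short ?kept"
    using True by (simp add: shorten_def Let_def drop_map)
  obtain l' v' where fold: "foldr edge_step (map Short ?kept) (l, v) = (l', v')"
    by (cases "foldr edge_step (map Short ?kept) (l, v)")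
  note kept_fold = foldr_edge_step_Short[OF kept assms(3), where l = l, unfolded fold]
  have "rev ?kept = take \<Lambda> (rev labs)"
    using True by (simp add: take_rev)
  then show ?thesis
    using that[of v'] kept_fold True
    by (simp add: located_attach shorten fold)
next
  case False
  then have "shorten \<Lambda> (map Short labs) = map Short labs"
    by (simp add: shorten_def)
  then show ?thesis
    using that[of "snd (foldr edge_step (map Short labs) (l, v))"] foldr_edge_step_Short[OF assms(2,3), where l = l]
      False assms(1) by (simp add: located_attach)
qed

text \<open>Pruning only replaces ones by zeros, hence the upper bound. It never touches the first
  \<open>\<Lambda>\<close> levels below the start of a path, and bits kept further down only add,
  hence the lower bound. Here \<open>v\<close> is the decompressed corner at that start, which may
  itself have lost bits.\<close>

lemma located_prune_path:
  assumes "full d l' t" and "labs \<noteq> []" and "\<forall>lab\<in>set labs. length lab = d" and "length v = d"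
    and "(b, u) \<in> located l v (Node [val (prune_path \<Lambda> (map Short labs) t)])"
  shows "\<exists>ls. path_to t ls b \<and> length u = d \<and>
    (\<forall>k<d. v ! k + labels_value l (take \<Lambda> (rev labs @ ls)) k \<le> u ! k \<and> u ! k \<le> v ! k + labels_value l (rev labs @ ls) k)"
  using assms
proof (induction labs l' t arbitrary: l v rule: full_path_induct)
  case (Leaf labs b')
  obtain v' where v': "length v' = d"
    "\<And>t :: 'a qtree. located l v (Node [attach (shorten \<Lambda> (map Short labs)) t]) =
      located (l - int (length labs)) v' t"
    "\<And>k. k < d \<Longrightarrow> v' ! k = v ! k +
      labels_value l (if \<Lambda> + 1 < length labs then take \<Lambda> (rev labs) else rev labs) k"
    by (rule located_path[OF Leaf(1,2,3), of l \<Lambda>]) blast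
  then have "b = b'" "u = v'"
    using Leaf(4) by (auto simp: located_def)
  then show ?case
    using v' labels_value_take_le[of l \<Lambda> "rev labs"]
    by (intro exI[of _ "[]"]) (auto intro: path_to_Leaf)
next
  case (Single labs l' lab t)
  obtain ls where "path_to t ls b" "length u = d"
    "\<forall>k<d. v ! k + labels_value l (take \<Lambda> (rev (lab # labs) @ ls)) k \<le> u ! k \<and>
      u ! k \<le> v ! k + labels_value l (rev (lab # labs) @ ls) k"
    using Single.IH[of v l] Single(1,2) Single.prems by (auto simp del: take_append)
  then show ?case
    by (intro exI[of _ "lab # ls"]) (auto intro: path_to_Node simp del: take_append)
next
  case (Branch labs l' cs)
  obtain v' where v': "length v' = d"
    "\<And>t :: 'a qtree. located l v (Node [attach (shorten \<Lambda> (map Short labs)) t]) =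
      located (l - int (length labs)) v' t"
    "\<And>k. k < d \<Longrightarrow> v' ! k = v ! k +
      labels_value l (if \<Lambda> + 1 < length labs then take \<Lambda> (rev labs) else rev labs) k"
    by (rule located_path[OF Branch(4,5,6), of l \<Lambda>]) blast
  let ?l = "l - int (length labs)"
  have "(b, u) \<in> located ?l v' (Node (map (prune_child \<Lambda>) cs))"
    using Branch.prems(4) unfolding val_prune_path_branch[OF Branch(1)] v'(2) .
  then obtain c where c: "c \<in> set cs" and loc: "(b, u) \<in> located ?l v' (Node [prune_child \<Lambda> c])"
    unfolding located_Node[of ?l v' "map (prune_child \<Lambda>) cs"] by auto
  obtain lab where lab: "fst c = Short lab" "length lab = d" "(Short lab, snd c) \<in> set cs"
    by (rule full_child[OF Branch(2) c])
  obtain ls where ls: "path_to (snd c) ls b" "length u = d"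
    "\<And>k. k < d \<Longrightarrow> v' ! k + labels_value ?l (take \<Lambda> (lab # ls)) k \<le> u ! k \<and>
      u ! k \<le> v' ! k + labels_value ?l (lab # ls) k"
    using Branch(3)[OF lab(3), of v' ?l] v'(1) lab(1,2) loc by auto
  have "v ! k + labels_value l (take \<Lambda> (rev labs @ lab # ls)) k \<le> u ! k \<and>
      u ! k \<le> v ! k + labels_value l (rev labs @ lab # ls) k" if k: "k < d" for k
  proof (cases "\<Lambda> + 1 < length labs")
    case True
    \<comment> \<open>The first \<open>\<Lambda>\<close> labels lie wholly on the current path; what
      the subtree adds is nonnegative.\<close>
    have "0 \<le> labels_value ?l (take \<Lambda> (lab # ls)) k" by (rule labels_value_nonneg)
    then show ?thesis
      using ls(3)[OF k] v'(3)[OF k] True labels_value_take_le[of l \<Lambda> "rev labs" k]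
      by (simp add: labels_value_append)
  next
    case False
    \<comment> \<open>The path kept all its labels, and the subtree keeps \<open>\<Lambda>\<close>
      more counted from its own start, which reaches at least as far as \<open>\<Lambda>\<close>
      counted from the start of the path.\<close>
    have "labels_value l (take \<Lambda> (rev labs @ lab # ls)) k \<le> labels_value l (rev labs @ take \<Lambda> (lab # ls)) k"
    proof -
      have "take \<Lambda> (rev labs @ lab # ls) = take \<Lambda> (rev labs @ take \<Lambda> (lab # ls))"
        by (simp add: min_def)
      then show ?thesis
        using labels_value_take_le[of l \<Lambda> "rev labs @ take \<Lambda> (lab # ls)" k] by simp
    qed
    then show ?thesis
      using ls(3)[OF k] v'(3)[OF k] False by (simp add: labels_value_append)
  qed
  then show ?case
    using ls(1,2) lab(3) by (intro exI[of _ "lab # ls"]) (auto intro: path_to_Node)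
qed

section \<open>Differences of decompressed points\<close>

fun common_prefix :: "'a list \<Rightarrow> 'a list \<Rightarrow> nat" where
  "common_prefix (x # xs) (y # ys) = (if x = y then Suc (common_prefix xs ys) else 0)"
| "common_prefix xs ys = 0"

text \<open>
  Only differences are compared, since the path above \<open>t\<close> may have lost bits, the same for all points of \<open>t\<close>.
\<close>

definition faithful :: "nat \<Rightarrow> nat \<Rightarrow> int \<Rightarrow> 'a qtree \<Rightarrow> ('a \<times> real list) set \<Rightarrow> bool" where
  "faithful d \<Lambda> l t S \<longleftrightarrow> (\<forall>(b1, u1)\<in>S. \<forall>(b2, u2)\<in>S. \<exists>ls1 ls2. path_to t ls1 b1 \<and> path_to t ls2 b2 \<and>
     (if ls1 = ls2 then u1 = u2
      else \<forall>k<d. \<bar>(u1 ! k - u2 ! k) - (labels_value l ls1 k - labels_value l ls2 k)\<bar>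
        \<le> 2 powi (l - int (common_prefix ls1 ls2) - int \<Lambda>)))"

lemma faithful_Leaf: "faithful d \<Lambda> l (Leaf b) (located l' v (Leaf b))"
proof -
  have "path_to (Leaf b) [] b" by (rule path_to_Leaf)
  then show ?thesis by (force simp: faithful_def located_def)
qed

text \<open>A common first label contributes equally to both points and cancels. Passing to the
  parent raises both the level and the common prefix by one, so the bound is unchanged.\<close>

lemma faithful_child:
  assumes "faithful d \<Lambda> (l - 1) t S" and "(Short lab, t) \<in> set cs"
  shows "faithful d \<Lambda> l (Node cs) S"
  unfolding faithful_def
proof (clarify)
  fix b1 u1 b2 u2
  assume "(b1, u1) \<in> S" "(b2, u2) \<in> S"
  with assms(1) obtain ls1 ls2 where *: "path_to t ls1 b1" "path_to t ls2 b2"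
    "if ls1 = ls2 then u1 = u2
      else \<forall>k<d. \<bar>(u1 ! k - u2 ! k) - (labels_value (l - 1) ls1 k - labels_value (l - 1) ls2 k)\<bar>
        \<le> 2 powi (l - 1 - int (common_prefix ls1 ls2) - int \<Lambda>)"
    unfolding faithful_def by fast
  then show "\<exists>ls1 ls2. path_to (Node cs) ls1 b1 \<and> path_to (Node cs) ls2 b2 \<and>
     (if ls1 = ls2 then u1 = u2
      else \<forall>k<d. \<bar>(u1 ! k - u2 ! k) - (labels_value l ls1 k - labels_value l ls2 k)\<bar>
        \<le> 2 powi (l - int (common_prefix ls1 ls2) - int \<Lambda>))"
    using assms(2)
    by (intro exI[of _ "lab # ls1"] exI[of _ "lab # ls2"])
      (auto intro: path_to_Node simp: algebra_simps split: if_splits)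
qed

text \<open>Below one child the claim is inherited. Two different children have different labels, so
  the common prefix is empty, and both start new paths from the same corner \<open>v\<close>, which
  keep their first \<open>\<Lambda>\<close> levels.\<close>

lemma faithful_children:
  assumes full: "full d (Suc l') (Node cs)" and v: "length v = d"
    and IH: "\<And>lab t. (Short lab, t) \<in> set cs \<Longrightarrow> full d l' t \<Longrightarrow> length lab = d \<Longrightarrow>
      faithful d \<Lambda> (l - 1) t (located l v (Node [val (prune_path \<Lambda> [Short lab] t)]))"
  shows "faithful d \<Lambda> l (Node cs) (located l v (Node (map (prune_child \<Lambda>) cs)))"
  unfolding faithful_def
proof (clarify)
  fix b1 u1 b2 u2
  assume "(b1, u1) \<in> located l v (Node (map (prune_child \<Lambda>) cs))"
    and "(b2, u2) \<in> located l v (Node (map (prune_child \<Lambda>) cs))"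
  then obtain c1 c2 where c: "c1 \<in> set cs" "c2 \<in> set cs"
    and loc: "(b1, u1) \<in> located l v (Node [prune_child \<Lambda> c1])" "(b2, u2) \<in> located l v (Node [prune_child \<Lambda> c2])"
    unfolding located_Node[of l v "map (prune_child \<Lambda>) cs"] by auto
  obtain lab1 where lab1: "fst c1 = Short lab1" "length lab1 = d" "full d l' (snd c1)" "(Short lab1, snd c1) \<in> set cs"
    by (rule full_child[OF full c(1)])
  obtain lab2 where lab2: "fst c2 = Short lab2" "length lab2 = d" "full d l' (snd c2)" "(Short lab2, snd c2) \<in> set cs"
    by (rule full_child[OF full c(2)])
  show "\<exists>ls1 ls2. path_to (Node cs) ls1 b1 \<and> path_to (Node cs) ls2 b2 \<and>
     (if ls1 = ls2 then u1 = u2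
      else \<forall>k<d. \<bar>(u1 ! k - u2 ! k) - (labels_value l ls1 k - labels_value l ls2 k)\<bar>
        \<le> 2 powi (l - int (common_prefix ls1 ls2) - int \<Lambda>))"
  proof (cases "c1 = c2")
    case True
    have "faithful d \<Lambda> l (Node cs) (located l v (Node [val (prune_path \<Lambda> [Short lab1] (snd c1))]))"
      using IH[OF lab1(4,3,2)] lab1(4) by (rule faithful_child)
    then show ?thesis
      using loc unfolding True[symmetric] lab1(1) faithful_def by fast
  next
    case False
    have "distinct (map fst cs)" using full by simp
    then have "fst c1 \<noteq> fst c2"
      using c False by (auto simp: distinct_map inj_on_def)
    then have neq: "lab1 \<noteq> lab2" using lab1(1) lab2(1) by simp
    obtain ls1 where ls1: "path_to (snd c1) ls1 b1"
      "\<And>k. k < d \<Longrightarrow> v ! k + labels_value l (take \<Lambda> (lab1 # ls1)) k \<le> u1 ! k \<and> u1 ! k \<le> v ! k + labels_value l (lab1 # ls1) k"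
      using located_prune_path[OF lab1(3) _ _ v, of "[lab1]" b1 u1 l \<Lambda>] loc(1) lab1(1,2) by auto
    obtain ls2 where ls2: "path_to (snd c2) ls2 b2"
      "\<And>k. k < d \<Longrightarrow> v ! k + labels_value l (take \<Lambda> (lab2 # ls2)) k \<le> u2 ! k \<and> u2 ! k \<le> v ! k + labels_value l (lab2 # ls2) k"
      using located_prune_path[OF lab2(3) _ _ v, of "[lab2]" b2 u2 l \<Lambda>] loc(2) lab2(1,2) by auto
    \<comment> \<open>Both points are rounded down, by at most
      \<open>2 powi (l - int \<Lambda>)\<close>; two errors of the same sign differ by no more than
      this, so there is no factor 2.\<close>
    have "\<bar>(u1 ! k - u2 ! k) - (labels_value l (lab1 # ls1) k - labels_value l (lab2 # ls2) k)\<bar> \<le> 2 powi (l - int \<Lambda>)"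
      if "k < d" for k
      using ls1(2)[OF that] ls2(2)[OF that]
        labels_value_take_ge[of l "lab1 # ls1" k \<Lambda>] labels_value_take_ge[of l "lab2 # ls2" k \<Lambda>] by linarith
    then show ?thesis
      using ls1(1) ls2(1) lab1(4) lab2(4) neq
      by (intro exI[of _ "lab1 # ls1"] exI[of _ "lab2 # ls2"]) (auto intro: path_to_Node)
  qed
qed

text \<open>The pending path merely replaces \<open>v\<close> by some \<open>v'\<close>; being
  common to all leaves below, its value can stay unspecified.\<close>

lemma faithful_prune_path:
  assumes "full d l' t" and "labs \<noteq> []" and "\<forall>lab\<in>set labs. length lab = d" and "length v = d"
  shows "faithful d \<Lambda> (l - int (length labs)) t (located l v (Node [val (prune_path \<Lambda> (map Short labs) t)]))"
  using assms
proof (induction labs l' t arbitrary: l v rule: full_path_induct)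
  case (Leaf labs b')
  obtain v' where v': 
    "\<And>t :: 'a qtree. located l v (Node [attach (shorten \<Lambda> (map Short labs)) t]) =
      located (l - int (length labs)) v' t"
    by (rule located_path[OF Leaf(1,2,3), of l \<Lambda>]) blast
  then show ?case by (simp add: faithful_Leaf)
next
  case (Single labs l' lab t)
  then have "faithful d \<Lambda> (l - int (length (lab # labs))) t
      (located l v (Node [val (prune_path \<Lambda> (map Short (lab # labs)) t)]))"
    by auto
  then have "faithful d \<Lambda> ((l - int (length labs)) - 1) t
      (located l v (Node [val (prune_path \<Lambda> (map Short (lab # labs)) t)]))"
    by (simp add: algebra_simps)
  then have "faithful d \<Lambda> (l - int (length labs)) (Node [(Short lab, t)])
      (located l v (Node [val (prune_path \<Lambda> (map Short (lab # labs)) t)]))"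
    by (rule faithful_child) simp
  then show ?case by simp
next
  case (Branch labs l' cs)
  obtain v' where v': "length v' = d"
    "\<And>t :: 'a qtree. located l v (Node [attach (shorten \<Lambda> (map Short labs)) t]) =
      located (l - int (length labs)) v' t"
    by (rule located_path[OF Branch(4,5,6), of l \<Lambda>]) blast
  show ?case
    unfolding val_prune_path_branch[OF Branch(1)] v'(2)
  proof (rule faithful_children[OF Branch(2) v'(1)])
    fix lab t
    assume "(Short lab, t) \<in> set cs" "length lab = d"
    then show "faithful d \<Lambda> (l - int (length labs) - 1) t
        (located (l - int (length labs)) v' (Node [val (prune_path \<Lambda> [Short lab] t)]))"
      using Branch(3)[of lab t v' "l - int (length labs)"] v'(1) by simp
  qed
qed

lemma faithful_prune:
  assumes "full d l' t" and "length v = d"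
  shows "faithful d \<Lambda> l t (located l v (val (prune \<Lambda> t)))"
proof (cases l')
  case 0
  then show ?thesis
    using assms by (auto simp: faithful_Leaf)
next
  case (Suc l'')
  then obtain cs where t: "t = Node cs" using assms by auto
  show ?thesis
    unfolding t val_prune_Node
  proof (rule faithful_children[OF assms(1)[unfolded t Suc] assms(2)])
    fix lab :: "bool list" and u :: "'a qtree"
    assume "full d l'' u" "length lab = d"
    then show "faithful d \<Lambda> (l - 1) u (located l v (Node [val (prune_path \<Lambda> [Short lab] u)]))"
      using faithful_prune_path[of d l'' u "[lab]" v \<Lambda> l] assms(2) by simp
  qed
qed

subsection \<open>Distances within one block\<close>

lemma time_cell_labels: "time (cell_labels l s z) = l * (2 * length z + 1) + 1"
  by (induction l arbitrary: s z) (auto simp: Let_def)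

lemma length_cell_labels [simp]: "length (val (cell_labels l s z)) = l"
  by (induction l arbitrary: s z) (auto simp: Let_def)

lemma length_cell_label: "lab \<in> set (val (cell_labels l s z)) \<Longrightarrow> length lab = length z"
  by (induction l arbitrary: s z) (auto simp: Let_def)

text \<open>The labels are a truncated binary expansion of the coordinate. Halving keeps the
  interval closed: a point on the upper face falls into the upper half and lies on its upper face
  again.\<close>

lemma cell_labels_value:
  assumes "k < length z" and "0 \<le> z ! k" and "z ! k \<le> 2 powi l"
  shows "labels_value l (val (cell_labels L (2 powi l) z)) k \<le> z ! k \<and>
    z ! k \<le> labels_value l (val (cell_labels L (2 powi l) z)) k + 2 powi (l - int L)"
  using assms
proof (induction L arbitrary: l z)
  case (Suc L)
  let ?h = "2 powi (l - 1) :: real"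
  have h: "2 powi l / 2 = ?h" and l: "2 powi l = 2 * ?h"
    using powi_half[of l] by auto
  define z' where "z' = map (\<lambda>a. if ?h \<le> a then a - ?h else a) z"
  have z'k: "z' ! k = (if ?h \<le> z ! k then z ! k - ?h else z ! k)"
    using Suc.prems(1) by (simp add: z'_def)
  have "k < length z'" "0 \<le> z' ! k" "z' ! k \<le> ?h"
    using Suc.prems l z'k by (auto simp: z'_def)
  from Suc.IH[OF this]
  show ?case
    using Suc.prems(1) z'k by (auto simp: Let_def h z'_def[symmetric] algebra_simps)
qed simp

text \<open>Labels first differ because in some coordinate the two points lie on different sides of
  the midpoint of their common cell. This midpoint is a grid line of the children, and
  \<open>z1\<close> is no farther from it than from \<open>z2\<close> in that coordinate.\<close>

lemma cell_labels_separated: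
  assumes "length z1 = length z2"
    and "val (cell_labels L s z1) \<noteq> val (cell_labels L s z2)"
  defines "p \<equiv> common_prefix (val (cell_labels L s z1)) (val (cell_labels L s z2))"
  shows "p < L \<and> (\<exists>k<length z1. \<exists>a::int.
    \<bar>z1 ! k - a * (s / 2 ^ (p + 1))\<bar> \<le> \<bar>z1 ! k - z2 ! k\<bar>)"
  using assms(1,2) unfolding p_def
proof (induction L arbitrary: s z1 z2)
  case (Suc L)
  define h where "h = s / 2"
  define f where "f = map (\<lambda>a. if h \<le> a then a - h else a)"
  define lab where "lab = map (\<lambda>a. h \<le> a)"
  have labels: "val (cell_labels (Suc L) s z) = lab z # val (cell_labels L h (f z))" for z
    unfolding f_def lab_def h_def[symmetric] by (simp add: Let_def flip: h_def)
  let ?p = "common_prefix (val (cell_labels L h (f z1))) (val (cell_labels L h (f z2)))"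
  show ?case
  proof (cases "lab z1 = lab z2")
    case False
    then obtain k where k: "k < length z1" "(h \<le> z1 ! k) \<noteq> (h \<le> z2 ! k)"
      using Suc.prems(1) by (auto simp: list_eq_iff_nth_eq lab_def)
    \<comment> \<open>With no common label the separating line is the midpoint \<open>h\<close>
      itself, so the multiple is 1.\<close>
    then have "\<bar>z1 ! k - of_int 1 * (s / 2 ^ (0 + 1))\<bar> \<le> \<bar>z1 ! k - z2 ! k\<bar>"
      by (auto simp: h_def)
    moreover have "common_prefix (val (cell_labels (Suc L) s z1)) (val (cell_labels (Suc L) s z2)) = 0"
      using False by (simp add: labels del: cell_labels.simps)
    ultimately show ?thesis
      using k(1) by (metis zero_less_Suc)
  next
    case True
    have "val (cell_labels L h (f z1)) \<noteq> val (cell_labels L h (f z2))"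
      using Suc.prems(2) True by (simp add: labels del: cell_labels.simps)
    then have "?p < L \<and> (\<exists>k<length z1. \<exists>a::int.
        \<bar>f z1 ! k - a * (h / 2 ^ (?p + 1))\<bar> \<le> \<bar>f z1 ! k - f z2 ! k\<bar>)"
      using Suc.IH[of "f z1" "f z2" h] Suc.prems(1) by (simp add: f_def)
    then obtain k a where p: "?p < L" and k: "k < length z1"
      and a: "\<bar>f z1 ! k - of_int a * (h / 2 ^ (?p + 1))\<bar> \<le> \<bar>f z1 ! k - f z2 ! k\<bar>"
      by auto
    have same: "h \<le> z1 ! k \<longleftrightarrow> h \<le> z2 ! k"
      using arg_cong[OF True, of "\<lambda>xs. xs ! k"] k Suc.prems(1) by (simp add: lab_def)
    \<comment> \<open>Moving back from the upper half shifts by \<open>h\<close>, which is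
      \<open>2 ^ (?p + 1)\<close> cell sides at the level of separation.\<close>
    define a' where "a' = (if h \<le> z1 ! k then a + 2 ^ (?p + 1) else a)"
    have "of_int a' * (s / 2 ^ (Suc ?p + 1)) = of_int a * (h / 2 ^ (?p + 1)) + (if h \<le> z1 ! k then h else 0)"
      by (auto simp: a'_def h_def field_simps)
    then have "\<bar>z1 ! k - of_int a' * (s / 2 ^ (Suc ?p + 1))\<bar> \<le> \<bar>z1 ! k - z2 ! k\<bar>"
      using a same k Suc.prems(1) by (auto simp: f_def)
    moreover have "common_prefix (val (cell_labels (Suc L) s z1)) (val (cell_labels (Suc L) s z2)) = Suc ?p"
      using True by (simp add: labels del: cell_labels.simps)
    ultimately show ?thesis
      using p k by (metis Suc_less_eq)
  qed
qed simp

definition labels_agree :: "nat \<Rightarrow> nat \<Rightarrow> int \<Rightarrow> bool list list \<Rightarrow> bool list list \<Rightarrow> real list \<Rightarrow> real list \<Rightarrow> bool" where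
  "labels_agree d \<Lambda> l ls1 ls2 u1 u2 \<longleftrightarrow>
     (if ls1 = ls2 then u1 = u2
      else \<forall>k<d. \<bar>(u1 ! k - u2 ! k) - (labels_value l ls1 k - labels_value l ls2 k)\<bar>
        \<le> 2 powi (l - int (common_prefix ls1 ls2) - int \<Lambda>))"

definition padded :: "nat \<Rightarrow> nat \<Rightarrow> real \<Rightarrow> real \<Rightarrow> real list \<Rightarrow> bool" where
  "padded d L \<rho> s z \<longleftrightarrow>
     (\<forall>k<d. \<forall>p<L. \<forall>a::int. \<rho> * (s / 2 ^ (p + 1)) \<le> \<bar>z ! k - a * (s / 2 ^ (p + 1))\<bar>)"

text \<open>Separation after \<open>p\<close> common labels puts a grid line within \<open>D\<close>
  of \<open>z1\<close>, and padding turns this into a lower bound on \<open>D\<close> proportional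
  to the cell side there. So the pruning error, a \<open>2 ^ \<Lambda>\<close>-th part of the common
  cell, is small relative to \<open>D\<close>. Points with equal labels decompress identically and
  differ by a leaf cell at most.\<close>

lemma cell_error:
  assumes len: "length z1 = d" "length z2 = d"
    and box: "\<And>k. k < d \<Longrightarrow> 0 \<le> z1 ! k \<and> z1 ! k \<le> 2 powi l" "\<And>k. k < d \<Longrightarrow> 0 \<le> z2 ! k \<and> z2 ! k \<le> 2 powi l"
    and agree: "labels_agree d \<Lambda> l (val (cell_labels L (2 powi l) z1)) (val (cell_labels L (2 powi l) z2)) u1 u2"
    and padded: "padded d L \<rho> (2 powi l) z1" and "\<rho> > 0"
    and D: "\<And>k. k < d \<Longrightarrow> \<bar>z1 ! k - z2 ! k\<bar> \<le> D" and k: "k < d"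
  shows "\<bar>(u1 ! k - u2 ! k) - (z1 ! k - z2 ! k)\<bar> \<le> 2 * D / (\<rho> * 2 ^ \<Lambda>) + 2 powi l / 2 ^ L"
proof -
  let ?ls1 = "val (cell_labels L (2 powi l) z1)" and ?ls2 = "val (cell_labels L (2 powi l) z2)"
  have powi: "2 powi (l - int j) = (2 powi l :: real) / 2 ^ j" for l j
    by (simp add: power_int_diff)
  have b: "labels_value l ?ls1 k \<le> z1 ! k" "z1 ! k \<le> labels_value l ?ls1 k + 2 powi l / 2 ^ L"
      "labels_value l ?ls2 k \<le> z2 ! k" "z2 ! k \<le> labels_value l ?ls2 k + 2 powi l / 2 ^ L"
    using cell_labels_value[of k z1 l L] cell_labels_value[of k z2 l L] box[OF k] k len
    by (auto simp: powi)
  have "0 \<le> D" using D[OF k] by linarith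
  show ?thesis
  proof (cases "?ls1 = ?ls2")
    case True
    have "\<bar>(u1 ! k - u2 ! k) - (z1 ! k - z2 ! k)\<bar> \<le> 2 powi l / 2 ^ L"
      using b agree True by (simp add: labels_agree_def)
    moreover have "0 \<le> 2 * D / (\<rho> * 2 ^ \<Lambda>)"
      using \<open>0 \<le> D\<close> \<open>\<rho> > 0\<close> by simp
    ultimately show ?thesis by linarith
  next
    case False
    let ?p = "common_prefix ?ls1 ?ls2"
    have "length z1 = length z2" using len by simp
    from cell_labels_separated[OF this False]
    obtain k' a where "?p < L" "k' < d"
      and "\<bar>z1 ! k' - of_int a * (2 powi l / 2 ^ (?p + 1))\<bar> \<le> \<bar>z1 ! k' - z2 ! k'\<bar>"
      using len by auto
    then have "\<rho> * (2 powi l / 2 ^ (?p + 1)) \<le> D"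
      using padded D[of k'] unfolding padded_def by (meson order_trans)
    \<comment> \<open>The separating line belongs to the level below the last common cell, hence the
      factor 2.\<close>
    then have "2 powi l / 2 ^ ?p \<le> 2 * D / \<rho>"
      using \<open>\<rho> > 0\<close> by (simp add: field_simps)
    then have "2 powi l / 2 ^ ?p / 2 ^ \<Lambda> \<le> 2 * D / \<rho> / 2 ^ \<Lambda>"
      by (rule divide_right_mono) simp
    moreover have "\<bar>(u1 ! k - u2 ! k) - (labels_value l ?ls1 k - labels_value l ?ls2 k)\<bar> \<le> 2 powi l / 2 ^ ?p / 2 ^ \<Lambda>"
      using agree False k by (simp add: labels_agree_def powi)
    moreover have "2 * D / \<rho> / 2 ^ \<Lambda> = 2 * D / (\<rho> * 2 ^ \<Lambda>)"
      by simp
    ultimately show ?thesis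
      using b by linarith
  qed
qed

section \<open>The sketch of one block as a function of the labels\<close>

definition sketch_tree :: "nat \<Rightarrow> nat \<Rightarrow> bool list list list \<Rightarrow> nat list qtree" where
  "sketch_tree d L labs = val (build d L (zip [0..<length labs] labs))"

definition point_labels :: "nat \<Rightarrow> real list list \<Rightarrow> (nat \<Rightarrow> real) \<Rightarrow> bool list list list" where
  "point_labels L ys \<sigma> = map (\<lambda>y. val (cell_labels L (4 * Delta ys) (rel_coords ys \<sigma> y))) ys"

definition pruned_tree :: "nat \<Rightarrow> nat \<Rightarrow> nat \<Rightarrow> bool list list list \<Rightarrow> nat list qtree" where
  "pruned_tree d L \<Lambda> labs = val (prune \<Lambda> (sketch_tree d L labs))"

definition leaf_numbers :: "nat \<Rightarrow> nat \<Rightarrow> nat \<Rightarrow> bool list list list \<Rightarrow> nat \<Rightarrow> nat" where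
  "leaf_numbers d L \<Lambda> labs = val (number_leaves (leaves (pruned_tree d L \<Lambda> labs)) 0 (\<lambda>_. 0))"

definition approx_point :: "int \<Rightarrow> nat \<Rightarrow> nat \<Rightarrow> nat \<Rightarrow> bool list list list \<Rightarrow> nat \<Rightarrow> real list" where
  "approx_point l d L \<Lambda> labs i =
     leaf_points l (replicate d 0) (pruned_tree d L \<Lambda> labs) ! leaf_numbers d L \<Lambda> labs i"

lemma labelled_zip:
  assumes "\<And>ls. ls \<in> set labs \<Longrightarrow> length ls = L \<and> (\<forall>lab\<in>set ls. length lab = d)"
  shows "labelled d L (zip [0..<length labs] labs)"
  using assms by (auto simp: labelled_def dest: set_zip_rightD)

context
  fixes d L :: nat and labs :: "bool list list list"
  assumes labs: "\<And>ls. ls \<in> set labs \<Longrightarrow> length ls = L \<and> (\<forall>lab\<in>set ls. length lab = d)"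
    and nonempty: "labs \<noteq> []"
begin

lemma full_sketch_tree: "full d L (sketch_tree d L labs)"
  unfolding sketch_tree_def using labelled_zip[OF labs] nonempty by (intro full_build) auto

lemma leaves_pruned_tree: "leaves (pruned_tree d L \<Lambda> labs) = leaves (sketch_tree d L labs)"
  unfolding pruned_tree_def by (rule leaves_prune[OF full_sketch_tree])

lemma sketch_tree_counts:
  "length (leaves (sketch_tree d L labs)) \<le> length labs"
  "num_nodes (sketch_tree d L labs) \<le> 1 + L * length labs"
  "(\<Sum>b\<leftarrow>leaves (sketch_tree d L labs). length b) = length labs"
  unfolding sketch_tree_def using build_counts[OF labelled_zip[OF labs]] nonempty by auto

lemma leaf_numbers_spec:
  assumes "i < length labs"
  shows "leaf_numbers d L \<Lambda> labs i < length (leaves (sketch_tree d L labs)) \<and>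
    i \<in> set (leaves (sketch_tree d L labs) ! leaf_numbers d L \<Lambda> labs i)"
proof -
  have "(i, labs ! i) \<in> set (zip [0..<length labs] labs)"
    using assms by (force simp: set_zip)
  then have "i \<in> \<Union>(set ` set (leaves (sketch_tree d L labs)))"
    using leaf_of_build[OF labelled_zip[OF labs]] by (auto simp: sketch_tree_def)
  then show ?thesis
    using number_leaves_spec[of i "leaves (sketch_tree d L labs)" 0 "\<lambda>_. 0"]
    by (auto simp: leaf_numbers_def leaves_pruned_tree)
qed

lemma approx_point_located:
  assumes "i < length labs"
  obtains b where "i \<in> set b" "(b, approx_point l d L \<Lambda> labs i) \<in> located l (replicate d 0) (pruned_tree d L \<Lambda> labs)"
proof (rule that)
  let ?j = "leaf_numbers d L \<Lambda> labs i"
  show "i \<in> set (leaves (sketch_tree d L labs) ! ?j)"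
    using leaf_numbers_spec[OF assms] by blast
  show "(leaves (sketch_tree d L labs) ! ?j, approx_point l d L \<Lambda> labs i)
      \<in> located l (replicate d 0) (pruned_tree d L \<Lambda> labs)"
    using leaf_numbers_spec[OF assms, where \<Lambda> = \<Lambda>]
    unfolding located_def approx_point_def leaves_pruned_tree set_zip
    by (auto simp: length_leaf_points leaves_pruned_tree)
qed

lemma approx_points_agree:
  assumes "i < length labs" and "j < length labs"
  shows "labels_agree d \<Lambda> l (labs ! i) (labs ! j) (approx_point l d L \<Lambda> labs i) (approx_point l d L \<Lambda> labs j)"
proof -
  obtain b1 where b1: "i \<in> set b1"
    "(b1, approx_point l d L \<Lambda> labs i) \<in> located l (replicate d 0) (pruned_tree d L \<Lambda> labs)"
    by (rule approx_point_located[OF assms(1)])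
  obtain b2 where b2: "j \<in> set b2"
    "(b2, approx_point l d L \<Lambda> labs j) \<in> located l (replicate d 0) (pruned_tree d L \<Lambda> labs)"
    by (rule approx_point_located[OF assms(2)])
  have "faithful d \<Lambda> l (sketch_tree d L labs) (located l (replicate d 0) (pruned_tree d L \<Lambda> labs))"
    unfolding pruned_tree_def by (rule faithful_prune[OF full_sketch_tree]) simp
  then obtain ls1 ls2 where ls: "path_to (sketch_tree d L labs) ls1 b1" "path_to (sketch_tree d L labs) ls2 b2"
    "labels_agree d \<Lambda> l ls1 ls2 (approx_point l d L \<Lambda> labs i) (approx_point l d L \<Lambda> labs j)"
    using b1(2) b2(2) unfolding faithful_def labels_agree_def by fast
  \<comment> \<open>\<open>faithful\<close> only provides some labels leading to the two leaves. As
    each index occurs once in the input of \<open>build\<close>, they are those of the two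
    points.\<close>
  have "ls1 = labs ! i"
    using path_to_build[OF labelled_zip[OF labs] ls(1)[unfolded sketch_tree_def] b1(1)]
    by (auto simp: set_zip)
  moreover have "ls2 = labs ! j"
    using path_to_build[OF labelled_zip[OF labs] ls(2)[unfolded sketch_tree_def] b2(1)]
    by (auto simp: set_zip)
  ultimately show ?thesis using ls(3) by simp
qed

lemma fits_pruned_tree: "fits d (long_width L) (pruned_tree d L \<Lambda> labs)"
  unfolding pruned_tree_def
proof (rule fits_prune[OF full_sketch_tree])
  show "L < 2 ^ long_width L" by (rule floorlog_leD) auto
qed

end

lemma length_point_label:
  assumes "ls \<in> set (point_labels L ys \<sigma>)"
  shows "length ls = L \<and> (\<forall>lab\<in>set ls. length lab = length (hd ys))"
  using assms length_cell_label by (fastforce simp: point_labels_def rel_coords_def)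

lemma val_quadsketch:
  "val (quadsketch L \<Lambda> ys \<sigma>) = (root_level ys,
     encode L (length ys) (pruned_tree (length (hd ys)) L \<Lambda> (point_labels L ys \<sigma>))
       (leaf_numbers (length (hd ys)) L \<Lambda> (point_labels L ys \<sigma>)))"
  by (simp add: quadsketch_def Let_def encode_def put_indices_def pruned_tree_def sketch_tree_def
      leaf_numbers_def point_labels_def o_def)

lemma length_quadsketch:
  assumes "ys \<noteq> []"
  shows "length (snd (val (quadsketch L \<Lambda> ys \<sigma>)))
    \<le> 2 * path_bits (length (hd ys)) (long_width L) \<Lambda> * length ys + 1 + length ys * index_width (length ys)"
proof -
  let ?d = "length (hd ys)" and ?labs = "point_labels L ys \<sigma>"
  have labs: "?labs \<noteq> []" using assms by (simp add: point_labels_def)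
  have "length (put_tree (long_width L) (pruned_tree ?d L \<Lambda> ?labs))
      \<le> 2 * path_bits ?d (long_width L) \<Lambda> * length (leaves (sketch_tree ?d L ?labs)) + 1"
    unfolding pruned_tree_def
    by (rule length_put_tree_prune[OF full_sketch_tree[OF length_point_label labs]])
  also have "\<dots> \<le> 2 * path_bits ?d (long_width L) \<Lambda> * length ?labs + 1"
    using sketch_tree_counts(1)[OF length_point_label labs] by (intro add_mono mult_left_mono) auto
  finally show ?thesis
    unfolding val_quadsketch by (simp add: encode_def length_put_indices point_labels_def)
qed

lemma floorlog_le_self: "floorlog 2 a \<le> a"
  by (rule floorlog_leI) (auto simp: less_exp)

text \<open>Everything up to pruning is linear in \<open>n * d * L\<close>. Listing the leaves of
  the pruned tree and emitting the bits are each paid for by the output length, hence its factor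
  2.\<close>

lemma time_quadsketch:
  assumes "ys \<noteq> []" and "length (hd ys) \<ge> 1" and "L \<ge> 1"
  shows "time (quadsketch L \<Lambda> ys \<sigma>)
    \<le> 100 * (length ys * length (hd ys) * L) + 2 * length (snd (val (quadsketch L \<Lambda> ys \<sigma>)))"
proof -
  define n where "n = length ys"
  define d where "d = length (hd ys)"
  define labs where "labs = point_labels L ys \<sigma>"
  define t where "t = sketch_tree d L labs"
  define p where "p = pruned_tree d L \<Lambda> labs"
  define bs where "bs = snd (val (quadsketch L \<Lambda> ys \<sigma>))"
  have pos: "n \<ge> 1" "d \<ge> 1" "L \<ge> 1"
    using assms by (auto simp: n_def d_def Suc_le_eq)
  have labs_len: "\<And>ls. ls \<in> set labs \<Longrightarrow> length ls = L \<and> (\<forall>lab\<in>set ls. length lab = d)"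
    using length_point_label unfolding labs_def d_def by blast
  have labs: "labs \<noteq> []" "length labs = n"
    using assms(1) by (auto simp: labs_def point_labels_def n_def)
  have "time (mapM (cell_labels L (4 * Delta ys)) (map (rel_coords ys \<sigma>) ys)) = n * (L * (2 * d + 1) + 1) + n + 1"
    by (simp add: time_mapM time_cell_labels o_def rel_coords_def n_def d_def sum_list_triv)
  moreover have "time (build d L (zip [0..<n] labs)) \<le> 1 + 13 * (n * (d + 1) * (L + 1))"
    using time_build[OF labelled_zip[OF labs_len]] labs pos by auto
  moreover have "time (prune \<Lambda> t) \<le> 6 * (1 + L * n)"
    using time_prune[of \<Lambda> t] sketch_tree_counts(2)[OF labs_len labs(1)] labs(2) by (simp add: t_def)
  moreover have "num_nodes p \<le> length bs"
    using num_nodes_le_put_tree[of p "long_width L"]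
    by (simp add: bs_def val_quadsketch encode_def p_def d_def labs_def)
  moreover have "time (number_leaves (leaves p) 0 (\<lambda>_. 0)) = n + 1"
    using sketch_tree_counts(3)[OF labs_len labs(1)] leaves_pruned_tree[OF labs_len labs(1)] labs(2)
    by (simp add: time_number_leaves p_def)
  moreover have "long_width L \<le> L" "index_width n \<le> n"
    using floorlog_le_self[of L] floorlog_le_self[of "n - 1"] by auto
  moreover have "time (quadsketch L \<Lambda> ys \<sigma>) = 4 * n * (d + 1) + (d + 4 * n * d)
      + time (mapM (cell_labels L (4 * Delta ys)) (map (rel_coords ys \<sigma>) ys)) + n
      + time (build d L (zip [0..<n] labs)) + time (prune \<Lambda> t) + num_nodes p
      + time (number_leaves (leaves p) 0 (\<lambda>_. 0)) + (long_width L + index_width n + n) + length bs + 1"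
    unfolding bs_def val_quadsketch
    by (simp add: quadsketch_def Let_def n_def d_def p_def t_def labs_def encode_def put_indices_def
        pruned_tree_def sketch_tree_def leaf_numbers_def point_labels_def o_def)
  ultimately have "time (quadsketch L \<Lambda> ys \<sigma>) \<le> 4 * n * (d + 1) + (d + 4 * n * d)
      + (n * (L * (2 * d + 1) + 1) + n + 1) + n + (1 + 13 * (n * (d + 1) * (L + 1))) + 6 * (1 + L * n)
      + length bs + (n + 1) + (L + n + n) + length bs + 1"
    by linarith
  also have "\<dots> \<le> 100 * (n * d * L) + 2 * length bs"
  proof -
    \<comment> \<open>All three factors are at least 1, so each lower monomial is at most
      \<open>V\<close>.\<close>
    define V where "V = n * d * L"
    have "n \<le> V" "d \<le> V" "L \<le> V" "1 \<le> V" "n * d \<le> V" "n * L \<le> V"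
      using pos by (auto simp: V_def Suc_le_eq)
    moreover have "4 * n * (d + 1) = 4 * (n * d) + 4 * n" "d + 4 * n * d = d + 4 * (n * d)"
      "n * (L * (2 * d + 1) + 1) = 2 * V + n * L + n" "6 * (1 + L * n) = 6 + 6 * (n * L)"
      "n * (d + 1) * (L + 1) = V + n * d + n * L + n"
      by (auto simp: V_def algebra_simps)
    ultimately show ?thesis
      unfolding V_def[symmetric] by linarith
  qed
  finally show ?thesis by (simp add: n_def d_def bs_def)
qed

subsection \<open>Random shifts\<close>

text \<open>Shifts \<open>x\<close> that bring a coordinate with offset \<open>c\<close> within
  \<open>r\<close> of a grid line of spacing \<open>h\<close>.\<close>

definition near_grid :: "real \<Rightarrow> real \<Rightarrow> real \<Rightarrow> real set" where
  "near_grid c r h = {x. \<exists>a::int. \<bar>c - x - a * h\<bar> < r}"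

lemma near_grid_borel [measurable]: "near_grid c r h \<in> sets borel"
proof -
  have "near_grid c r h = (\<Union>a::int. {x. \<bar>c - x - a * h\<bar> < r})"
    by (auto simp: near_grid_def)
  also have "\<dots> \<in> sets borel" by measurable
  finally show ?thesis .
qed

text \<open>The shifts in question lie in strips of length \<open>2 * \<rho> * h\<close> around the
  grid lines, and about \<open>2 * D / h\<close> of these strips meet the interval.\<close>

lemma measure_near_grid:
  assumes "0 < h" "h \<le> 2 * D" "0 \<le> \<rho>" "\<rho> \<le> 1 / 2"
  shows "measure (uniform_measure lborel {-D..D}) (near_grid c (\<rho> * h) h) \<le> 6 * \<rho>"
proof -
  define A where "A = {\<lceil>(c - D) / h - \<rho>\<rceil>..\<lfloor>(c + D) / h + \<rho>\<rfloor>}"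
  define F where "F a = cbox (c - of_int a * h - \<rho> * h) (c - of_int a * h + \<rho> * h)" for a :: int
  have D: "D > 0" using assms by linarith
  have "{-D..D} \<inter> near_grid c (\<rho> * h) h \<subseteq> (\<Union>a\<in>A. F a)"
  proof
    fix x assume x: "x \<in> {-D..D} \<inter> near_grid c (\<rho> * h) h"
    then obtain a :: int where a: "\<bar>c - x - of_int a * h\<bar> < \<rho> * h"
      by (auto simp: near_grid_def)
    have "c - D - \<rho> * h \<le> of_int a * h" "of_int a * h \<le> c + D + \<rho> * h"
      using a x by (auto simp: abs_less_iff)
    then have "(c - D - \<rho> * h) / h \<le> of_int a" "of_int a \<le> (c + D + \<rho> * h) / h"
      using assms(1) by (simp_all add: pos_divide_le_eq pos_le_divide_eq)
    then have "a \<in> A"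
      using assms(1) by (simp add: A_def ceiling_le_iff le_floor_iff add_divide_distrib diff_divide_distrib)
    moreover have "x \<in> F a"
      using a by (auto simp: F_def abs_less_iff)
    ultimately show "x \<in> (\<Union>a\<in>A. F a)" by blast
  qed
  moreover have "(\<Union>a\<in>A. F a) \<in> fmeasurable lborel"
    unfolding F_def A_def by (intro fmeasurable.finite_UN fmeasurable_cbox) auto
  ultimately have "measure lborel ({-D..D} \<inter> near_grid c (\<rho> * h) h) \<le> measure lborel (\<Union>a\<in>A. F a)"
    by (intro measure_mono_fmeasurable) auto
  also have "\<dots> \<le> (\<Sum>a\<in>A. measure lborel (F a))"
    by (rule measure_UNION_le) (auto simp: A_def F_def)
  also have "\<dots> = card A * (2 * \<rho> * h)"
    using assms by (simp add: F_def)
  also have "\<dots> \<le> (2 * D / h + 2 * \<rho> + 1) * (2 * \<rho> * h)"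
  proof (rule mult_right_mono)
    have "(c + D) / h - (c - D) / h = 2 * D / h"
      by (simp add: diff_divide_distrib[symmetric])
    moreover have "0 \<le> D / h" using D assms by simp
    ultimately show "real (card A) \<le> 2 * D / h + 2 * \<rho> + 1"
      unfolding A_def using assms(3) by (simp add: of_nat_diff) linarith
  qed (use assms in auto)
  also have "\<dots> = 4 * \<rho> * D + (2 * \<rho> + 1) * (2 * \<rho>) * h"
    using assms(1) by (simp add: field_simps)
  \<comment> \<open>As \<open>2 * \<rho> \<le> 1\<close> and \<open>h \<le> 2 * D\<close>, the
    excess strips at the boundary contribute at most 8 \<rho> D beside the main term 4 \<rho> D; the
    total 12 \<rho> D is 6 \<rho> times the length of the interval.\<close>
  also have "\<dots> \<le> 4 * \<rho> * D + (1 + 1) * (2 * \<rho>) * (2 * D)"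
    using assms by (intro add_mono mult_mono) auto
  also have "\<dots> = 6 * \<rho> * (2 * D)" by simp
  finally have "measure lborel ({-D..D} \<inter> near_grid c (\<rho> * h) h) / (2 * D) \<le> 6 * \<rho>"
    using D by (simp add: pos_divide_le_eq)
  moreover have "measure (uniform_measure lborel {-D..D}) (near_grid c (\<rho> * h) h)
      = measure lborel ({-D..D} \<inter> near_grid c (\<rho> * h) h) / (2 * D)"
    using D by (subst measure_uniform_measure) auto
  ultimately show ?thesis by simp
qed

lemma prob_space_uniform_interval:
  assumes "D > (0::real)"
  shows "prob_space (uniform_measure lborel {-D..D})"
  using assms by (intro prob_space_uniform_measure) auto

text \<open>
  \<open>4 * D / 2 ^ (p + 1)\<close> is the side of the cells \<open>p + 1\<close> levels below the root.
\<close>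

definition bad_shifts :: "nat \<Rightarrow> real \<Rightarrow> real \<Rightarrow> real \<Rightarrow> real set" where
  "bad_shifts L \<rho> D c =
     - {-D..D} \<union> (\<Union>p<L. near_grid c (\<rho> * (4 * D / 2 ^ (p + 1))) (4 * D / 2 ^ (p + 1)))"

lemma bad_shifts_borel [measurable]: "bad_shifts L \<rho> D c \<in> sets borel"
  unfolding bad_shifts_def by measurable

lemma measure_bad_shifts:
  assumes "D > 0" "0 \<le> \<rho>" "\<rho> \<le> 1 / 2"
  shows "measure (uniform_measure lborel {-D..D}) (bad_shifts L \<rho> D c) \<le> real L * (6 * \<rho>)"
proof -
  let ?M = "uniform_measure lborel {-D..D}"
  let ?h = "\<lambda>p::nat. 4 * D / 2 ^ (p + 1)"
  interpret prob_space ?M by (rule prob_space_uniform_interval[OF assms(1)])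
  have out: "measure ?M (- {-D..D}) = 0"
    using assms(1) by (subst measure_uniform_measure) auto
  have "measure ?M (bad_shifts L \<rho> D c)
      \<le> measure ?M (- {-D..D}) + measure ?M (\<Union>p<L. near_grid c (\<rho> * ?h p) (?h p))"
    unfolding bad_shifts_def by (rule measure_Un_le) measurable
  also have "\<dots> \<le> 0 + (\<Sum>p<L. measure ?M (near_grid c (\<rho> * ?h p) (?h p)))"
    unfolding out by (intro add_mono finite_measure_subadditive_finite) auto
  also have "\<dots> \<le> 0 + (\<Sum>p<L. 6 * \<rho>)"
  proof (intro add_mono sum_mono measure_near_grid)
    fix p :: nat
    have "4 * D * 1 \<le> 4 * D * 2 ^ p"
      using assms(1) by (intro mult_left_mono) auto
    then show "?h p \<le> 2 * D" by (simp add: field_simps)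
  qed (use assms in auto)
  finally show ?thesis by simp
qed

text \<open>Union bound over the coordinates, each bad event being measured by its marginal.\<close>

lemma measure_PiM_avoid_ge:
  fixes M :: "'i \<Rightarrow> 'a measure"
  assumes prob: "\<And>x. prob_space (M x)" and fin: "finite I"
    and sets: "\<And>x. x \<in> I \<Longrightarrow> Z x \<in> sets (M x)"
    and small: "\<And>x. x \<in> I \<Longrightarrow> measure (M x) (Z x) \<le> q"
    and E: "E \<in> sets (PiM I M)" "\<And>\<sigma>. \<sigma> \<in> space (PiM I M) \<Longrightarrow> (\<And>x. x \<in> I \<Longrightarrow> \<sigma> x \<notin> Z x) \<Longrightarrow> \<sigma> \<in> E"
  shows "1 - real (card I) * q \<le> measure (PiM I M) E"
proof -
  interpret product_prob_space M I
    using prob by (simp add: product_prob_space_def product_prob_space_axioms_def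
        product_sigma_finite_def prob_space_imp_sigma_finite)
  let ?P = "PiM I M"
  let ?Z = "\<lambda>x. {\<sigma> \<in> space ?P. \<sigma> x \<in> Z x}"
  have Z: "?Z x \<in> sets ?P" if "x \<in> I" for x
    using measurable_sets[OF measurable_component_singleton[OF that, of M] sets[OF that]]
    by (simp add: vimage_def Int_def conj_commute)
  have "measure ?P (?Z x) \<le> q" if "x \<in> I" for x
    using emeasure_PiM_Collect_single[OF that sets[OF that]] small[OF that]
    by (simp add: measure_def)
  then have "(\<Sum>x\<in>I. measure ?P (?Z x)) \<le> (\<Sum>x\<in>I. q)"
    by (rule sum_mono)
  moreover have "measure ?P (\<Union>x\<in>I. ?Z x) \<le> (\<Sum>x\<in>I. measure ?P (?Z x))"
    using Z fin by (intro measure_UNION_le) auto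
  ultimately have "measure ?P (\<Union>x\<in>I. ?Z x) \<le> real (card I) * q" by simp
  moreover have "measure ?P (space ?P - (\<Union>x\<in>I. ?Z x)) = 1 - measure ?P (\<Union>x\<in>I. ?Z x)"
    using Z fin by (intro P.prob_compl sets.finite_UN) auto
  moreover have "measure ?P (space ?P - (\<Union>x\<in>I. ?Z x)) \<le> measure ?P E"
    using E by (intro P.finite_measure_mono) auto
  ultimately show ?thesis by linarith
qed

section \<open>Measurability of the labels\<close>

lemma measurable_Cons_countable:
  fixes f :: "'a \<Rightarrow> 'b::countable"
  assumes [measurable]: "f \<in> M \<rightarrow>\<^sub>M count_space UNIV" "g \<in> M \<rightarrow>\<^sub>M count_space UNIV"
  shows "(\<lambda>x. f x # g x) \<in> M \<rightarrow>\<^sub>M count_space UNIV"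
\<comment> \<open>The head takes countably many values, and for each fixed value only the tail
  varies.\<close>
proof (rule measurable_compose_countable[OF _ assms(1)])
  show "(\<lambda>x. i # g x) \<in> M \<rightarrow>\<^sub>M count_space UNIV" for i
    by (rule measurable_compose[OF assms(2)]) simp
qed

lemma measurable_map_countable:
  fixes f :: "'c \<Rightarrow> 'a \<Rightarrow> 'b::countable"
  assumes "\<And>y. y \<in> set ys \<Longrightarrow> f y \<in> M \<rightarrow>\<^sub>M count_space UNIV"
  shows "(\<lambda>x. map (\<lambda>y. f y x) ys) \<in> M \<rightarrow>\<^sub>M count_space UNIV"
  using assms
proof (induction ys)
  case (Cons y ys)
  then show ?case by (auto intro!: measurable_Cons_countable)
qed simp

lemma measurable_cell_labels:
  assumes "\<And>k. k \<in> set ks \<Longrightarrow> c k \<in> borel_measurable M"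
  shows "(\<lambda>x. val (cell_labels L s (map (\<lambda>k. c k x) ks))) \<in> M \<rightarrow>\<^sub>M count_space UNIV"
  using assms
proof (induction L arbitrary: s c)
  case (Suc L)
  let ?h = "s / 2"
  let ?c = "\<lambda>k x. if ?h \<le> c k x then c k x - ?h else c k x"
  have "(\<lambda>x. val (cell_labels L ?h (map (\<lambda>k. ?c k x) ks))) \<in> M \<rightarrow>\<^sub>M count_space UNIV"
  proof (rule Suc.IH)
    fix k assume "k \<in> set ks"
    then have [measurable]: "c k \<in> borel_measurable M" by (rule Suc.prems)
    show "?c k \<in> borel_measurable M" by measurable
  qed
  moreover have "(\<lambda>x. map (\<lambda>k. ?h \<le> c k x) ks) \<in> M \<rightarrow>\<^sub>M count_space UNIV"
  proof (rule measurable_map_countable)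
    fix k assume "k \<in> set ks"
    then have [measurable]: "c k \<in> borel_measurable M" by (rule Suc.prems)
    show "(\<lambda>x. ?h \<le> c k x) \<in> M \<rightarrow>\<^sub>M count_space UNIV" by measurable
  qed
  ultimately show ?case
    by (auto simp: Let_def o_def intro!: measurable_Cons_countable)
qed simp

section \<open>Distances and their perturbation\<close>

lemma vdist_map_nth:
  assumes "distinct bs"
  shows "vdist (map ((!) x) bs) (map ((!) y) bs) = L2_set (\<lambda>k. x ! k - y ! k) (set bs)"
  using sum.reindex_bij_betw[OF bij_betw_nth[OF assms refl refl], of "\<lambda>k. (x ! k - y ! k)\<^sup>2"]
  by (simp add: vdist_def L2_set_def)

lemma vdist_nonneg: "0 \<le> vdist x y"
  by (simp add: vdist_def L2_set_nonneg)

lemma vdist_commute: "length x = length y \<Longrightarrow> vdist x y = vdist y x"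
  by (simp add: vdist_def L2_set_def power2_commute)

lemma abs_nth_le_vdist: "k < length x \<Longrightarrow> \<bar>x ! k - y ! k\<bar> \<le> vdist x y"
  unfolding vdist_def L2_set_def by (rule order_trans[OF _ real_sqrt_le_mono[OF member_le_sum[of k]]]) auto

text \<open>The norm of the error vector is bounded by the sum of its absolute values. This gives
  the factor \<open>length x\<close> rather than its square root, which the constant in
  \<open>Lambda_param\<close> absorbs.\<close>

lemma vdist_perturb:
  fixes e :: real
  assumes len: "length x' = length x"
    and err: "\<And>k. k < length x \<Longrightarrow> \<bar>(x' ! k - y' ! k) - (x ! k - y ! k)\<bar> \<le> e"
  shows "\<bar>vdist x' y' - vdist x y\<bar> \<le> length x * e"
proof -
  let ?A = "{..<length x}"
  let ?f = "\<lambda>k. x' ! k - y' ! k" and ?g = "\<lambda>k. x ! k - y ! k"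
  have "L2_set ?f ?A \<le> L2_set ?g ?A + L2_set (\<lambda>k. ?f k - ?g k) ?A"
    using L2_set_triangle_ineq[of ?g "\<lambda>k. ?f k - ?g k" ?A] by simp
  moreover have "L2_set ?g ?A \<le> L2_set ?f ?A + L2_set (\<lambda>k. ?g k - ?f k) ?A"
    using L2_set_triangle_ineq[of ?f "\<lambda>k. ?g k - ?f k" ?A] by simp
  moreover have "L2_set (\<lambda>k. ?g k - ?f k) ?A = L2_set (\<lambda>k. ?f k - ?g k) ?A"
    by (simp add: L2_set_def power2_commute)
  moreover have "L2_set (\<lambda>k. ?f k - ?g k) ?A \<le> (\<Sum>k\<in>?A. \<bar>?f k - ?g k\<bar>)"
    by (rule L2_set_le_sum_abs)
  moreover have "(\<Sum>k\<in>?A. \<bar>?f k - ?g k\<bar>) \<le> (\<Sum>k\<in>?A. e)"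
    using err by (intro sum_mono) auto
  ultimately show ?thesis
    unfolding vdist_def len by simp
qed

lemma vdist_project_le:
  assumes "distinct B" and "set B \<subseteq> {..<length x}"
  shows "vdist (map ((!) x) B) (map ((!) y) B) \<le> vdist x y"
  unfolding vdist_map_nth[OF assms(1)] unfolding vdist_def L2_set_def
  using assms(2) by (intro real_sqrt_le_mono sum_mono2) auto

section \<open>Error within one block\<close>

lemma radius_ge: "y \<in> set ys \<Longrightarrow> vdist (hd ys) y \<le> radius ys"
  by (simp add: radius_def)

lemma radius_nonneg: "ys \<noteq> [] \<Longrightarrow> 0 \<le> radius ys"
  using radius_ge[of "hd ys" ys] vdist_nonneg[of "hd ys" "hd ys"] by simp

lemma Delta_pos: "0 < Delta ys"
  by (simp add: Delta_def)

lemma Delta_root_level: "4 * Delta ys = 2 powi root_level ys"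
  by (simp add: Delta_def root_level_def power_int_add)

lemma Delta_bounds:
  assumes "0 < radius ys"
  shows "radius ys \<le> Delta ys" and "Delta ys \<le> 2 * radius ys"
proof -
  have Delta: "Delta ys = 2 powr of_int \<lceil>log 2 (radius ys)\<rceil>"
    using assms by (simp add: Delta_def log_Delta_def powr_real_of_int')
  have "2 powr log 2 (radius ys) \<le> Delta ys"
    unfolding Delta by (intro powr_mono) linarith+
  then show "radius ys \<le> Delta ys" using assms by simp
  have "Delta ys \<le> 2 powr (log 2 (radius ys) + 1)"
    unfolding Delta by (intro powr_mono) linarith+
  then show "Delta ys \<le> 2 * radius ys"
    using assms by (simp add: powr_add)
qed

text \<open>Includes the degenerate radius 0, where \<open>Delta\<close> has its default value
  1.\<close>

lemma radius_le_Delta: "ys \<noteq> [] \<Longrightarrow> radius ys \<le> Delta ys"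
  using Delta_bounds(1)[of ys] radius_nonneg[of ys] Delta_pos[of ys] by force

lemma nth_rel_coords:
  "k < length (hd ys) \<Longrightarrow> rel_coords ys \<sigma> y ! k = y ! k - (hd ys ! k + \<sigma> k - 2 * Delta ys)"
  by (simp add: rel_coords_def)

lemma abs_hd_le:
  assumes "y \<in> set ys" and "k < length (hd ys)"
  shows "\<bar>hd ys ! k - y ! k\<bar> \<le> radius ys"
  using abs_nth_le_vdist[OF assms(2), of y] radius_ge[OF assms(1)] by linarith

lemma block_error:
  fixes ys :: "real list list"
  defines "d \<equiv> length (hd ys)"
  assumes "i < length ys" "j < length ys" and "\<rho> > 0"
    and shift: "\<And>k. k < d \<Longrightarrow> \<sigma> k \<in> {- Delta ys..Delta ys}"
    and padded: "padded d L \<rho> (4 * Delta ys) (rel_coords ys \<sigma> (ys ! i))"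
    and D: "\<And>k. k < d \<Longrightarrow> \<bar>ys ! i ! k - ys ! j ! k\<bar> \<le> D" and k: "k < d"
  shows "\<bar>(approx_point (root_level ys) d L \<Lambda> (point_labels L ys \<sigma>) i ! k
      - approx_point (root_level ys) d L \<Lambda> (point_labels L ys \<sigma>) j ! k) - (ys ! i ! k - ys ! j ! k)\<bar>
    \<le> 2 * D / (\<rho> * 2 ^ \<Lambda>) + 8 * radius ys / 2 ^ L"
proof -
  let ?labs = "point_labels L ys \<sigma>"
  let ?u = "approx_point (root_level ys) d L \<Lambda> ?labs"
  let ?z = "\<lambda>i. rel_coords ys \<sigma> (ys ! i)"
  have ys: "ys \<noteq> []" using assms(2) by auto
  have labs: "?labs \<noteq> []" "length ?labs = length ys"
    using ys by (auto simp: point_labels_def)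
  have nth: "?labs ! i = val (cell_labels L (2 powi root_level ys) (?z i))" if "i < length ys" for i
    using that by (simp add: point_labels_def Delta_root_level)
  have diff: "?z i ! k - ?z j ! k = ys ! i ! k - ys ! j ! k" if "k < d" for k
    using that by (simp add: nth_rel_coords d_def)
  have agree: "labels_agree d \<Lambda> (root_level ys) (?labs ! i) (?labs ! j) (?u i) (?u j)"
    using approx_points_agree[OF length_point_label labs(1)] assms(2,3) labs(2) unfolding d_def by simp
  show ?thesis
  \<comment> \<open>With radius 0 the cube has its default size, so leaf cells are not small
    compared with the radius. But then all points of the block coincide and the error
    vanishes.\<close>
  proof (cases "radius ys = 0")
    case True
    have "ys ! i ! k = hd ys ! k" if "i < length ys" "k < d" for i k
      using abs_hd_le[of "ys ! i" ys k] that True by (simp add: d_def)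
    then have same: "ys ! i ! k = ys ! j ! k" if "k < d" for k
      using assms(2,3) that by simp
    then have "?z i = ?z j"
      by (simp add: rel_coords_def d_def)
    then have "?u i = ?u j"
      using agree nth assms(2,3) by (simp add: labels_agree_def)
    moreover have "0 \<le> 2 * D / (\<rho> * 2 ^ \<Lambda>)"
      using D[OF k] \<open>\<rho> > 0\<close> by simp
    ultimately show ?thesis
      using same[OF k] True by simp
  next
    case False
    then have radius: "0 < radius ys" using radius_nonneg[OF ys] by simp
    \<comment> \<open>A point is within \<open>Delta ys\<close> of the head, and the shift moves the
      centre by at most \<open>Delta ys\<close>, so the point stays within half the side
      \<open>4 * Delta ys\<close> of the centre.\<close>
    have box: "0 \<le> ?z i ! k \<and> ?z i ! k \<le> 2 powi root_level ys" if "i < length ys" "k < d" for i k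
      using abs_hd_le[of "ys ! i" ys k] that radius_le_Delta[OF ys] shift[of k]
      by (simp add: nth_rel_coords d_def abs_le_iff flip: Delta_root_level)
    have "\<bar>(?u i ! k - ?u j ! k) - (?z i ! k - ?z j ! k)\<bar>
        \<le> 2 * D / (\<rho> * 2 ^ \<Lambda>) + 2 powi root_level ys / 2 ^ L"
    proof (rule cell_error)
      show "length (?z i) = d" "length (?z j) = d" by (simp_all add: rel_coords_def d_def)
      show "labels_agree d \<Lambda> (root_level ys) (val (cell_labels L (2 powi root_level ys) (?z i)))
          (val (cell_labels L (2 powi root_level ys) (?z j))) (?u i) (?u j)"
        using agree nth assms(2,3) by simp
      show "padded d L \<rho> (2 powi root_level ys) (?z i)"
        using padded by (simp add: Delta_root_level)
      show "\<bar>?z i ! k - ?z j ! k\<bar> \<le> D" if "k < d" for k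
        using D[OF that] diff[OF that] by simp
    qed (use box assms(2,3) k \<open>\<rho> > 0\<close> in auto)
    \<comment> \<open>The side is \<open>4 * Delta ys\<close>, and rounding up to a power of two at
      most doubles the radius.\<close>
    moreover have "2 powi root_level ys / 2 ^ L \<le> 8 * radius ys / 2 ^ L"
      using Delta_bounds(2)[OF radius] by (intro divide_right_mono) (simp_all flip: Delta_root_level)
    ultimately show ?thesis
      using diff[OF k] by simp
  qed
qed

lemma length_leaf_point:
  assumes "fits d w t" and "length v = d" and "u \<in> set (leaf_points l v t)"
  shows "length u = d"
  using assms
proof (induction arbitrary: l v rule: fits.induct)
  case (fits_Node cs)
  from fits_Node.prems(2) obtain e t where mem: "(e, t) \<in> set cs"
    and u: "u \<in> set (case_prod leaf_points (edge_step e (l, v)) t)"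
    unfolding leaf_points_Node by auto
  have "length (snd (edge_step e (l, v))) = d"
    using fits_Node.hyps(2)[OF mem] fits_Node.prems(1) by (cases e) auto
  then show ?case
    using fits_Node.IH[OF mem] u by (auto simp: case_prod_unfold)
qed simp

lemma length_approx_point:
  assumes "\<And>ls. ls \<in> set labs \<Longrightarrow> length ls = L \<and> (\<forall>lab\<in>set ls. length lab = d)" and "labs \<noteq> []"
    and "i < length labs"
  shows "length (approx_point l d L \<Lambda> labs i) = d"
proof -
  have "leaf_numbers d L \<Lambda> labs i < length (leaf_points l (replicate d 0) (pruned_tree d L \<Lambda> labs))"
    using leaf_numbers_spec[OF assms, where \<Lambda> = \<Lambda>]
    by (simp add: length_leaf_points leaves_pruned_tree[OF assms(1,2)])
  then have "approx_point l d L \<Lambda> labs i \<in> set (leaf_points l (replicate d 0) (pruned_tree d L \<Lambda> labs))"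
    unfolding approx_point_def by (rule nth_mem)
  with fits_pruned_tree[OF assms(1,2)] length_replicate show ?thesis
    by (rule length_leaf_point)
qed

section \<open>Putting the blocks together\<close>

lemma concat_map_nth_property:
  assumes "\<And>t. t \<in> set ts \<Longrightarrow> length (a t) = length (c t) \<and> length (b t) = length (c t) \<and> length (e t) = length (c t)"
    and "\<And>t k. t \<in> set ts \<Longrightarrow> k < length (c t) \<Longrightarrow> R (a t ! k) (b t ! k) (c t ! k) (e t ! k)"
    and "k < length (concat (map c ts))"
  shows "R (concat (map a ts) ! k) (concat (map b ts) ! k) (concat (map c ts) ! k) (concat (map e ts) ! k)"
  using assms
proof (induction ts arbitrary: k)
  case (Cons t ts)
  show ?case
  proof (cases "k < length (c t)")
    case True
    then show ?thesis using Cons.prems by (simp add: nth_append)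
  next
    case False
    then have "k - length (c t) < length (concat (map c ts))"
      using Cons.prems(3) by auto
    then show ?thesis
      using Cons.IH[of "k - length (c t)"] Cons.prems(1,2) False by (simp add: nth_append)
  qed
qed simp

abbreviation block_labels :: "nat \<Rightarrow> nat list list \<Rightarrow> real list list \<Rightarrow> (nat \<times> nat \<Rightarrow> real) \<Rightarrow> nat \<Rightarrow> bool list list list" where
  "block_labels L Bs X \<sigma> t \<equiv> point_labels L (project (Bs ! t) X) (\<lambda>k. \<sigma> (t, k))"

abbreviation block_sketch :: "nat \<Rightarrow> nat \<Rightarrow> nat list list \<Rightarrow> real list list \<Rightarrow> (nat \<times> nat \<Rightarrow> real) \<Rightarrow> nat \<Rightarrow> (int \<times> bool list) tm" where
  "block_sketch L \<Lambda> Bs X \<sigma> t \<equiv> quadsketch L \<Lambda> (project (Bs ! t) X) (\<lambda>k. \<sigma> (t, k))"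

lemma zip_upt_nth: "zip [0..<length Bs] Bs = map (\<lambda>t. (t, Bs ! t)) [0..<length Bs]"
  by (rule nth_equalityI) auto

lemma val_block_quadsketch:
  "val (block_quadsketch L \<Lambda> Bs X \<sigma>) =
    (map (\<lambda>t. fst (val (block_sketch L \<Lambda> Bs X \<sigma> t))) [0..<length Bs],
     concat (map (\<lambda>t. snd (val (block_sketch L \<Lambda> Bs X \<sigma> t))) [0..<length Bs]))"
  by (simp add: block_quadsketch_def zip_upt_nth o_def)

lemma time_block_quadsketch:
  "time (block_quadsketch L \<Lambda> Bs X \<sigma>) =
    (\<Sum>t\<leftarrow>[0..<length Bs]. length X * (length (Bs ! t) + 1) + time (block_sketch L \<Lambda> Bs X \<sigma> t)) + length Bs + 1
    + (\<Sum>t\<leftarrow>[0..<length Bs]. 1 + length (snd (val (block_sketch L \<Lambda> Bs X \<sigma> t)))) + 1"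
  by (simp add: block_quadsketch_def zip_upt_nth time_mapM o_def case_prod_unfold)

lemma length_hd_project: "X \<noteq> [] \<Longrightarrow> length (hd (project B X)) = length B"
  by (cases X) (auto simp: project_def)

lemma length_project [simp]: "length (project B X) = length X"
  by (simp add: project_def)

lemma leaf_numbers_less:
  assumes "X \<noteq> []" and "i < length X"
  shows "leaf_numbers (length B) L \<Lambda> (point_labels L (project B X) \<sigma>) i < length X"
proof -
  let ?labs = "point_labels L (project B X) \<sigma>"
  have labs: "?labs \<noteq> []" "length ?labs = length X"
    using assms(1) by (auto simp: point_labels_def project_def)
  note len = length_point_label[of _ L "project B X" \<sigma>, unfolded length_hd_project[OF assms(1)]]
  have "leaf_numbers (length B) L \<Lambda> ?labs i < length (leaves (sketch_tree (length B) L ?labs))"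
    by (rule leaf_numbers_spec[OF len labs(1), THEN conjunct1]) (simp_all add: assms(2) labs(2))
  also have "\<dots> \<le> length X"
    unfolding labs(2)[symmetric] by (rule sketch_tree_counts(1)[OF len labs(1)])
  finally show ?thesis .
qed

text \<open>From here on the bit string is out of the picture: a decompressed point depends on the
  root levels, which are not random, and on the labels.\<close>

lemma decompress_block_quadsketch:
  assumes "X \<noteq> []" and "i < length X"
  shows "decompress L (length X) Bs (val (block_quadsketch L \<Lambda> Bs X \<sigma>)) i =
    concat (map (\<lambda>t. approx_point (root_level (project (Bs ! t) X)) (length (Bs ! t)) L \<Lambda>
      (block_labels L Bs X \<sigma> t) i) [0..<length Bs])"
proof -
  let ?tree = "\<lambda>t. pruned_tree (length (Bs ! t)) L \<Lambda> (block_labels L Bs X \<sigma> t)"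
  let ?idx = "\<lambda>t. leaf_numbers (length (Bs ! t)) L \<Lambda> (block_labels L Bs X \<sigma> t)"
  have labs: "block_labels L Bs X \<sigma> t \<noteq> []" for t
    using assms(1) by (auto simp: point_labels_def project_def)
  have val: "val (block_sketch L \<Lambda> Bs X \<sigma> t) =
      (root_level (project (Bs ! t) X), encode L (length X) (?tree t) (?idx t))" for t
    by (simp add: val_quadsketch length_hd_project[OF assms(1)])
  have "get_blocks L (length X) (map ((!) Bs) [0..<length Bs])
      (concat (map (\<lambda>t. encode L (length X) (?tree t) (?idx t)) [0..<length Bs])) =
    map (\<lambda>t. (shape (?tree t), map (?idx t) [0..<length X])) [0..<length Bs]"
  proof (rule get_blocks_encode)
    show "fits (length (Bs ! t)) (long_width L) (?tree t)" for t
      by (rule fits_pruned_tree[OF length_point_label[of _ L "project (Bs ! t) X", unfolded length_hd_project[OF assms(1)]] labs])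
    show "i < length X \<Longrightarrow> ?idx t i < length X" for t i
      by (rule leaf_numbers_less[OF assms(1)])
  qed
  then have blocks: "get_blocks L (length X) Bs (snd (val (block_quadsketch L \<Lambda> Bs X \<sigma>))) =
    map (\<lambda>t. (shape (?tree t), map (?idx t) [0..<length X])) [0..<length Bs]"
    by (simp add: val_block_quadsketch val map_nth)
  have zip: "zip Bs (zip (map f [0..<length Bs]) (map g [0..<length Bs])) =
      map (\<lambda>t. (Bs ! t, f t, g t)) [0..<length Bs]" for f :: "nat \<Rightarrow> int" and g :: "nat \<Rightarrow> unit qtree \<times> nat list"
    by (rule nth_equalityI) auto
  show ?thesis
    unfolding decompress_def blocks unfolding val_block_quadsketch fst_conv zip map_map
    using assms(2)
    by (intro arg_cong[of _ _ concat] map_cong refl) (simp add: val leaf_points_shape approx_point_def)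
qed

subsection \<open>Parameters and the block variant\<close>

text \<open>Applied to \<open>\<Lambda>\<close>, this lets half of the exponent pay for the factor
  \<open>\<Lambda>\<close> brought in by \<open>L\<close>.\<close>

lemma nat_le_two_powr_half:
  assumes "n \<ge> 4"
  shows "real n \<le> 2 powr (real n / 2)"
proof -
  have "n ^ 2 \<le> 2 ^ n"
    using assms
  proof (induction n rule: nat_induct_at_least)
    case (Suc n)
    have "4 * n \<le> n * n" using Suc.hyps by simp
    moreover have "(Suc n) ^ 2 = n * n + 2 * n + 1" by (simp add: power2_eq_square)
    ultimately have "(Suc n) ^ 2 \<le> 2 * n ^ 2"
      using Suc.hyps unfolding power2_eq_square by linarith
    then show ?case using Suc.IH by simp
  qed simp
  then have "(real n)\<^sup>2 \<le> 2 ^ n"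
    by (metis of_nat_le_iff of_nat_numeral of_nat_power)
  also have "2 ^ n = (2 powr (real n / 2))\<^sup>2"
    by (simp add: powr_power powr_realpow)
  finally show ?thesis
    by (rule power2_le_imp_le) simp
qed

text \<open>
  The left-hand side is the total distance error relative to \<open>min 1 \<epsilon>\<close> and the true distance: \<open>d\<close> coordinates
  with an error of \<open>10 / (\<rho> * 2 ^ \<Lambda>)\<close> each, where \<open>\<rho> = min 1 \<delta> / (6 * d * L)\<close>, times \<open>2 ^ \<Lambda>\<close>.
\<close>

lemma Lambda_param_sufficient:
  fixes d :: nat and \<Phi> \<epsilon> \<delta> :: real
  assumes "d \<ge> 1" "\<Phi> \<ge> 1" "\<epsilon> > 0" "\<delta> > 0"
  defines "\<Lambda> \<equiv> Lambda_param 22 d \<Phi> \<epsilon> \<delta>"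
  shows "60 * real d ^ 2 * real (L_param \<Phi> \<Lambda>) / (min 1 \<epsilon> * min 1 \<delta>) \<le> 2 ^ \<Lambda>" and "\<Lambda> \<ge> 22"
proof -
  define g where "g = min 1 \<epsilon> * min 1 \<delta>"
  \<comment> \<open>The argument of the logarithm in \<open>Lambda_param\<close>. It is at least 1
    and dominates both \<open>d / g\<close> and \<open>log 2 \<Phi>\<close>, so powers of
    \<open>Y\<close> can bound everything but \<open>\<Lambda>\<close>.\<close>
  define Y where "Y = real d * max 1 (log 2 \<Phi>) / g"
  define M where "M = max 1 (log 2 Y)"
  have g: "0 < g" "g \<le> 1"
    using assms mult_le_one[of "min 1 \<epsilon>" "min 1 \<delta>"] by (auto simp: g_def)
  have \<Lambda>: "real \<Lambda> \<ge> 22 * M"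
    unfolding \<Lambda>_def Lambda_param_def M_def Y_def g_def by linarith
  then show "\<Lambda> \<ge> 22" unfolding M_def by linarith
  have "real d * 1 \<le> real d * max 1 (log 2 \<Phi>)" by (intro mult_left_mono) auto
  then have dg: "real d / g \<le> Y" using g by (simp add: Y_def divide_right_mono)
  have "1 / 1 \<le> real d / g" using g assms(1) by (intro frac_le) auto
  then have Y1: "1 \<le> Y" using dg by simp
  have "1 * max 1 (log 2 \<Phi>) / 1 \<le> Y"
    unfolding Y_def using g assms(1) by (intro frac_le mult_mono) auto
  then have "log 2 \<Phi> \<le> Y" by simp
  moreover have "0 \<le> log 2 \<Phi>" using assms(2) by simp
  ultimately have "real (L_param \<Phi> \<Lambda>) \<le> Y + 1 + real \<Lambda>"
    unfolding L_param_def by linarith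
  also have "\<dots> \<le> Y * \<Lambda> + Y * \<Lambda> + Y * \<Lambda>"
  proof -
    have "1 \<le> real \<Lambda>" using \<open>\<Lambda> \<ge> 22\<close> by simp
    then have "Y * 1 \<le> Y * \<Lambda>" "1 * 1 \<le> Y * \<Lambda>" "1 * real \<Lambda> \<le> Y * \<Lambda>"
      using Y1 by (intro mult_mono; simp)+
    then show ?thesis by simp
  qed
  finally have L: "real (L_param \<Phi> \<Lambda>) \<le> 3 * Y * \<Lambda>" by simp
  have "real d ^ 2 / g \<le> (real d / g) ^ 2"
  proof -
    have "g ^ 2 \<le> g" using g by (simp add: power2_eq_square mult_left_le)
    then have "real d ^ 2 / g \<le> real d ^ 2 / g ^ 2"
      using g by (intro frac_le) simp_all
    then show ?thesis by (simp add: power_divide)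
  qed
  also have "\<dots> \<le> Y ^ 2" using dg g by (intro power_mono) auto
  finally have "real d ^ 2 / g \<le> Y ^ 2" .
  then have "real d ^ 2 / g * real (L_param \<Phi> \<Lambda>) \<le> Y ^ 2 * (3 * Y * \<Lambda>)"
    using L by (intro mult_mono) auto
  then have "60 * real d ^ 2 * real (L_param \<Phi> \<Lambda>) / g \<le> 180 * Y ^ 3 * \<Lambda>"
    by (simp add: power2_eq_square power3_eq_cube)
  \<comment> \<open>Here 180 is 60 times the 3 in the bound on \<open>L\<close>. One half of the
    exponent pays for \<open>\<Lambda>\<close>, the other for \<open>180 * Y ^ 3\<close>, which is
    at most \<open>2 powr ((8 + 3) * M)\<close>; twice 11 is 22.\<close>
  also have "\<dots> \<le> 2 powr (real \<Lambda> / 2) * 2 powr (real \<Lambda> / 2)"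
  proof (intro mult_mono nat_le_two_powr_half)
    have "Y = 2 powr (log 2 Y)" using Y1 by simp
    also have "\<dots> \<le> 2 powr M" unfolding M_def by (intro powr_mono) auto
    finally have "Y ^ 3 \<le> (2 powr M) ^ 3" using Y1 by (intro power_mono) auto
    moreover have "(180::real) \<le> (2 powr 1) ^ 8" by simp
    moreover have "(2 powr 1 :: real) ^ 8 \<le> (2 powr M) ^ 8"
      unfolding M_def by (intro power_mono powr_mono) auto
    ultimately have "180 * Y ^ 3 \<le> (2 powr M) ^ 8 * (2 powr M) ^ 3"
      using Y1 by (intro mult_mono) auto
    also have "\<dots> = 2 powr (11 * M)"
      by (simp add: powr_power flip: powr_add)
    also have "\<dots> \<le> 2 powr (real \<Lambda> / 2)"
      using \<Lambda> by (intro powr_mono) auto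
    finally show "180 * Y ^ 3 \<le> 2 powr (real \<Lambda> / 2)" .
  qed (use \<open>\<Lambda> \<ge> 22\<close> in auto)
  also have "\<dots> = 2 ^ \<Lambda>" by (simp add: powr_realpow flip: powr_add)
  finally show "60 * real d ^ 2 * real (L_param \<Phi> \<Lambda>) / (min 1 \<epsilon> * min 1 \<delta>) \<le> 2 ^ \<Lambda>"
    by (simp add: g_def)
qed

locale block_instance =
  fixes d m n :: nat and X :: "real list list" and Bs :: "nat list list" and \<epsilon> \<delta> \<Phi> :: real and \<Lambda> L :: nat
  assumes d: "d \<ge> 1" and m: "m dvd d" and partition: "is_block_partition d m Bs"
    and n: "n \<ge> 2" and X: "length X = n" "\<And>x. x \<in> set X \<Longrightarrow> length x = d" "distinct X"
    and \<epsilon>: "\<epsilon> > 0" and \<delta>: "\<delta> > 0" and \<Phi>: "\<Phi> = aspect_ratio X"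
    and \<Lambda>: "\<Lambda> = Lambda_param 22 d \<Phi> \<epsilon> \<delta>" and L: "L = L_param \<Phi> \<Lambda>"
begin

lemma m_pos: "m \<ge> 1"
  using m d by (cases m) auto

lemma X_nonempty: "X \<noteq> []"
  using X(1) n by auto

lemma blocks: "length Bs = m" "distinct (concat Bs)" "set (concat Bs) = {..<d}"
  using partition by (auto simp: is_block_partition_def)

lemma block:
  assumes "t < m"
  shows "length (Bs ! t) = d div m" "distinct (Bs ! t)" "set (Bs ! t) \<subseteq> {..<d}"
proof -
  have mem: "Bs ! t \<in> set Bs" using assms blocks(1) by simp
  then show "length (Bs ! t) = d div m" using partition by (simp add: is_block_partition_def)
  show "distinct (Bs ! t)" using mem blocks(2) by (simp add: distinct_concat_iff)
  show "set (Bs ! t) \<subseteq> {..<d}" using mem blocks(3) by auto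
qed

lemma block_size: "m * (d div m) = d" "d div m \<ge> 1"
proof -
  show *: "m * (d div m) = d" using m by simp
  show "d div m \<ge> 1" using * d by (cases "d div m") auto
qed

lemma pair_dists_finite: "finite (pair_dists X)"
proof -
  have "pair_dists X \<subseteq> (\<lambda>(i, j). vdist (X ! i) (X ! j)) ` ({..<n} \<times> {..<n})"
    using X(1) by (force simp: pair_dists_def)
  then show ?thesis by (rule finite_subset) auto
qed

lemma vdist_in_pair_dists:
  assumes "i < n" "j < n" "i \<noteq> j"
  shows "vdist (X ! i) (X ! j) \<in> pair_dists X"
proof (cases "i < j")
  case True
  then show ?thesis using assms X(1) by (auto simp: pair_dists_def)
next
  case False
  then have "vdist (X ! j) (X ! i) \<in> pair_dists X" using assms X(1)
    by (simp add: pair_dists_def) (metis linorder_neqE_nat)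
  then show ?thesis using vdist_commute[of "X ! i" "X ! j"] assms X by simp
qed

lemma vdist_pos:
  assumes "i < n" "j < n" "i \<noteq> j"
  shows "0 < vdist (X ! i) (X ! j)"
proof -
  have "X ! i \<noteq> X ! j" using assms X by (simp add: nth_eq_iff_index_eq)
  moreover have "length (X ! i) = d" "length (X ! j) = d" using assms X by auto
  ultimately obtain k where "k < length (X ! i)" "X ! i ! k \<noteq> X ! j ! k"
    by (metis nth_equalityI)
  then show ?thesis using abs_nth_le_vdist[of k "X ! i" "X ! j"] by linarith
qed

abbreviation "dmin \<equiv> Min (pair_dists X)"
abbreviation "dmax \<equiv> Max (pair_dists X)"

lemma dmin_pos: "0 < dmin"
proof -
  have "pair_dists X \<noteq> {}" using vdist_in_pair_dists[of 0 1] n by auto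
  then have "dmin \<in> pair_dists X" using pair_dists_finite by simp
  then obtain i j where "i < j" "j < n" "dmin = vdist (X ! i) (X ! j)"
    using X(1) by (auto simp: pair_dists_def)
  then show ?thesis using vdist_pos[of i j] by simp
qed

lemma dmin_le: "i < n \<Longrightarrow> j < n \<Longrightarrow> i \<noteq> j \<Longrightarrow> dmin \<le> vdist (X ! i) (X ! j)"
  using vdist_in_pair_dists pair_dists_finite by simp

lemma le_dmax:
  assumes "i < n" "j < n"
  shows "vdist (X ! i) (X ! j) \<le> dmax"
proof (cases "i = j")
  case True
  have "0 < vdist (X ! 0) (X ! 1)" using vdist_pos[of 0 1] n by simp
  also have "\<dots> \<le> dmax" using vdist_in_pair_dists[of 0 1] n pair_dists_finite by simp
  finally show ?thesis using True by (simp add: vdist_def L2_set_def)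
qed (use assms vdist_in_pair_dists pair_dists_finite in simp)

lemma \<Phi>_ge_1: "1 \<le> \<Phi>"
proof -
  have "dmin \<le> dmax" using dmin_le[of 0 1] le_dmax[of 0 1] n by simp
  then show ?thesis using dmin_pos by (simp add: \<Phi> aspect_ratio_def)
qed

lemma \<Lambda>_ge: "\<Lambda> \<ge> 22"
  unfolding \<Lambda> by (rule Lambda_param_sufficient(2)[OF d \<Phi>_ge_1 \<epsilon> \<delta>])

lemma \<Lambda>_sufficient: "60 * real d ^ 2 * real L / (min 1 \<epsilon> * min 1 \<delta>) \<le> 2 ^ \<Lambda>"
  unfolding L \<Lambda> by (rule Lambda_param_sufficient(1)[OF d \<Phi>_ge_1 \<epsilon> \<delta>])

lemma L_ge: "\<Lambda> \<le> L" "L \<ge> 1"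
  using \<Lambda>_ge by (auto simp: L L_param_def)

text \<open>A by-product of the accuracy requirement, whose left-hand side is at least
  \<open>L\<close>. It makes \<open>long_width L\<close> at most
  \<open>\<Lambda> + 1\<close>.\<close>

lemma L_le: "L < 2 ^ (\<Lambda> + 1)"
proof -
  have "1 * 1 * real L / 1 \<le> 60 * real d ^ 2 * real L / (min 1 \<epsilon> * min 1 \<delta>)"
    using d \<epsilon> \<delta> mult_le_one[of "min 1 \<epsilon>" "min 1 \<delta>"] by (intro frac_le mult_mono) auto
  also have "\<dots> \<le> 2 ^ \<Lambda>" by (rule \<Lambda>_sufficient)
  finally have "real L \<le> real (2 ^ \<Lambda>)" by simp
  then have "L \<le> 2 ^ \<Lambda>" by (simp only: of_nat_le_iff)
  then show ?thesis by (simp add: le_less_trans)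
qed

text \<open>What the choice of \<open>L\<close> achieves: the levels beyond \<open>\<Lambda>\<close>
  bridge the aspect ratio of the whole pointset.\<close>

lemma two_power_L: "dmax / 2 ^ L \<le> dmin / 2 ^ \<Lambda>"
proof -
  have "\<Phi> = 2 powr (log 2 \<Phi>)" using \<Phi>_ge_1 by simp
  also have "\<dots> \<le> 2 powr (real (nat \<lceil>log 2 \<Phi>\<rceil>))" by (intro powr_mono) linarith+
  finally have "\<Phi> * 2 ^ \<Lambda> \<le> 2 ^ L"
    by (simp add: L L_param_def power_add powr_realpow)
  then have "dmax * 2 ^ \<Lambda> \<le> dmin * 2 ^ L"
    using dmin_pos by (simp add: \<Phi> aspect_ratio_def field_simps)
  then show ?thesis by (simp add: field_simps)
qed

section \<open>Accuracy at the fixed point\<close>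

lemma project_nonempty [simp]: "project B X \<noteq> []"
  using X_nonempty by (simp add: project_def)

abbreviation "I \<equiv> SIGMA t:{..<length Bs}. {..<length (Bs ! t)}"

abbreviation "side t \<equiv> Delta (project (Bs ! t) X)"

lemma card_I: "finite I" "card I = d"
proof -
  show "finite I" by auto
  have "card I = (\<Sum>t<m. length (Bs ! t))" by (simp add: blocks(1))
  also have "\<dots> = (\<Sum>t<m. d div m)" using block(1) by simp
  finally show "card I = d" using block_size by simp
qed

lemma nth_project: "i < n \<Longrightarrow> project B X ! i = map ((!) (X ! i)) B"
  using X(1) by (simp add: project_def)

lemma hd_project: "hd (project B X) = map ((!) (X ! 0)) B"
  using X_nonempty by (simp add: project_def hd_map hd_conv_nth)

lemma radius_le:
  assumes "t < m"
  shows "radius (project (Bs ! t) X) \<le> dmax"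
proof -
  have "vdist (map ((!) (X ! 0)) (Bs ! t)) (map ((!) x) (Bs ! t)) \<le> dmax" if x: "x \<in> set X" for x
  proof -
    obtain i where i: "i < n" "x = X ! i" using x X(1) unfolding in_set_conv_nth by blast
    have "length (X ! 0) = d" using X n by auto
    then have "vdist (map ((!) (X ! 0)) (Bs ! t)) (map ((!) x) (Bs ! t)) \<le> vdist (X ! 0) x"
      using block[OF assms] by (intro vdist_project_le) auto
    then show ?thesis using le_dmax[of 0 i] i n by simp
  qed
  then show ?thesis
    unfolding radius_def hd_project using X_nonempty by (auto simp: project_def)
qed

text \<open>Chosen so that the union bound over \<open>d\<close> coordinates and \<open>L\<close>
  levels, each with probability at most \<open>6 * margin\<close>, gives
  \<open>min 1 \<delta>\<close>.\<close>

definition margin :: real where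
  "margin = min 1 \<delta> / (6 * real d * real L)"

lemma margin: "0 < margin" "margin \<le> 1 / 2"
proof -
  have dL: "1 * 1 \<le> real d * real L" using d L_ge(2) by (intro mult_mono) auto
  show "0 < margin" using \<delta> d L_ge(2) by (simp add: margin_def)
  have "min 1 \<delta> / (6 * real d * real L) \<le> 1 / 2"
    by (intro frac_le) (insert dL, linarith+)
  then show "margin \<le> 1 / 2" by (simp add: margin_def)
qed

text \<open>Position relative to the corner of the unshifted root cube; subtracting the shift gives
  \<open>rel_coords\<close>.\<close>

definition offset :: "nat \<Rightarrow> nat \<times> nat \<Rightarrow> real" where
  "offset i = (\<lambda>(t, k). project (Bs ! t) X ! i ! k - hd (project (Bs ! t) X) ! k + 2 * side t)"

definition bad :: "nat \<Rightarrow> nat \<times> nat \<Rightarrow> real set" where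
  "bad i = (\<lambda>(t, k). bad_shifts L margin (side t) (offset i (t, k)))"

abbreviation "approx \<sigma> \<equiv> decompress L n Bs (val (block_quadsketch L \<Lambda> Bs X \<sigma>))"

lemma approx_coords:
  "i < n \<Longrightarrow> approx \<sigma> i =
    concat (map (\<lambda>t. approx_point (root_level (project (Bs ! t) X)) (length (Bs ! t)) L \<Lambda>
      (block_labels L Bs X \<sigma> t) i) [0..<m])"
  using decompress_block_quadsketch[OF X_nonempty, of i L Bs \<Lambda> \<sigma>] X(1) blocks(1) by simp

text \<open>All randomness is confined to the first hypothesis, which concerns \<open>i\<close>
  alone; \<open>j\<close> may be chosen afterwards.\<close>

lemma approx_distance:
  assumes good: "\<And>x. x \<in> I \<Longrightarrow> \<sigma> x \<notin> bad i x" and i: "i < n" and j: "j < n"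
  shows "\<bar>vdist (approx \<sigma> i) (approx \<sigma> j) - vdist (X ! i) (X ! j)\<bar> \<le> min 1 \<epsilon> * vdist (X ! i) (X ! j)"
proof (cases "i = j")
  case True
  then show ?thesis by (simp add: vdist_def L2_set_def)
next
  case False
  define D where "D = vdist (X ! i) (X ! j)"
  define u where "u i t = approx_point (root_level (project (Bs ! t) X)) (length (Bs ! t)) L \<Lambda>
      (block_labels L Bs X \<sigma> t) i" for i t
  \<comment> \<open>Error per coordinate: 2 parts from pruning and 8 parts from the leaf
    cells.\<close>
  define e where "e = 10 * D / (margin * 2 ^ \<Lambda>)"
  have D: "dmin \<le> D" "0 < D" using dmin_le vdist_pos i j False by (auto simp: D_def)
  have lenX: "length (X ! i) = d" "length (X ! j) = d" using X i j by auto
  have len_u: "length (u i' t) = length (Bs ! t)" if "i' < n" for i' t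
    unfolding u_def
    by (rule length_approx_point[OF length_point_label[of _ L "project (Bs ! t) X", unfolded length_hd_project[OF X_nonempty]]])
      (use that X X_nonempty in \<open>auto simp: point_labels_def project_def\<close>)
  have err: "\<bar>(u i t ! k - u j t ! k) - (X ! i ! (Bs ! t ! k) - X ! j ! (Bs ! t ! k))\<bar> \<le> e"
    if t: "t < m" and k: "k < length (Bs ! t)" for t k
  proof -
    let ?ys = "project (Bs ! t) X"
    have hd: "length (hd ?ys) = length (Bs ! t)" by (rule length_hd_project[OF X_nonempty])
    have good_t: "\<sigma> (t, k) \<notin> bad_shifts L margin (side t) (offset i (t, k))" if "k < length (Bs ! t)" for k
      using good[of "(t, k)"] that t blocks(1) by (simp add: bad_def)
    have proj: "?ys ! i' ! k = X ! i' ! (Bs ! t ! k)" if "i' < n" "k < length (Bs ! t)" for i' k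
      using nth_project[OF that(1)] that(2) by simp
    have "\<bar>(u i t ! k - u j t ! k) - (?ys ! i ! k - ?ys ! j ! k)\<bar>
        \<le> 2 * D / (margin * 2 ^ \<Lambda>) + 8 * radius ?ys / 2 ^ L"
      unfolding u_def hd[symmetric]
    proof (rule block_error)
      show "padded (length (hd ?ys)) L margin (4 * side t) (rel_coords ?ys (\<lambda>k. \<sigma> (t, k)) (?ys ! i))"
        unfolding padded_def
      proof (intro allI impI)
        fix k p :: nat and a :: int
        assume "k < length (hd ?ys)" "p < L"
        then have "\<not> \<bar>offset i (t, k) - \<sigma> (t, k) - a * (4 * side t / 2 ^ (p + 1))\<bar>
            < margin * (4 * side t / 2 ^ (p + 1))"
        proof -
          have "\<sigma> (t, k) \<notin> near_grid (offset i (t, k)) (margin * (4 * side t / 2 ^ (p + 1))) (4 * side t / 2 ^ (p + 1))"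
            using good_t[of k] \<open>k < length (hd ?ys)\<close> \<open>p < L\<close> hd by (auto simp: bad_shifts_def)
          then show ?thesis unfolding near_grid_def mem_Collect_eq by blast
        qed
        moreover have "rel_coords ?ys (\<lambda>k. \<sigma> (t, k)) (?ys ! i) ! k = offset i (t, k) - \<sigma> (t, k)"
          using \<open>k < length (hd ?ys)\<close> by (simp add: nth_rel_coords offset_def)
        ultimately show "margin * (4 * side t / 2 ^ (p + 1))
            \<le> \<bar>rel_coords ?ys (\<lambda>k. \<sigma> (t, k)) (?ys ! i) ! k - a * (4 * side t / 2 ^ (p + 1))\<bar>"
          by (simp only: not_less)
      qed
      show "\<sigma> (t, k) \<in> {- side t..side t}" if "k < length (hd ?ys)" for k
        using good_t[of k] that hd by (auto simp: bad_shifts_def)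
      show "\<bar>?ys ! i ! k - ?ys ! j ! k\<bar> \<le> D" if "k < length (hd ?ys)" for k
      proof -
        have "Bs ! t ! k \<in> set (Bs ! t)" using that hd by simp
        then have "Bs ! t ! k < length (X ! i)" using block(3)[OF t] lenX(1) by auto
        then show ?thesis
          using abs_nth_le_vdist[of "Bs ! t ! k" "X ! i" "X ! j"] proj that hd i j by (simp add: D_def)
      qed
    qed (use i j X margin k hd in auto)
    also have "\<dots> \<le> 2 * D / (margin * 2 ^ \<Lambda>) + 8 * (D / (margin * 2 ^ \<Lambda>))"
    proof -
      have "radius ?ys / 2 ^ L \<le> dmax / 2 ^ L" using radius_le[OF t] by (simp add: divide_right_mono)
      also have "\<dots> \<le> dmin / 2 ^ \<Lambda>" by (rule two_power_L)
      \<comment> \<open>Enlarged by the factor \<open>1 / margin\<close> to bring it to the form of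
        the pruning error.\<close>
      also have "\<dots> \<le> D / (margin * 2 ^ \<Lambda>)"
        using D margin by (intro frac_le) auto
      finally show ?thesis by simp
    qed
    also have "\<dots> = e" by (simp add: e_def)
    finally show ?thesis using proj i j k by simp
  qed
  \<comment> \<open>The points with coordinates reordered block by block; \<open>concat Bs\<close>
    is a permutation of the coordinates, so distances stay the same.\<close>
  define x where "x i = concat (map (\<lambda>t. map ((!) (X ! i)) (Bs ! t)) [0..<m])" for i
  have x: "x i = map ((!) (X ! i)) (concat Bs)" for i
  proof -
    have "map ((!) Bs) [0..<m] = Bs" using map_nth[of Bs] blocks(1) by simp
    then have "map (\<lambda>t. map ((!) (X ! i)) (Bs ! t)) [0..<m] = map (map ((!) (X ! i))) Bs"
      by (metis (no_types) list.map_comp comp_def map_eq_conv)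
    then show ?thesis by (simp add: x_def map_concat)
  qed
  have len_x: "length (x i) = d"
    using distinct_card[OF blocks(2)] blocks(3) by (simp add: x del: set_concat)
  have approx: "approx \<sigma> i' = concat (map (u i') [0..<m])" if "i' < n" for i'
    unfolding approx_coords[OF that] u_def[abs_def] ..
  have "\<bar>vdist (approx \<sigma> i) (approx \<sigma> j) - vdist (x i) (x j)\<bar> \<le> length (x i) * e"
  proof (rule vdist_perturb)
    show "length (approx \<sigma> i) = length (x i)"
      unfolding approx[OF i] x_def by (simp add: length_concat o_def len_u[OF i])
    show "\<bar>(approx \<sigma> i ! k - approx \<sigma> j ! k) - (x i ! k - x j ! k)\<bar> \<le> e" if "k < length (x i)" for k
      unfolding approx[OF i] approx[OF j] x_def
      by (rule concat_map_nth_property[where R = "\<lambda>a b c f. \<bar>(a - b) - (c - f)\<bar> \<le> e"])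
        (use err len_u i j that in \<open>auto simp: x_def\<close>)
  qed
  moreover have "vdist (x i) (x j) = D"
    unfolding x vdist_map_nth[OF blocks(2)] blocks(3) D_def by (simp add: vdist_def lenX)
  moreover have "d * e \<le> min 1 \<epsilon> * D"
  proof -
    \<comment> \<open>Unfolding \<open>margin\<close> produces the left-hand side of the parameter
      inequality; its 60 is the 10 of \<open>e\<close> times the 6 of \<open>margin\<close>.\<close>
    have "d * e = (60 * real d ^ 2 * real L / (min 1 \<epsilon> * min 1 \<delta>)) * (min 1 \<epsilon> * D) / 2 ^ \<Lambda>"
    proof -
      have "min 1 \<epsilon> \<noteq> 0" "min 1 \<delta> \<noteq> 0" using \<epsilon> \<delta> by auto
      then show ?thesis
        using d L_ge(2) by (simp add: e_def margin_def field_simps power2_eq_square)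
    qed
    also have "\<dots> \<le> 2 ^ \<Lambda> * (min 1 \<epsilon> * D) / 2 ^ \<Lambda>"
      using \<Lambda>_sufficient D \<epsilon> by (intro divide_right_mono mult_right_mono) auto
    finally show ?thesis by simp
  qed
  ultimately show ?thesis
    using len_x by (simp add: D_def)
qed

definition preserved :: "nat \<Rightarrow> (nat \<Rightarrow> real list) \<Rightarrow> bool" where
  "preserved i x' \<longleftrightarrow> (\<forall>j<n. (1 - \<epsilon>) * vdist (X ! i) (X ! j) \<le> vdist (x' i) (x' j) \<and>
     vdist (x' i) (x' j) \<le> (1 + \<epsilon>) * vdist (X ! i) (X ! j))"

lemma shift_prob_space: "prob_space (case x of (t, k) \<Rightarrow> let D = side t in uniform_measure lborel {-D..D})"
  by (cases x) (simp add: Let_def prob_space_uniform_interval Delta_pos)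

text \<open>
  The sketch depends on the shifts only through the labels of the cells, which take countably many values.
\<close>

lemma preserved_measurable:
  assumes "i < n"
  shows "{\<sigma> \<in> space (shift_measure Bs X). preserved i (approx \<sigma>)} \<in> sets (shift_measure Bs X)"
proof -
  define labels where "labels \<sigma> = map (\<lambda>t. block_labels L Bs X \<sigma> t) [0..<m]" for \<sigma>
  define decode where "decode c i = concat (map (\<lambda>t. approx_point (root_level (project (Bs ! t) X))
      (length (Bs ! t)) L \<Lambda> (c ! t) i) [0..<m])" for c i
  have decode: "approx \<sigma> i = decode (labels \<sigma>) i" if "i < n" for \<sigma> i
    unfolding approx_coords[OF that] decode_def labels_def
    by (intro arg_cong[of _ _ concat] map_cong) auto
  have preserved: "preserved i (approx \<sigma>) \<longleftrightarrow> preserved i (decode (labels \<sigma>))" for \<sigma>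
    using decode assms by (simp add: preserved_def)
  have component: "(\<lambda>\<sigma>. \<sigma> (t, k)) \<in> borel_measurable (shift_measure Bs X)"
    if "t < m" "k < length (Bs ! t)" for t k
  proof -
    have "(\<lambda>\<sigma>. \<sigma> (t, k)) \<in> shift_measure Bs X \<rightarrow>\<^sub>M
        (case (t, k) of (t, k) \<Rightarrow> let D = side t in uniform_measure lborel {-D..D})"
      unfolding shift_measure_def by (rule measurable_component_singleton) (use that blocks(1) in auto)
    then show ?thesis by (simp add: Let_def cong: measurable_cong_sets)
  qed
  have "labels \<in> shift_measure Bs X \<rightarrow>\<^sub>M count_space UNIV"
    unfolding labels_def point_labels_def
  proof (intro measurable_map_countable)
    fix t y assume t: "t \<in> set [0..<m]"
    show "(\<lambda>\<sigma>. val (cell_labels L (4 * side t) (rel_coords (project (Bs ! t) X) (\<lambda>k. \<sigma> (t, k)) y)))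
        \<in> shift_measure Bs X \<rightarrow>\<^sub>M count_space UNIV"
      unfolding rel_coords_def
    proof (rule measurable_cell_labels)
      fix k assume "k \<in> set [0..<length (hd (project (Bs ! t) X))]"
      then have [measurable]: "(\<lambda>\<sigma>. \<sigma> (t, k)) \<in> borel_measurable (shift_measure Bs X)"
        using t length_hd_project[OF X_nonempty] by (intro component) auto
      show "(\<lambda>\<sigma>. y ! k - (hd (project (Bs ! t) X) ! k + \<sigma> (t, k) - 2 * side t))
          \<in> borel_measurable (shift_measure Bs X)"
        by measurable
    qed
  qed
  from measurable_sets[OF this, of "{c. preserved i (decode c)}"]
  show ?thesis
    by (simp add: preserved vimage_def Int_def conj_commute)
qed

text \<open>The shifts of all blocks are treated in a single union bound, so failure has probability
  at most \<open>min 1 \<delta>\<close>, which is at most \<open>m * \<delta>\<close>.\<close>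

lemma preserved_probability:
  assumes "i < n"
  shows "1 - real m * \<delta> \<le> measure (shift_measure Bs X) {\<sigma> \<in> space (shift_measure Bs X). preserved i (approx \<sigma>)}"
proof -
  have "1 - real m * \<delta> \<le> 1 - real (card I) * (real L * (6 * margin))"
  proof -
    have "real (card I) * (real L * (6 * margin)) = min 1 \<delta>"
      using d L_ge(2) by (simp add: card_I(2) margin_def)
    also have "\<dots> \<le> 1 * \<delta>" by simp
    also have "\<dots> \<le> real m * \<delta>" using m_pos \<delta> by (intro mult_right_mono) auto
    finally show ?thesis by simp
  qed
  also have "\<dots> \<le> measure (shift_measure Bs X) {\<sigma> \<in> space (shift_measure Bs X). preserved i (approx \<sigma>)}"
    unfolding shift_measure_def
  proof (rule measure_PiM_avoid_ge[OF shift_prob_space card_I(1)])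
    fix x assume "x \<in> I"
    obtain t k where x: "x = (t, k)" by (cases x)
    show "bad i x \<in> sets (case x of (t, k) \<Rightarrow> let D = side t in uniform_measure lborel {-D..D})"
      by (simp add: x bad_def Let_def)
    show "measure (case x of (t, k) \<Rightarrow> let D = side t in uniform_measure lborel {-D..D}) (bad i x)
        \<le> real L * (6 * margin)"
      unfolding x bad_def prod.case Let_def using margin by (intro measure_bad_shifts Delta_pos) auto
  next
    fix \<sigma>
    assume \<sigma>: "\<sigma> \<in> space (PiM I (\<lambda>(t, k). let D = side t in uniform_measure lborel {-D..D}))"
      and good: "\<And>x. x \<in> I \<Longrightarrow> \<sigma> x \<notin> bad i x"
    have "(1 - \<epsilon>) * vdist (X ! i) (X ! j) \<le> vdist (approx \<sigma> i) (approx \<sigma> j) \<and>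
        vdist (approx \<sigma> i) (approx \<sigma> j) \<le> (1 + \<epsilon>) * vdist (X ! i) (X ! j)" if "j < n" for j
    proof -
      have "min 1 \<epsilon> * vdist (X ! i) (X ! j) \<le> \<epsilon> * vdist (X ! i) (X ! j)"
        by (intro mult_right_mono vdist_nonneg) simp
      then show ?thesis
        using approx_distance[OF good assms that] by (simp add: algebra_simps abs_le_iff)
    qed
    then show "\<sigma> \<in> {\<sigma> \<in> space (PiM I (\<lambda>(t, k). let D = side t in uniform_measure lborel {-D..D})).
        preserved i (approx \<sigma>)}"
      using \<sigma> by (simp add: preserved_def)
  qed (use preserved_measurable[OF assms] in \<open>simp add: shift_measure_def\<close>)
  finally show ?thesis .
qed

section \<open>Size and running time\<close>

lemma index_width_le: "real (index_width n) \<le> 2 * log 2 (real n)"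
proof -
  have "index_width n = nat \<lfloor>log 2 (real (n - 1))\<rfloor> + 1"
    using n by (simp add: floorlog_def)
  moreover have "0 \<le> log 2 (real (n - 1))" using n by simp
  moreover have "log 2 (real (n - 1)) \<le> log 2 (real n)" using n by simp
  \<comment> \<open>\<open>floorlog\<close> exceeds the integer part of the logarithm by 1, which is
    absorbed because n is at least 2.\<close>
  moreover have "1 \<le> log 2 (real n)" using n by (simp add: le_log_iff)
  ultimately show ?thesis by linarith
qed

lemma block_bits:
  assumes "t < m"
  shows "real (length (snd (val (block_sketch L \<Lambda> Bs X \<sigma> t))))
    \<le> 27 * real (n * (d div m) * \<Lambda>) + 2 * (real n * log 2 (real n))"
proof -
  define b where "b = d div m"
  define w where "w = long_width L"
  have pos: "b \<ge> 1" "\<Lambda> \<ge> 1" "n \<ge> 1" using block_size(2) \<Lambda>_ge n by (auto simp: b_def)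
  have "w \<le> \<Lambda> + 1" unfolding w_def using L_le by (intro floorlog_leI) auto
  have "length (snd (val (block_sketch L \<Lambda> Bs X \<sigma> t)))
      \<le> 2 * path_bits b w \<Lambda> * n + 1 + n * index_width n"
    using length_quadsketch[of "project (Bs ! t) X" L \<Lambda> "\<lambda>k. \<sigma> (t, k)"] X_nonempty X(1) block(1)[OF assms]
    by (simp add: length_hd_project b_def w_def)
  moreover have "2 * path_bits b w \<Lambda> * n + 1 \<le> 27 * (n * b * \<Lambda>)"
  proof -
    have 1: "1 * \<Lambda> \<le> b * \<Lambda>" "1 * 1 \<le> b * \<Lambda>" "b * 1 \<le> b * \<Lambda>"
      using pos by (intro mult_mono; simp)+
    \<comment> \<open>With \<open>w \<le> \<Lambda> + 1\<close> the coefficients 1, 4, 1 and 7 add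
      up to 13. Doubled, and with the closing bit of the root, they give 27.\<close>
    then have "path_bits b w \<Lambda> \<le> 13 * (b * \<Lambda>)"
    proof -
      have "path_bits b w \<Lambda> = b * \<Lambda> + 3 * \<Lambda> + b + 6 + w"
        by (simp add: path_bits_def algebra_simps)
      then show ?thesis using 1 \<open>w \<le> \<Lambda> + 1\<close> by linarith
    qed
    then have "path_bits b w \<Lambda> * n \<le> 13 * (b * \<Lambda>) * n" by (rule mult_right_mono) simp
    moreover have "1 * 1 \<le> n * (b * \<Lambda>)" using pos 1 by (intro mult_mono) auto
    moreover have "13 * (b * \<Lambda>) * n = 13 * (n * b * \<Lambda>)" "n * (b * \<Lambda>) = n * b * \<Lambda>"
      "2 * path_bits b w \<Lambda> * n = 2 * (path_bits b w \<Lambda> * n)" by simp_all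
    ultimately show ?thesis by linarith
  qed
  ultimately have "length (snd (val (block_sketch L \<Lambda> Bs X \<sigma> t))) \<le> 27 * (n * b * \<Lambda>) + n * index_width n"
    by linarith
  then have "real (length (snd (val (block_sketch L \<Lambda> Bs X \<sigma> t)))) \<le> real (27 * (n * b * \<Lambda>) + n * index_width n)"
    by (simp only: of_nat_le_iff)
  also have "\<dots> \<le> 27 * real (n * b * \<Lambda>) + real n * (2 * log 2 (real n))"
    using mult_left_mono[OF index_width_le, of "real n"] by simp
  finally show ?thesis by (simp add: b_def)
qed

abbreviation "bits \<sigma> \<equiv> sketch_bits (val (block_quadsketch L \<Lambda> Bs X \<sigma>))"

lemma bits_eq: "bits \<sigma> = (\<Sum>t<m. length (snd (val (block_sketch L \<Lambda> Bs X \<sigma> t))))"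
  by (simp add: sketch_bits_def val_block_quadsketch length_concat o_def blocks(1) sum_list_sum_nth atLeast0LessThan)

text \<open>The path budgets of the blocks add up to \<open>d\<close>, whereas leaf indices are
  stored anew in each block, hence the factor \<open>m\<close> in the second term.\<close>

lemma size_bound: "real (bits \<sigma>) \<le> 27 * (real (n * d * \<Lambda>) + real (n * m) * log 2 (real n))"
proof -
  have "real (bits \<sigma>) \<le> (\<Sum>t<m. 27 * real (n * (d div m) * \<Lambda>) + 2 * (real n * log 2 (real n)))"
    unfolding bits_eq of_nat_sum using block_bits by (intro sum_mono) auto
  also have "\<dots> = 27 * real (n * (m * (d div m)) * \<Lambda>) + 2 * (real (n * m) * log 2 (real n))"
    by (simp add: algebra_simps)
  also have "\<dots> = 27 * real (n * d * \<Lambda>) + 2 * (real (n * m) * log 2 (real n))"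
    by (simp only: block_size)
  also have "\<dots> \<le> 27 * (real (n * d * \<Lambda>) + real (n * m) * log 2 (real n))"
    using n by simp
  finally show ?thesis .
qed

text \<open>The single logarithm comes from the leaf indices in the output; all other work is linear
  in \<open>n * d * L\<close>. The exponent is written out to match the witness for
  \<open>q\<close>.\<close>

lemma time_bound:
  "real (time (block_quadsketch L \<Lambda> Bs X \<sigma>)) \<le> 300 * real (n * d * L) * (log 2 (real (n * d * L))) ^ 1"
proof -
  define b where "b = d div m"
  define V where "V = n * d * L"
  let ?bits = "\<lambda>t. length (snd (val (block_sketch L \<Lambda> Bs X \<sigma> t)))"
  have pos: "b \<ge> 1" "L \<ge> 1" "n \<ge> 1" "m \<ge> 1" using block_size(2) L_ge n m_pos by (auto simp: b_def)
  have mb: "m * (n * b * L) = V" using block_size(1) by (simp add: V_def b_def mult_ac)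
  have one: "1 \<le> n * b * L" using pos by (simp add: Suc_le_eq)
  have "time (block_quadsketch L \<Lambda> Bs X \<sigma>)
      = (\<Sum>t<m. n * (length (Bs ! t) + 1) + time (block_sketch L \<Lambda> Bs X \<sigma> t)) + m + 1 + (\<Sum>t<m. 1 + ?bits t) + 1"
    by (simp only: time_block_quadsketch blocks(1) X(1)) (simp add: sum_list_sum_nth atLeast0LessThan)
  also have "\<dots> \<le> (\<Sum>t<m. 102 * (n * b * L) + 2 * ?bits t) + m + 1 + (\<Sum>t<m. 1 + ?bits t) + 1"
  proof -
    have "n * (length (Bs ! t) + 1) + time (block_sketch L \<Lambda> Bs X \<sigma> t) \<le> 102 * (n * b * L) + 2 * ?bits t"
      if "t < m" for t
    proof -
      have "time (block_sketch L \<Lambda> Bs X \<sigma> t) \<le> 100 * (n * b * L) + 2 * ?bits t"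
        using time_quadsketch[of "project (Bs ! t) X" L \<Lambda> "\<lambda>k. \<sigma> (t, k)"] X_nonempty X(1) block(1)[OF that] pos
        by (simp add: length_hd_project b_def)
      moreover have "n * (b + 1) \<le> 2 * (n * b * L)"
      proof -
        have "n * b * 1 \<le> n * b * L" "n * 1 * 1 \<le> n * b * L" using pos by (intro mult_mono; simp)+
        then show ?thesis by (simp only: distrib_left mult_1_right)
      qed
      ultimately show ?thesis using block(1)[OF that] by (simp add: b_def)
    qed
    then show ?thesis by (intro add_right_mono sum_mono) (simp only: lessThan_iff)
  qed
  also have "\<dots> = 102 * (m * (n * b * L)) + 2 * m + 2 + 3 * bits \<sigma>"
    unfolding bits_eq sum.distrib sum_distrib_left[symmetric] by simp
  \<comment> \<open>Both \<open>m\<close> and 1 are at most \<open>V\<close>, so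
    \<open>2 * m + 2\<close> adds 4 to the coefficient.\<close>
  also have "\<dots> \<le> 106 * V + 3 * bits \<sigma>"
  proof -
    have "m * 1 \<le> m * (n * b * L)" "1 * 1 \<le> m * (n * b * L)" using one pos by (intro mult_mono; simp)+
    then show ?thesis unfolding mb by simp
  qed
  finally have "real (time (block_quadsketch L \<Lambda> Bs X \<sigma>)) \<le> real (106 * V + 3 * bits \<sigma>)"
    by (simp only: of_nat_le_iff)
  \<comment> \<open>The coefficient 81 is 3 times the 27 of the size bound.\<close>
  also have "\<dots> \<le> 106 * real V + 81 * (real (n * d * \<Lambda>) + real (n * m) * log 2 (real n))"
    using size_bound[of \<sigma>] by simp
  also have "\<dots> \<le> 106 * (real V * log 2 (real V)) + 81 * (real V * log 2 (real V) + real V * log 2 (real V))"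
  proof -
    have "m \<le> d" using m d by (intro dvd_imp_le) auto
    have nV: "n * 1 * 1 \<le> V" unfolding V_def using d pos by (intro mult_mono) auto
    have log1: "1 \<le> log 2 (real n)" using n by (simp add: le_log_iff)
    have logV: "log 2 (real n) \<le> log 2 (real V)" using nV n by simp
    have "real V * 1 \<le> real V * log 2 (real V)" using log1 logV by (intro mult_left_mono) auto
    moreover have "real (n * d * \<Lambda>) \<le> real V"
      unfolding V_def using L_ge(1) by (simp add: mult_left_mono)
    moreover have "real (n * m) * log 2 (real n) \<le> real V * log 2 (real V)"
    proof (rule mult_mono)
      have "n * m * 1 \<le> n * d * L" using \<open>m \<le> d\<close> pos by (intro mult_mono) auto
      then show "real (n * m) \<le> real V" unfolding V_def by (simp only: of_nat_le_iff mult_1_right)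
    qed (use logV log1 in auto)
    ultimately show ?thesis by simp
  qed
  also have "\<dots> \<le> 300 * real V * (log 2 (real V)) ^ 1"
  proof -
    have "1 \<le> V" using mb one pos by (cases V) auto
    then have "0 \<le> real V * log 2 (real V)" by simp
    then show ?thesis by simp
  qed
  finally show ?thesis by (simp only: V_def)
qed

end

theorem theorem3:
  shows "\<exists>(C::real) > 0. \<exists>(K\<^sub>T::real) > 0. \<exists>q::nat. \<exists>(K\<^sub>S::real) > 0.
    \<forall>(d::nat) (m::nat) (n::nat) (X::real list list) (Bs::nat list list) (\<epsilon>::real) (\<delta>::real)
      (\<Phi>::real) (\<Lambda>::nat) (L::nat).
      d \<ge> 1 \<and> m dvd d \<and> is_block_partition d m Bs \<and>
      n \<ge> 2 \<and> length X = n \<and> (\<forall>x\<in>set X. length x = d) \<and> distinct X \<and>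
      \<epsilon> > 0 \<and> \<delta> > 0 \<and>
      \<Phi> = aspect_ratio X \<and> \<Lambda> = Lambda_param C d \<Phi> \<epsilon> \<delta> \<and> L = L_param \<Phi> \<Lambda>
      \<longrightarrow>
      (\<forall>\<sigma> \<in> space (shift_measure Bs X).
         real (time (block_quadsketch L \<Lambda> Bs X \<sigma>))
           \<le> K\<^sub>T * real (n * d * L) * (log 2 (real (n * d * L))) ^ q \<and>
         real (sketch_bits (val (block_quadsketch L \<Lambda> Bs X \<sigma>)))
           \<le> K\<^sub>S * (real (n * d * \<Lambda>) + real (n * m) * log 2 (real n))) \<and>
      (\<forall>i<n.
         measure (shift_measure Bs X)
           {\<sigma> \<in> space (shift_measure Bs X).
              let x' = decompress L n Bs (val (block_quadsketch L \<Lambda> Bs X \<sigma>)) in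
              \<forall>j<n. (1 - \<epsilon>) * vdist (X ! i) (X ! j) \<le> vdist (x' i) (x' j) \<and>
                    vdist (x' i) (x' j) \<le> (1 + \<epsilon>) * vdist (X ! i) (X ! j)}
         \<ge> 1 - real m * \<delta>)"
proof (rule exI[of _ "22::real"], rule conjI, simp, rule exI[of _ "300::real"], rule conjI, simp,
    rule exI[of _ "1::nat"], rule exI[of _ "27::real"], rule conjI, simp, intro allI impI)
  fix d m n :: nat and X Bs and \<epsilon> \<delta> \<Phi> :: real and \<Lambda> L :: nat
  assume "d \<ge> 1 \<and> m dvd d \<and> is_block_partition d m Bs \<and>
      n \<ge> 2 \<and> length X = n \<and> (\<forall>x\<in>set X. length x = d) \<and> distinct X \<and>
      \<epsilon> > 0 \<and> \<delta> > 0 \<and>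
      \<Phi> = aspect_ratio X \<and> \<Lambda> = Lambda_param 22 d \<Phi> \<epsilon> \<delta> \<and> L = L_param \<Phi> \<Lambda>"
  then interpret block_instance d m n X Bs \<epsilon> \<delta> \<Phi> \<Lambda> L
    by unfold_locales auto
  show "(\<forall>\<sigma> \<in> space (shift_measure Bs X).
         real (time (block_quadsketch L \<Lambda> Bs X \<sigma>))
           \<le> 300 * real (n * d * L) * (log 2 (real (n * d * L))) ^ 1 \<and>
         real (sketch_bits (val (block_quadsketch L \<Lambda> Bs X \<sigma>)))
           \<le> 27 * (real (n * d * \<Lambda>) + real (n * m) * log 2 (real n))) \<and>
      (\<forall>i<n.
         measure (shift_measure Bs X)
           {\<sigma> \<in> space (shift_measure Bs X).
              let x' = decompress L n Bs (val (block_quadsketch L \<Lambda> Bs X \<sigma>)) in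
              \<forall>j<n. (1 - \<epsilon>) * vdist (X ! i) (X ! j) \<le> vdist (x' i) (x' j) \<and>
                    vdist (x' i) (x' j) \<le> (1 + \<epsilon>) * vdist (X ! i) (X ! j)}
         \<ge> 1 - real m * \<delta>)"
    using time_bound size_bound preserved_probability[unfolded preserved_def]
    unfolding Let_def by blast
qed

end
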